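(* Let $K$ be a non-trivial knot or a non-split link (with at least two components), and let $D^t$ be a triple-crossing diagram of $K$. Let $t_1,t_2,t_3,t_4$ be the numbers of disjoint tangles of types $T_1,T_2,T_3,T_4$, respectively, embedded in the graph corresponding to $D^t$. Then $$t_1+t_2+t_3+t_4\geq 1,$$ i.e. the projection underlying $D^t$ contains at least one tangle of one of the types $T_1,T_2,T_3,T_4$.
   Context: A projection of a knot or link is its image under the standard projection $\pi:\mathbb{R}^3\to\mathbb{R}^2$ (or into a 2-sphere), having only finitely many self-intersections (multiple-points), at each of which the strands are pairwise transverse. A triple-point projection is a projection all of whose multiple-points have multiplicity three. A triple-crossing diagram is a triple-point projection in which, at each triple point, the three strands are labeled $T$ (top), $M$ (middle), $B$ (bottom): near that point the preimage of the strand $T$ lies above that of $M$, which lies above that of $B$. Tangle types: the graph corresponding to a triple-crossing diagram is its projection viewed as a planar (spherical) graph whose vertices are the triple points, each of degree 6. An $m$-gon is a face whose boundary walk has $m$ edges, the outer region counting as a face; monogon, bigon, triangle mean $m=1,2,3$. The four types are the following configurations of triple points and faces (taken with a neighbourhood): - $T_1$: one triple point with a loop edge bounding a monogon. - $T_2$: two distinct triple points and two bigons sharing a common edge (so the two triple points are joined by three edges consecutive around each of them). - $T_3$: a bigon and a triangle sharing a common edge. - $T_4$: three bigons adjacent along three consecutive edges of the boundary walk of one common $m$-gon with $m\geq 4$. *)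

theory Defs
  imports "HOL-Analysis.Analysis"
begin

text \<open>
  Space is the product of the plane, written as the complex numbers, and a vertical axis.
  The standard projection is \<^const>\<open>fst\<close> and the height of a point is \<^const>\<open>snd\<close>.
\<close>

type_synonym R3 = "complex \<times> real"


section \<open>Knots and links\<close>

text \<open>Closed curves are parametrised with period 1; smooth means regular of class C1.\<close>

definition knot_param :: "(real \<Rightarrow> R3) \<Rightarrow> bool" where
  "knot_param \<gamma> \<longleftrightarrow>
     (\<forall>s. \<gamma> (s + 1) = \<gamma> s) \<and>
     \<gamma> C1_differentiable_on UNIV \<and>
     (\<forall>s. vector_derivative \<gamma> (at s) \<noteq> 0) \<and>
     inj_on \<gamma> {0..<1}"

definition link_param :: "nat \<Rightarrow> (nat \<Rightarrow> real \<Rightarrow> R3) \<Rightarrow> bool" where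
  "link_param n \<gamma> \<longleftrightarrow>
     (\<forall>i<n. knot_param (\<gamma> i)) \<and>
     (\<forall>i<n. \<forall>j<n. i \<noteq> j \<longrightarrow> range (\<gamma> i) \<inter> range (\<gamma> j) = {})"

definition link_image :: "nat \<Rightarrow> (nat \<Rightarrow> real \<Rightarrow> R3) \<Rightarrow> R3 set" where
  "link_image n \<gamma> = (\<Union>i<n. range (\<gamma> i))"

definition is_link :: "nat \<Rightarrow> R3 set \<Rightarrow> bool" where
  "is_link n K \<longleftrightarrow> (\<exists>\<gamma>. link_param n \<gamma> \<and> K = link_image n \<gamma>)"

definition is_knot :: "R3 set \<Rightarrow> bool" where
  "is_knot K \<longleftrightarrow> is_link 1 K"

definition ambient_isotopic :: "R3 set \<Rightarrow> R3 set \<Rightarrow> bool" where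
  "ambient_isotopic K K' \<longleftrightarrow>
     (\<exists>H. continuous_on ({0..1} \<times> UNIV) (\<lambda>(t::real, x). H t x) \<and>
          (\<forall>t\<in>{0..1}. \<exists>g. homeomorphism UNIV UNIV (H t) g) \<and>
          H 0 = id \<and> H 1 ` K = K')"

definition trivial_knot :: "R3 set \<Rightarrow> bool" where
  "trivial_knot K \<longleftrightarrow> ambient_isotopic K {(z, 0) |z. cmod z = 1}"

text \<open>
  A link is split if some 2-sphere in its complement has parts of the link on both sides.
  The sphere is tame: it is the image of the unit sphere under a homeomorphism of space, so that
  its two sides are the images of the open unit ball and of the exterior of the closed unit ball.
\<close>

definition split_link :: "R3 set \<Rightarrow> bool" where
  "split_link K \<longleftrightarrow>
     (\<exists>(h :: R3 \<Rightarrow> R3) g. homeomorphism UNIV UNIV h g \<and>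
            K \<inter> h ` sphere 0 1 = {} \<and>
            K \<inter> h ` ball 0 1 \<noteq> {} \<and>
            K \<inter> h ` (- cball 0 1) \<noteq> {})"


section \<open>Triple-crossing diagrams\<close>

datatype level = Top | Middle | Bottom

text \<open>
  A strand is a pair of a component and a parameter in \<open>{0..<1}\<close>. The labels of strands
  are meaningful only at the multiple points.
\<close>

type_synonym strand = "nat \<times> real"

record diagram =
  ncomp :: nat
  curve :: "nat \<Rightarrow> real \<Rightarrow> complex"
  label :: "strand \<Rightarrow> level"

definition projection_image :: "diagram \<Rightarrow> complex set" where
  "projection_image D = (\<Union>i<ncomp D. range (curve D i))"

definition point_of :: "diagram \<Rightarrow> strand \<Rightarrow> complex" where
  "point_of D a = curve D (fst a) (snd a)"

definition tangent :: "diagram \<Rightarrow> strand \<Rightarrow> complex" where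
  "tangent D a = vector_derivative (curve D (fst a)) (at (snd a))"

definition strands :: "diagram \<Rightarrow> complex \<Rightarrow> strand set" where
  "strands D p = {a \<in> {..<ncomp D} \<times> {0..<1}. point_of D a = p}"

definition multiple_points :: "diagram \<Rightarrow> complex set" where
  "multiple_points D = {p. \<exists>a\<in>strands D p. \<exists>b\<in>strands D p. a \<noteq> b}"

definition transverse :: "complex \<Rightarrow> complex \<Rightarrow> bool" where
  "transverse u v \<longleftrightarrow> \<not> collinear {0, u, v}"

definition projection :: "diagram \<Rightarrow> bool" where
  "projection D \<longleftrightarrow>
     finite (multiple_points D) \<and>
     (\<forall>p\<in>multiple_points D. pairwise (\<lambda>a b. transverse (tangent D a) (tangent D b)) (strands D p))"

definition triple_point_projection :: "diagram \<Rightarrow> bool" where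
  "triple_point_projection D \<longleftrightarrow>
     projection D \<and> (\<forall>p\<in>multiple_points D. card (strands D p) = 3)"

definition projects_to :: "(nat \<Rightarrow> real \<Rightarrow> R3) \<Rightarrow> diagram \<Rightarrow> bool" where
  "projects_to \<gamma> D \<longleftrightarrow> (\<forall>i<ncomp D. \<forall>s. curve D i s = fst (\<gamma> i s))"

definition height :: "(nat \<Rightarrow> real \<Rightarrow> R3) \<Rightarrow> strand \<Rightarrow> real" where
  "height \<gamma> a = snd (\<gamma> (fst a) (snd a))"

definition labels_by_height :: "(nat \<Rightarrow> real \<Rightarrow> R3) \<Rightarrow> diagram \<Rightarrow> bool" where
  "labels_by_height \<gamma> D \<longleftrightarrow>
     (\<forall>p\<in>multiple_points D.
        bij_betw (label D) (strands D p) UNIV \<and>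
        (\<forall>a\<in>strands D p. \<forall>b\<in>strands D p.
           (label D a, label D b) \<in> {(Top, Middle), (Middle, Bottom)} \<longrightarrow>
           height \<gamma> b < height \<gamma> a))"

text \<open>
  Knots and links are considered up to ambient isotopy: a diagram of \<open>K\<close> is obtained by
  projecting some representative of the isotopy class of \<open>K\<close>.
\<close>

definition triple_crossing_diagram_of :: "diagram \<Rightarrow> R3 set \<Rightarrow> bool" where
  "triple_crossing_diagram_of D K \<longleftrightarrow>
     (\<exists>\<gamma>. link_param (ncomp D) \<gamma> \<and> ambient_isotopic K (link_image (ncomp D) \<gamma>) \<and>
          projects_to \<gamma> D \<and> triple_point_projection D \<and> labels_by_height \<gamma> D)"


section \<open>The graph of a diagram and its faces\<close>

text \<open>
  The vertices are the triple points, and an edge is an arc of a component between two consecutive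
  passages through triple points. A dart is an edge with a direction, given by the strand on which
  it starts and a flag saying whether it follows the parametrisation or runs against it. The darts
  \<open>d\<close> and \<open>opp D d\<close> are the two directions of the same edge. Only darts in \<open>darts D\<close> matter.
\<close>

type_synonym dart = "strand \<times> bool"

definition darts :: "diagram \<Rightarrow> dart set" where
  "darts D = {(a, b). \<exists>p\<in>multiple_points D. a \<in> strands D p}"

definition origin :: "diagram \<Rightarrow> dart \<Rightarrow> complex" where
  "origin D d = point_of D (fst d)"

definition direction :: "diagram \<Rightarrow> dart \<Rightarrow> complex" where
  "direction D d = (if snd d then tangent D (fst d) else - tangent D (fst d))"

definition crossing_params :: "diagram \<Rightarrow> nat \<Rightarrow> real set" where
  "crossing_params D i = {s \<in> {0..<1}. curve D i s \<in> multiple_points D}"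

text \<open>The wrap-around cases are the arcs that pass through the parameter 0.\<close>

definition next_param :: "diagram \<Rightarrow> nat \<Rightarrow> real \<Rightarrow> real" where
  "next_param D i s =
     (let A = {s' \<in> crossing_params D i. s < s'}
      in Min (if A = {} then crossing_params D i else A))"

definition prev_param :: "diagram \<Rightarrow> nat \<Rightarrow> real \<Rightarrow> real" where
  "prev_param D i s =
     (let A = {s' \<in> crossing_params D i. s' < s}
      in Max (if A = {} then crossing_params D i else A))"

fun opp :: "diagram \<Rightarrow> dart \<Rightarrow> dart" where
  "opp D ((i, s), True) = ((i, next_param D i s), False)"
| "opp D ((i, s), False) = ((i, prev_param D i s), True)"

text \<open>
  The next dart clockwise around the same vertex: the clockwise angle from \<open>d\<close> to \<open>d'\<close> is
  \<open>Arg2pi (direction D d / direction D d')\<close>.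
\<close>

definition rot_cw :: "diagram \<Rightarrow> dart \<Rightarrow> dart" where
  "rot_cw D d =
     arg_min_on (\<lambda>d'. Arg2pi (direction D d / direction D d'))
       {d' \<in> darts D. origin D d' = origin D d \<and> d' \<noteq> d}"

text \<open>
  Walk along \<open>d\<close> with a face on the left; at the end of \<open>d\<close> the boundary of this face continues
  along the first dart clockwise from the reversed \<open>d\<close>.
\<close>

definition walk_step :: "diagram \<Rightarrow> dart \<Rightarrow> dart" where
  "walk_step D d = rot_cw D (opp D d)"

definition faces :: "diagram \<Rightarrow> complex set set" where
  "faces D = components (- projection_image D)"

text \<open>
  A set \<open>f\<close> lies on the left of a dart if it contains an initial piece of every ray that starts
  at the origin of the dart in a direction slightly counterclockwise from the dart.
\<close>

definition on_left :: "diagram \<Rightarrow> dart \<Rightarrow> complex set \<Rightarrow> bool" where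
  "on_left D d f \<longleftrightarrow>
     (\<forall>\<^sub>F \<theta> in at_right 0. \<forall>\<^sub>F r in at_right 0.
        origin D d + of_real r * (cis \<theta> * direction D d) \<in> f)"

text \<open>
  A boundary walk is recorded as its set of darts, whose cyclic order is given by
  \<^const>\<open>walk_step\<close>. An edge with the face on both sides contributes two darts.
\<close>

definition boundary_walk :: "diagram \<Rightarrow> complex set \<Rightarrow> dart set \<Rightarrow> bool" where
  "boundary_walk D f W \<longleftrightarrow>
     f \<in> faces D \<and>
     (\<exists>d\<in>darts D. W = range (\<lambda>k. (walk_step D ^^ k) d)) \<and>
     (\<forall>d\<in>W. on_left D d f)"

text \<open>
  A polygon is a face together with its boundary walk. (A face has a single boundary walk
  whenever the projection is connected.)
\<close>

definition gons :: "diagram \<Rightarrow> nat \<Rightarrow> (complex set \<times> dart set) set" where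
  "gons D m = {(f, W). boundary_walk D f W \<and> card W = m}"


section \<open>Tangles\<close>

text \<open>
  A tangle is represented by the closed region covered by its monogon, bigons and triangle, which
  contains the triple points of the configuration. As these regions are closed, two of them have
  disjoint neighbourhoods if and only if they are disjoint. The common polygon in the fourth type
  can be arbitrarily large and is not part of the tangle.
\<close>

definition tangles1 :: "diagram \<Rightarrow> complex set set" where
  "tangles1 D = {closure f |f W. (f, W) \<in> gons D 1}"

definition tangles2 :: "diagram \<Rightarrow> complex set set" where
  "tangles2 D =
     {closure f \<union> closure g |f g W X d.
        (f, W) \<in> gons D 2 \<and> (g, X) \<in> gons D 2 \<and> (f, W) \<noteq> (g, X) \<and>
        d \<in> W \<and> opp D d \<in> X \<and> origin D d \<noteq> origin D (opp D d)}"

definition tangles3 :: "diagram \<Rightarrow> complex set set" where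
  "tangles3 D =
     {closure f \<union> closure g |f g W X d.
        (f, W) \<in> gons D 2 \<and> (g, X) \<in> gons D 3 \<and> d \<in> W \<and> opp D d \<in> X}"

definition tangles4 :: "diagram \<Rightarrow> complex set set" where
  "tangles4 D =
     {closure f0 \<union> closure f1 \<union> closure f2 |f0 f1 f2 W0 W1 W2 g X m d.
        {(f0, W0), (f1, W1), (f2, W2)} \<subseteq> gons D 2 \<and> distinct [(f0, W0), (f1, W1), (f2, W2)] \<and>
        4 \<le> m \<and> (g, X) \<in> gons D m \<and> d \<in> X \<and>
        opp D d \<in> W0 \<and>
        opp D (walk_step D d) \<in> W1 \<and>
        opp D (walk_step D (walk_step D d)) \<in> W2}"

definition disjoint_number :: "complex set set \<Rightarrow> nat" where
  "disjoint_number \<T> = Max {card \<F> |\<F>. \<F> \<subseteq> \<T> \<and> finite \<F> \<and> pairwise disjnt \<F>}"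

definition t1 :: "diagram \<Rightarrow> nat" where "t1 D = disjoint_number (tangles1 D)"
definition t2 :: "diagram \<Rightarrow> nat" where "t2 D = disjoint_number (tangles2 D)"
definition t3 :: "diagram \<Rightarrow> nat" where "t3 D = disjoint_number (tangles3 D)"
definition t4 :: "diagram \<Rightarrow> nat" where "t4 D = disjoint_number (tangles4 D)"

end

theory Submission
  imports Defs "HOL-Complex_Analysis.Complex_Analysis"
begin

text \<open>
  Suppose that the diagram has \<open>V > 0\<close> triple points. All vertices have degree six, so there are \<open>3 V\<close>
  edges, and a plane graph with that many edges has more than \<open>2 V\<close> faces. As the degrees \<open>m\<close> of the
  faces add up to \<open>6 V\<close>, the sum of \<open>3 - m\<close> over all faces is positive. Monogons are tangles of the
  first type; without them the surplus comes from bigons alone. If no bigon borders a bigon (type two)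
  or a triangle (type three), each bigon hands half of its surplus across each of its edges to a face
  with \<open>m \<ge> 4\<close> edges. Such a face lacks \<open>m - 3\<close>, which absorbs all it is given unless at least \<open>m - 1\<close>
  of its edges border bigons; but then three consecutive edges do (type four). This is
  \<open>discharging\<close>. The distinctness conditions in the types two and four hold because every
  degenerate configuration contains a monogon.

  Triple points exist by the hypothesis on \<open>K\<close> (\<open>multiple_points_exist\<close>). Without them the components
  have disjoint simple shadows, and heights can be changed freely. If there are several components, one
  is lifted above the others, and the link is split. If there is one, it is lifted so that its height
  has a single maximum and a single minimum; each level then contains two points, which are moved level by
  level to those of a round circle, and the knot is trivial.

  The rest is the topology of the graph. The curves are smooth, but their projections may stop away from
  the triple points, where an edge is just a Jordan arc. It has to be shown that a boundary walk, which is
  defined by turning at the vertices, follows one face (\<open>left_walk_step\<close>), and that there are enough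
  faces (\<open>euler_inequality\<close>). Both use winding functions. A flow on the graph assigns to each dart a
  real number, opposite numbers to opposite darts, with sum zero at every vertex. The winding
  numbers of the edges, weighted by a flow, add up to a function that is constant on every face
  (\<open>winding_constant_on_face\<close>) and jumps across an edge by twice its coefficient
  (\<open>winding_jump\<close>).

  For the boundary walks, the two sides of an edge are visible explicitly near a triple point, because the
  tangent does not vanish there. By Janiszewski's theorem an edge borders the same faces at both ends.
  The only doubt is whether the two sides are exchanged on the way, and then the jump of a winding
  function would change its sign. For the number of faces, a flow is recovered from the jumps of its
  winding function, and so it is a combination of boundary walks. A flow that is orthogonal to all boundary
  walks therefore vanishes, and this bounds the number of edges by that of the vertices and faces.
\<close>


section \<open>Ambient isotopies\<close>

lemma ambient_isotopicI:
  assumes cont: "continuous_on ({0..1} \<times> UNIV) (\<lambda>(t::real, x). H t x)"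
    and cont': "\<And>t. t \<in> {0..1} \<Longrightarrow> continuous_on UNIV (G t)"
    and GH: "\<And>t x. t \<in> {0..1} \<Longrightarrow> G t (H t x) = x"
    and HG: "\<And>t x. t \<in> {0..1} \<Longrightarrow> H t (G t x) = x"
    and "\<And>x. H 0 x = x" "H 1 ` K = K'"
  shows "ambient_isotopic K K'"
  unfolding ambient_isotopic_def
proof (intro exI[of _ H] conjI ballI)
  fix t :: real assume t: "t \<in> {0..1}"
  have "continuous_on UNIV (\<lambda>x. (t, x))" by (intro continuous_intros)
  moreover have "continuous_on (range (\<lambda>x. (t, x))) (\<lambda>(t, x). H t x)"
    by (rule continuous_on_subset[OF cont]) (use t in auto)
  ultimately have "continuous_on UNIV (H t)"
    using continuous_on_compose[of UNIV "\<lambda>x. (t, x)" "\<lambda>(t, x). H t x"] by (simp add: comp_def)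
  moreover have "surj (H t)" "surj (G t)" using GH[OF t] HG[OF t] by (metis surjI)+
  ultimately show "\<exists>g. homeomorphism UNIV UNIV (H t) g"
    using cont'[OF t] GH[OF t] HG[OF t] by (intro exI[of _ "G t"]) (simp add: homeomorphism_def)
qed (use assms in auto)

lemma ambient_isotopic_trans:
  assumes "ambient_isotopic K L" "ambient_isotopic L M"
  shows "ambient_isotopic K M"
proof -
  obtain F where F: "continuous_on ({0..1} \<times> UNIV) (\<lambda>(t::real, x). F t x)"
    "\<forall>t\<in>{0..1}. \<exists>g. homeomorphism UNIV UNIV (F t) g" "F 0 = id" "F 1 ` K = L"
    using assms(1) unfolding ambient_isotopic_def by blast
  obtain G where G: "continuous_on ({0..1} \<times> UNIV) (\<lambda>(t::real, x). G t x)"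
    "\<forall>t\<in>{0..1}. \<exists>g. homeomorphism UNIV UNIV (G t) g" "G 0 = id" "G 1 ` L = M"
    using assms(2) unfolding ambient_isotopic_def by blast
  have "continuous_on ({0..1} \<times> UNIV) (\<lambda>p. (fst p, (\<lambda>(t, x). F t x) p))"
    by (intro continuous_on_Pair continuous_on_fst continuous_on_id F(1))
  moreover have "continuous_on ((\<lambda>p. (fst p, (\<lambda>(t, x). F t x) p)) ` ({0..1} \<times> UNIV)) (\<lambda>(t, x). G t x)"
    by (rule continuous_on_subset[OF G(1)]) auto
  ultimately have "continuous_on ({0..1} \<times> UNIV) ((\<lambda>(t, x). G t x) \<circ> (\<lambda>p. (fst p, (\<lambda>(t, x). F t x) p)))"
    by (rule continuous_on_compose)
  then have 1: "continuous_on ({0..1} \<times> UNIV) (\<lambda>(t, x). (G t \<circ> F t) x)"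
    by (simp add: comp_def case_prod_unfold)
  show ?thesis
    unfolding ambient_isotopic_def
  proof (intro exI[of _ "\<lambda>t. G t \<circ> F t"] conjI ballI 1)
    show "\<exists>g. homeomorphism UNIV UNIV (G t \<circ> F t) g" if "t \<in> {0..1}" for t
      using F(2) G(2) homeomorphism_compose that by meson
    show "(G 1 \<circ> F 1) ` K = M" by (metis F(4) G(4) image_comp)
  qed (use F(3) G(3) in auto)
qed

lemma ambient_isotopic_imp_homeomorphism:
  assumes "ambient_isotopic K L"
  obtains h g where "homeomorphism UNIV UNIV h g" "h ` K = L"
  using assms unfolding ambient_isotopic_def by (metis atLeastAtMost_iff le_numeral_extra(4) zero_less_one_class.zero_le_one)

lemma ambient_isotopic_vertical_shear:
  fixes g :: "complex \<Rightarrow> real"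
  assumes g: "continuous_on UNIV g"
  shows "ambient_isotopic K ((\<lambda>(z, x). (z, x + g z)) ` K)"
proof (rule ambient_isotopicI[where H = "\<lambda>t (z, x). (z, x + t * g z)" and G = "\<lambda>t (z, x). (z, x - t * g z)"])
  show "continuous_on ({0..1} \<times> UNIV) (\<lambda>(t, y). case y of (z, x) \<Rightarrow> (z, x + t * g z))"
    unfolding case_prod_unfold
    by (intro continuous_intros continuous_on_compose2[OF g]) auto
  show "continuous_on UNIV (\<lambda>(z, x). (z, x - t * g z))" for t
    unfolding case_prod_unfold by (intro continuous_intros continuous_on_compose2[OF g]) auto
qed auto

lemma ambient_isotopic_horizontal_shear:
  fixes c :: "real \<Rightarrow> complex"
  assumes c: "continuous_on UNIV c"
  shows "ambient_isotopic K ((\<lambda>(z, x). (z + c x, x)) ` K)"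
proof (rule ambient_isotopicI[where H = "\<lambda>t (z, x). (z + t *\<^sub>R c x, x)" and G = "\<lambda>t (z, x). (z - t *\<^sub>R c x, x)"])
  show "continuous_on ({0..1} \<times> UNIV) (\<lambda>(t, y). case y of (z, x) \<Rightarrow> (z + t *\<^sub>R c x, x))"
    unfolding case_prod_unfold
    by (intro continuous_intros continuous_on_compose2[OF c]) auto
  show "continuous_on UNIV (\<lambda>(z, x). (z - t *\<^sub>R c x, x))" for t
    unfolding case_prod_unfold by (intro continuous_intros continuous_on_compose2[OF c]) auto
qed auto

text \<open>
  The two isotopies below are given at each level \<open>t\<close> between \<open>-1\<close> and \<open>1\<close> by formulas that degenerate at
  \<open>t = -1\<close> and \<open>t = 1\<close>. They extend continuously over these levels because they move points by
  less and less. Here \<open>e\<close> bounds the motion and \<open>U\<close> is the set of the good levels.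
\<close>

lemma continuous_on_if_close_to_continuous:
  fixes F G :: "'a::metric_space \<Rightarrow> 'b::metric_space" and e :: "'a \<Rightarrow> real"
  assumes "open U" "continuous_on U F" "continuous_on UNIV G" "continuous_on UNIV e"
    and close: "\<And>x. dist (F x) (G x) \<le> e x" and zero: "\<And>x. x \<notin> U \<Longrightarrow> e x = 0"
  shows "continuous_on UNIV F"
  unfolding continuous_on_eq_continuous_at[OF open_UNIV]
proof
  fix x :: 'a
  show "isCont F x"
  proof (cases "x \<in> U")
    case True
    then show ?thesis using assms(1,2) continuous_on_eq_continuous_at by blast
  next
    case False
    have e: "(e \<longlongrightarrow> 0) (at x)"
      using assms(4) zero[OF False] by (metis continuous_on_def UNIV_I)
    have G: "(G \<longlongrightarrow> G x) (at x)" using assms(3) by (metis continuous_on_def UNIV_I)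
    have "((\<lambda>y. dist (F y) (G y)) \<longlongrightarrow> 0) (at x)"
      by (rule tendsto_sandwich[OF _ _ tendsto_const e]) (use close in auto)
    then have d: "((\<lambda>y. dist (F y) (G y) + dist (G y) (G x)) \<longlongrightarrow> 0) (at x)"
      using tendsto_add[OF _ tendsto_dist[OF G tendsto_const, of "G x"]] by force
    have "((\<lambda>y. dist (F y) (G x)) \<longlongrightarrow> 0) (at x)"
      by (rule tendsto_sandwich[OF _ _ tendsto_const d]) (auto simp: dist_triangle)
    moreover have "F x = G x" using close[of x] zero[OF False] by simp
    ultimately show ?thesis using tendsto_dist_iff[of F "F x" "at x"] by (simp add: isCont_def)
  qed
qed

text \<open>
  Each level is turned back by an argument of \<open>w t\<close>, chosen continuously in \<open>t\<close>, on the disc of radius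
  \<open>cmod (w t)\<close>; the angle dies out at twice that radius. The argument may be unbounded near
  \<open>t = -1\<close> and \<open>t = 1\<close>, but the discs shrink to a point there.
\<close>

lemma ambient_isotopic_twist:
  fixes w :: "real \<Rightarrow> complex"
  assumes w: "continuous_on UNIV w" and nz: "\<And>t. t \<in> {-1<..<1} \<Longrightarrow> w t \<noteq> 0"
    and z: "\<And>t. t \<notin> {-1<..<1} \<Longrightarrow> w t = 0"
  shows "ambient_isotopic {(s * w t, t) |s t. s \<in> {1, -1} \<and> t \<in> {-1..1}}
    {(s * of_real (cmod (w t)), t) |s t. s \<in> {1, -1} \<and> t \<in> {-1..1}}"
proof -
  obtain l where l: "continuous_on {-1<..<1} l" "\<And>t. t \<in> {-1<..<1} \<Longrightarrow> w t = exp (l t)"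
    using continuous_logarithm_on_contractible[of "{-1<..<1::real}" w] nz
      continuous_on_subset[OF w] convex_imp_contractible[of "{-1<..<1::real}"] by auto
  \<comment> \<open>the angle at distance \<open>x\<close> from the axis, before the factor for the time \<open>\<tau>\<close>\<close>
  define A where "A t x = (if t \<in> {-1<..<1} then Im (l t) * max 0 (min 1 (2 - x / cmod (w t))) else 0)"
    for t x :: real
  define T where "T \<tau> = (\<lambda>(z, t). (z * cis (- (\<tau> * A t (cmod z))), t))" for \<tau> :: real
  have T: "continuous_on UNIV (\<lambda>p. fst (snd p) * cis (- (fst p * A (snd (snd p)) (cmod (fst (snd p))))))"
    (is "continuous_on UNIV ?F")
  proof (rule continuous_on_if_close_to_continuous)
    let ?U = "{p::real \<times> complex \<times> real. snd (snd p) \<in> {-1<..<1}}"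
    show "open ?U"
      using open_vimage[of "{-1<..<1::real}" "\<lambda>p::real \<times> complex \<times> real. snd (snd p)"]
      by (simp add: vimage_def continuous_on_snd continuous_on_id)
    have "continuous_on ?U (\<lambda>p. fst (snd p) * cis (- (fst p * (Im (l (snd (snd p))) *
        max 0 (min 1 (2 - cmod (fst (snd p)) / cmod (w (snd (snd p)))))))))"
      by (intro continuous_intros continuous_on_compose2[OF l(1)] continuous_on_compose2[OF w]) (use nz in auto)
    then show "continuous_on ?U ?F"
      by (rule continuous_on_eq) (auto simp: A_def)
    show "continuous_on UNIV (\<lambda>p::real \<times> complex \<times> real. fst (snd p))" by (intro continuous_intros)
    show "continuous_on UNIV (\<lambda>p::real \<times> complex \<times> real. 4 * cmod (w (snd (snd p))))"
      by (intro continuous_intros continuous_on_compose2[OF w]) auto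
    show "4 * cmod (w (snd (snd p))) = 0" if "p \<notin> ?U" for p :: "real \<times> complex \<times> real"
      using that z by auto
    show "dist (?F p) (fst (snd p)) \<le> 4 * cmod (w (snd (snd p)))" for p :: "real \<times> complex \<times> real"
    proof (cases "snd (snd p) \<in> {-1<..<1} \<and> cmod (fst (snd p)) < 2 * cmod (w (snd (snd p)))")
      case True
      have "dist (?F p) (fst (snd p)) \<le> norm (?F p) + norm (fst (snd p))"
        by (metis dist_norm norm_triangle_ineq4)
      also have "\<dots> = 2 * cmod (fst (snd p))" by (simp add: norm_mult)
      finally show ?thesis using True by simp
    next
      case False
      have "2 - cmod (fst (snd p)) / cmod (w (snd (snd p))) \<le> 0" if "snd (snd p) \<in> {-1<..<1}"
        using False that nz[OF that] by (simp add: field_simps)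
      then have "A (snd (snd p)) (cmod (fst (snd p))) = 0" by (auto simp: A_def max_def)
      then show ?thesis by simp
    qed
  qed
  have T': "continuous_on S (\<lambda>p. f p * cis (- (g p * A (h p) (cmod (f p)))))"
    if "continuous_on S f" "continuous_on S g" "continuous_on S h"
    for f :: "'c::topological_space \<Rightarrow> complex" and g h :: "'c \<Rightarrow> real" and S
  proof -
    have "continuous_on S (\<lambda>p. (g p, f p, h p))" by (intro continuous_intros that)
    then show ?thesis using continuous_on_compose2[OF T, of S "\<lambda>p. (g p, f p, h p)"] by simp
  qed
  show ?thesis
  proof (rule ambient_isotopicI[where H = T and G = "\<lambda>\<tau>. T (- \<tau>)"])
    show "continuous_on ({0..1} \<times> UNIV) (\<lambda>(\<tau>, x). T \<tau> x)"
      unfolding T_def case_prod_unfold by (intro continuous_intros T')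
    show "continuous_on UNIV (T (- \<tau>))" for \<tau>
      unfolding T_def case_prod_unfold by (intro continuous_intros T')
    show "T (- \<tau>) (T \<tau> x) = x" "T \<tau> (T (- \<tau>) x) = x" for \<tau> x
      by (cases x; simp add: T_def norm_mult mult.assoc cis_mult)+
    show "T 0 x = x" for x by (cases x) (simp add: T_def)
    have e: "T 1 (s * w t, t) = (s * of_real (cmod (w t)), t)" if "s \<in> {1, -1}" "t \<in> {-1..1}" for s t
    proof (cases "t \<in> {-1<..<1}")
      case True
      have s: "cmod s = 1" using that by auto
      have "exp (l t) * cis (- Im (l t)) = of_real (exp (Re (l t)))"
        by (subst exp_eq_polar) (simp add: mult.assoc cis_mult exp_of_real)
      then show ?thesis using True nz[OF True] l(2)[OF True] s
        by (simp add: T_def A_def norm_mult mult.assoc)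
    next
      case False
      then show ?thesis using z[OF False] by (simp add: T_def)
    qed
    show "T 1 ` {(s * w t, t) |s t. s \<in> {1, -1} \<and> t \<in> {-1..1}} =
        {(s * of_real (cmod (w t)), t) |s t. s \<in> {1, -1} \<and> t \<in> {-1..1}}" (is "T 1 ` ?X = ?Y")
    proof
      show "T 1 ` ?X \<subseteq> ?Y" using e by blast
      show "?Y \<subseteq> T 1 ` ?X"
      proof
        fix y assume "y \<in> ?Y"
        then obtain s t where st: "s \<in> {1, -1}" "t \<in> {-1..1}" "y = (s * of_real (cmod (w t)), t)" by blast
        then have "y = T 1 (s * w t, t)" using e by simp
        then show "y \<in> T 1 ` ?X" using st by blast
      qed
    qed
  qed
qed

text \<open>
  The real coordinate is shifted by the odd function that is linear on \<open>[-a t, a t]\<close>, so that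
  \<open>a t\<close> goes to \<open>b t\<close>, and constant on either side of this interval.
\<close>

lemma ambient_isotopic_stretch:
  fixes a b :: "real \<Rightarrow> real"
  assumes a: "continuous_on UNIV a" and b: "continuous_on UNIV b"
    and pos: "\<And>t. t \<in> {-1<..<1} \<Longrightarrow> a t > 0 \<and> b t > 0"
    and z: "\<And>t. t \<notin> {-1<..<1} \<Longrightarrow> a t = 0 \<and> b t = 0"
  shows "ambient_isotopic {(s * of_real (a t), t) |s t. s \<in> {1, -1} \<and> t \<in> {-1..1}}
    {(s * of_real (b t), t) |s t. s \<in> {1, -1} \<and> t \<in> {-1..1}}"
proof -
  define cl where "cl x = max (-1) (min 1 x)" for x :: real
  define c where "c \<tau> t = (1 - \<tau>) * a t + \<tau> * b t" for \<tau> t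
  have cpos: "c \<tau> t > 0" if "\<tau> \<in> {0..1}" "t \<in> {-1<..<1}" for \<tau> t
    using pos[OF that(2)] that(1) unfolding c_def
    by (cases "\<tau> = 0") (auto intro: add_nonneg_pos)
  define S where "S \<tau> = (\<lambda>(z, t). (z + of_real (\<tau> * (b t - a t) * cl (Re z / a t)), t))" for \<tau> :: real
  define R where "R \<tau> = (\<lambda>(z, t). (z - of_real (\<tau> * (b t - a t) * cl (Re z / c \<tau> t)), t))" for \<tau> :: real
  have cl: "continuous_on X (\<lambda>x. cl (f x))" if "continuous_on X f"
    for X :: "'z::topological_space set" and f
    unfolding cl_def by (intro continuous_intros that)
  have clb: "\<bar>cl x\<bar> \<le> 1" for x by (auto simp: cl_def)
  have cont: "continuous_on UNIV (\<lambda>p. fst (snd p) + of_real (fst p * (b (snd (snd p)) - a (snd (snd p)))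
       * cl (Re (fst (snd p)) / m (snd (snd p)))))" (is "continuous_on UNIV ?F")
    if m: "continuous_on UNIV m" and mpos: "\<And>t. t \<in> {-1<..<1} \<Longrightarrow> m t \<noteq> 0" for m
  proof (rule continuous_on_if_close_to_continuous)
    let ?U = "{p::real \<times> complex \<times> real. snd (snd p) \<in> {-1<..<1}}"
    show "open ?U"
      using open_vimage[of "{-1<..<1::real}" "\<lambda>p::real \<times> complex \<times> real. snd (snd p)"]
      by (simp add: vimage_def continuous_on_snd continuous_on_id)
    show "continuous_on ?U ?F"
      by (intro continuous_intros cl continuous_on_compose2[OF a] continuous_on_compose2[OF b]
          continuous_on_compose2[OF m]) (use mpos in auto)
    show "continuous_on UNIV (\<lambda>p::real \<times> complex \<times> real. fst (snd p))" by (intro continuous_intros)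
    show "continuous_on UNIV (\<lambda>p::real \<times> complex \<times> real. \<bar>fst p * (b (snd (snd p)) - a (snd (snd p)))\<bar>)"
      by (intro continuous_intros continuous_on_compose2[OF a] continuous_on_compose2[OF b]) auto
    show "\<bar>fst p * (b (snd (snd p)) - a (snd (snd p)))\<bar> = 0" if "p \<notin> ?U" for p :: "real \<times> complex \<times> real"
      using that z[of "snd (snd p)"] by auto
    show "dist (?F p) (fst (snd p)) \<le> \<bar>fst p * (b (snd (snd p)) - a (snd (snd p)))\<bar>"
      for p :: "real \<times> complex \<times> real"
      using mult_left_mono[OF clb, of "\<bar>fst p * (b (snd (snd p)) - a (snd (snd p)))\<bar>"]
      by (simp add: dist_norm abs_mult flip: of_real_mult)
  qed
  have clin: "\<tau> * (b t - a t) * cl (x / a t) = \<tau> * (b t - a t) * cl ((x + \<tau> * (b t - a t) * cl (x / a t)) / c \<tau> t)"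
    if t: "t \<in> {-1<..<1}" and \<tau>: "\<tau> \<in> {0..1}" for t x \<tau>
  proof -
    have p: "a t > 0" "c \<tau> t > 0" using pos[OF t] cpos[OF \<tau> t] by auto
    have ce: "c \<tau> t = a t + \<tau> * (b t - a t)" by (simp add: c_def algebra_simps)
    have "cl (x / a t) = cl ((x + \<tau> * (b t - a t) * cl (x / a t)) / c \<tau> t)"
    proof -
      consider "x / a t \<ge> 1" | "x / a t \<le> -1" | "-1 < x / a t" "x / a t < 1" by linarith
      then show ?thesis
      proof cases
        case 1
        then have "x \<ge> a t" "cl (x / a t) = 1" using p by (auto simp: cl_def field_simps)
        moreover then have "(x + \<tau> * (b t - a t)) / c \<tau> t \<ge> 1" using p ce by (simp add: field_simps)
        ultimately show ?thesis by (simp add: cl_def)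
      next
        case 2
        then have "x \<le> - a t" "cl (x / a t) = -1" using p by (auto simp: cl_def field_simps)
        moreover then have "(x - \<tau> * (b t - a t)) / c \<tau> t \<le> -1" using p ce by (simp add: field_simps)
        ultimately show ?thesis by (simp add: cl_def)
      next
        case 3
        then have 4: "cl (x / a t) = x / a t" by (simp add: cl_def)
        have "(x + \<tau> * (b t - a t) * (x / a t)) = x / a t * c \<tau> t"
          using p unfolding ce by (simp add: field_simps)
        then show ?thesis using 4 p by simp
      qed
    qed
    then show ?thesis by simp
  qed
  have clin': "cl (y / c \<tau> t) = cl ((y - \<tau> * (b t - a t) * cl (y / c \<tau> t)) / a t)"
    if t: "t \<in> {-1<..<1}" and \<tau>: "\<tau> \<in> {0..1}" for t y \<tau>
  proof -
    have p: "a t > 0" "c \<tau> t > 0" using pos[OF t] cpos[OF \<tau> t] by auto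
    have ce: "a t = c \<tau> t - \<tau> * (b t - a t)" by (simp add: c_def algebra_simps)
    consider "y / c \<tau> t \<ge> 1" | "y / c \<tau> t \<le> -1" | "-1 < y / c \<tau> t" "y / c \<tau> t < 1" by linarith
    then show ?thesis
    proof cases
      case 1
      then have "y \<ge> c \<tau> t" "cl (y / c \<tau> t) = 1" using p by (auto simp: cl_def field_simps)
      moreover then have "(y - \<tau> * (b t - a t)) / a t \<ge> 1" using p ce by (simp add: field_simps)
      ultimately show ?thesis by (simp add: cl_def)
    next
      case 2
      then have "y \<le> - c \<tau> t" "cl (y / c \<tau> t) = -1" using p by (auto simp: cl_def field_simps)
      moreover then have "(y + \<tau> * (b t - a t)) / a t \<le> -1" using p ce by (simp add: field_simps)
      ultimately show ?thesis by (simp add: cl_def)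
    next
      case 3
      then have 4: "cl (y / c \<tau> t) = y / c \<tau> t" by (simp add: cl_def)
      define k where "k = \<tau> * (b t - a t)"
      have k: "a t = c \<tau> t - k" using ce by (simp add: k_def)
      have "y - k * (y / c \<tau> t) = y / c \<tau> t * a t"
        using p unfolding k by (simp add: field_simps)
      then show ?thesis using 4 p by (simp add: k_def)
    qed
  qed
  have cc: "continuous_on UNIV (c \<tau>)" for \<tau>
    unfolding c_def by (intro continuous_intros a b)
  show ?thesis
  proof (rule ambient_isotopicI[where H = S and G = R])
    have "a t \<noteq> 0" if "t \<in> {-1<..<1}" for t using pos[OF that] by simp
    from continuous_on_subset[OF cont[OF a this]]
    show "continuous_on ({0..1} \<times> UNIV) (\<lambda>(\<tau>, x). S \<tau> x)"
      unfolding S_def case_prod_unfold by (intro continuous_on_Pair continuous_on_snd continuous_on_id) auto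
    show "continuous_on UNIV (R \<tau>)" if \<tau>: "\<tau> \<in> {0..1}" for \<tau>
    proof -
      have "c \<tau> t \<noteq> 0" if "t \<in> {-1<..<1}" for t using cpos[OF \<tau> that] by simp
      moreover have "continuous_on UNIV (\<lambda>p::complex \<times> real. (-\<tau>, fst p, snd p))" by (intro continuous_intros)
      ultimately have "continuous_on UNIV (\<lambda>p::complex \<times> real. fst p + of_real ((-\<tau>) * (b (snd p) - a (snd p)) * cl (Re (fst p) / c \<tau> (snd p))))"
        using continuous_on_compose2[OF cont[OF cc[of \<tau>]], of UNIV "\<lambda>p. (-\<tau>, fst p, snd p)"] by simp
      then show ?thesis
        unfolding R_def case_prod_unfold by (intro continuous_on_Pair continuous_on_snd continuous_on_id) simp
    qed
    show "R \<tau> (S \<tau> x) = x" if "\<tau> \<in> {0..1}" for \<tau> x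
    proof (cases x)
      case (Pair y t)
      show ?thesis
      proof (cases "t \<in> {-1<..<1}")
        case True
        show ?thesis using clin[OF True that, of "Re y"]
          by (simp add: Pair S_def R_def flip: of_real_mult of_real_diff)
      next
        case False
        then show ?thesis using z[OF False] by (simp add: Pair S_def R_def)
      qed
    qed
    show "S \<tau> (R \<tau> x) = x" if "\<tau> \<in> {0..1}" for \<tau> x
    proof (cases x)
      case (Pair y t)
      show ?thesis
      proof (cases "t \<in> {-1<..<1}")
        case True
        show ?thesis using clin'[OF True that, of "Re y"]
          by (simp add: Pair S_def R_def flip: of_real_mult of_real_diff)
      next
        case False
        then show ?thesis using z[OF False] by (simp add: Pair S_def R_def)
      qed
    qed
    show "S 0 x = x" for x by (cases x) (simp add: S_def)
    have e: "S 1 (s * of_real (a t), t) = (s * of_real (b t), t)" if "s \<in> {1, -1}" "t \<in> {-1..1}" for s t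
    proof (cases "t \<in> {-1<..<1}")
      case True
      then show ?thesis using pos[OF True] that by (auto simp: S_def cl_def)
    next
      case False
      then show ?thesis using z[OF False] by (simp add: S_def)
    qed
    show "S 1 ` {(s * of_real (a t), t) |s t. s \<in> {1, -1} \<and> t \<in> {-1..1}} =
        {(s * of_real (b t), t) |s t. s \<in> {1, -1} \<and> t \<in> {-1..1}}" (is "S 1 ` ?X = ?Y")
    proof
      show "S 1 ` ?X \<subseteq> ?Y" using e by blast
      show "?Y \<subseteq> S 1 ` ?X"
      proof
        fix y assume "y \<in> ?Y"
        then obtain s t where st: "s \<in> {1, -1}" "t \<in> {-1..1}" "y = (s * of_real (b t), t)" by blast
        then have "y = S 1 (s * of_real (a t), t)" using e by simp
        then show "y \<in> S 1 ` ?X" using st by blast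
      qed
    qed
  qed
qed

lemma vertical_circle_trivial:
  "ambient_isotopic {(s * of_real (sqrt (1 - t\<^sup>2)), t) |s t. s \<in> {1, -1} \<and> t \<in> {-1..1}} {(z, 0) |z. cmod z = 1}"
proof -
  define R where "R \<tau> = (\<lambda>(z, t). (Complex (Re z) (cos (\<tau> * pi / 2) * Im z - sin (\<tau> * pi / 2) * t),
      sin (\<tau> * pi / 2) * Im z + cos (\<tau> * pi / 2) * t))" for \<tau> :: real
  show ?thesis
  proof (rule ambient_isotopicI[where H = R and G = "\<lambda>\<tau>. R (- \<tau>)"])
    show "continuous_on ({0..1} \<times> UNIV) (\<lambda>(\<tau>, x). R \<tau> x)"
      unfolding R_def case_prod_unfold by (intro continuous_intros continuous_on_Complex) auto
    show "continuous_on UNIV (R (- \<tau>))" for \<tau>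
      unfolding R_def case_prod_unfold by (intro continuous_intros continuous_on_Complex) auto
    have id: "c * (c * y - s * t) + s * (s * y + c * t) = y" "c * (s * y + c * t) - s * (c * y - s * t) = t"
      "c * (c * y + s * t) - s * (c * t - s * y) = y" "s * (c * y + s * t) + c * (c * t - s * y) = t"
      if "c\<^sup>2 + s\<^sup>2 = 1" for c s y t :: real
      using that by algebra+
    show "R (- \<tau>) (R \<tau> x) = x" for \<tau> x
      using id[of "cos (\<tau> * pi / 2)" "sin (\<tau> * pi / 2)" "Im (fst x)" "snd x"]
      by (cases x) (simp add: R_def complex_eq_iff)
    show "R \<tau> (R (- \<tau>) x) = x" for \<tau> x
      using id(3,4)[of "cos (\<tau> * pi / 2)" "sin (\<tau> * pi / 2)" "Im (fst x)" "snd x"]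
      by (cases x) (simp add: R_def complex_eq_iff algebra_simps)
    show "R 0 x = x" for x by (cases x) (simp add: R_def)
    show "R 1 ` {(s * of_real (sqrt (1 - t\<^sup>2)), t) |s t. s \<in> {1, -1} \<and> t \<in> {-1..1}} = {(z, 0) |z. cmod z = 1}"
      (is "R 1 ` ?X = ?Y")
    proof
      show "R 1 ` ?X \<subseteq> ?Y"
        by (auto simp: R_def cmod_def abs_square_le_1 abs_le_iff)
      show "?Y \<subseteq> R 1 ` ?X"
      proof
        fix y assume "y \<in> ?Y"
        then obtain z where z: "y = (z, 0)" "(Re z)\<^sup>2 + (Im z)\<^sup>2 = 1" by (auto simp: cmod_def)
        define t s where "t = - Im z" and "s = (if Re z \<ge> 0 then 1 else - 1 :: complex)"
        have "\<bar>t\<bar> \<le> 1" using z(2) by (metis abs_square_le_1 le_add_same_cancel2 power2_minus t_def zero_le_power2)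
        moreover have "sqrt (1 - t\<^sup>2) = \<bar>Re z\<bar>" using z(2) by (simp add: t_def flip: real_sqrt_abs)
        then have "R 1 (s * of_real (sqrt (1 - t\<^sup>2)), t) = y"
          by (simp add: R_def z(1) s_def t_def complex_eq_iff)
        ultimately show "y \<in> R 1 ` ?X" unfolding image_iff s_def
          by (intro bexI[of _ "(s * of_real (sqrt (1 - t\<^sup>2)), t)"]) (auto simp: abs_le_iff s_def)
      qed
    qed
  qed
qed

text \<open>
  Each level between the minimum and the maximum contains two points of the knot. A translation makes
  them symmetric to the axis, a twist makes them real, and a stretch moves them to those of a
  vertical round circle.
\<close>

lemma one_bridge_trivial:
  fixes z :: "real \<Rightarrow> complex"
  assumes z: "continuous_on UNIV z" and per: "z 1 = z 0" and inj: "inj_on z {0..<1}"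
  shows "ambient_isotopic ((\<lambda>s. (z s, 1 - \<bar>4 * s - 2\<bar>)) ` {0..1}) {(z, 0) |z. cmod z = 1}"
proof -
  \<comment> \<open>clamping the level extends the two points \<open>p\<close> and \<open>q\<close> to all levels, with \<open>p = q\<close> outside\<close>
  define k where "k t = max (-1) (min 1 t)" for t :: real
  define p q where "p t = z ((k t + 1) / 4)" and "q t = z (1 - (k t + 1) / 4)" for t
  define w m where "w t = (q t - p t) / 2" and "m t = (p t + q t) / 2" for t
  have k: "continuous_on UNIV k" unfolding k_def by (intro continuous_intros)
  have cont: "continuous_on UNIV p" "continuous_on UNIV q"
    unfolding p_def q_def by (intro continuous_on_compose2[OF z] continuous_intros k; simp)+
  have w: "continuous_on UNIV w" and m: "continuous_on UNIV m"
    unfolding w_def m_def by (intro continuous_intros cont; simp)+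
  have nz: "w t \<noteq> 0" if "t \<in> {-1<..<1}" for t
  proof
    assume "w t = 0"
    then have "z ((t + 1) / 4) = z (1 - (t + 1) / 4)" using that by (simp add: w_def p_def q_def k_def)
    then have "(t + 1) / 4 = 1 - (t + 1) / 4" using inj_onD[OF inj] that by fastforce
    then have "t = 1" by argo
    then show False using that by simp
  qed
  have zero: "w t = 0" if "t \<notin> {-1<..<1}" for t
  proof -
    have "k t = -1 \<or> k t = 1" using that by (auto simp: k_def)
    then show ?thesis using per by (auto simp: w_def p_def q_def)
  qed
  have eq: "(\<lambda>(z, x). (z + - m x, x)) ` ((\<lambda>s. (z s, 1 - \<bar>4 * s - 2\<bar>)) ` {0..1})
      = {(s * w t, t) |s t. s \<in> {1, -1} \<and> t \<in> {-1..1}}" (is "?M ` ?f ` _ = ?Y")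
  proof
    have pm: "p t - m t = - w t" "q t - m t = w t" for t by (simp_all add: w_def m_def field_simps)
    show "?M ` ?f ` {0..1} \<subseteq> ?Y"
    proof (clarsimp simp del: mult_minus1)
      fix s :: real assume s: "0 \<le> s" "s \<le> 1"
      define t where "t = 1 - \<bar>4 * s - 2\<bar>"
      have t: "-1 \<le> t" "t \<le> 1" "k t = t" using s by (auto simp: t_def k_def)
      have "z s = p t \<or> z s = q t"
      proof (cases "s \<le> 1/2")
        case True
        then have "(t + 1) / 4 = s" by (simp add: t_def abs_if)
        then show ?thesis using t by (simp add: p_def)
      next
        case False
        then have "1 - (t + 1) / 4 = s" by (simp add: t_def abs_if field_simps)
        then show ?thesis using t by (simp add: q_def)
      qed
      then obtain sa :: complex where "z s - m t = sa * w t" "sa = 1 \<or> sa = - 1"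
        using pm[of t] by (metis mult_1 mult_minus1)
      then show "\<exists>sa. z s - m (1 - \<bar>4 * s - 2\<bar>) = sa * w (1 - \<bar>4 * s - 2\<bar>) \<and> (sa = 1 \<or> sa = - 1) \<and> \<bar>4 * s - 2\<bar> \<le> 2"
        using t unfolding t_def by (intro exI[of _ sa]) auto
    qed
    show "?Y \<subseteq> ?M ` ?f ` {0..1}"
    proof clarify
      fix s :: complex and t :: real assume st: "s \<in> {1, -1}" "t \<in> {-1..1}"
      define u where "u = (if s = 1 then 1 - (t + 1) / 4 else (t + 1) / 4)"
      have kt: "k t = t" using st by (auto simp: k_def)
      have u: "u \<in> {0..1}" "1 - \<bar>4 * u - 2\<bar> = t" using st by (auto simp: u_def abs_if field_simps)
      have "z u = m t + s * w t"
        using st kt pm[of t] by (auto simp: u_def p_def q_def algebra_simps)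
      then have "(s * w t, t) = ?M (?f u)" using u by simp
      then show "(s * w t, t) \<in> ?M ` ?f ` {0..1}" using u(1) by blast
    qed
  qed
  have "continuous_on UNIV (\<lambda>t. - m t)" by (intro continuous_intros m)
  from ambient_isotopic_horizontal_shear[OF this, of "(\<lambda>s. (z s, 1 - \<bar>4 * s - 2\<bar>)) ` {0..1}"]
  have 1: "ambient_isotopic ((\<lambda>s. (z s, 1 - \<bar>4 * s - 2\<bar>)) ` {0..1}) {(s * w t, t) |s t. s \<in> {1, -1} \<and> t \<in> {-1..1}}"
    by (simp only: eq)
  define b where "b t = sqrt (1 - (k t)\<^sup>2)" for t
  have beq: "{(s * of_real (sqrt (1 - t\<^sup>2)), t) |s t. s \<in> {1, -1::complex} \<and> t \<in> {-1..1}}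
     = {(s * of_real (b t), t) |s t. s \<in> {1, -1} \<and> t \<in> {-1..1}}"
  proof -
    have "sqrt (1 - t\<^sup>2) = b t" if "t \<in> {-1..1}" for t using that by (simp add: b_def k_def max_absorb2)
    then show ?thesis by (intro Collect_cong) (metis (no_types, lifting))
  qed
  have 2: "ambient_isotopic {(s * of_real (cmod (w t)), t) |s t. s \<in> {1, -1} \<and> t \<in> {-1..1}}
    {(s * of_real (b t), t) |s t. s \<in> {1, -1} \<and> t \<in> {-1..1}}"
  proof (rule ambient_isotopic_stretch)
    show "continuous_on UNIV (\<lambda>t. cmod (w t))" by (intro continuous_intros w)
    show "continuous_on UNIV b" unfolding b_def by (intro continuous_intros k)
    show "cmod (w t) > 0 \<and> b t > 0" if "t \<in> {-1<..<1}" for t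
      using nz[OF that] that by (auto simp: b_def k_def abs_square_less_1 abs_less_iff)
    show "cmod (w t) = 0 \<and> b t = 0" if "t \<notin> {-1<..<1}" for t
    proof -
      have "k t = -1 \<or> k t = 1" using that by (auto simp: k_def)
      then show ?thesis using zero[OF that] by (auto simp: b_def)
    qed
  qed
  show ?thesis
    using 1 ambient_isotopic_twist[OF w nz zero] 2 vertical_circle_trivial
    unfolding beq by (blast intro: ambient_isotopic_trans)
qed


section \<open>Projections without multiple points\<close>

text \<open>
  The graph of the induced function is the image of a compact set, hence closed, and a function into a
  compact set with a closed graph is continuous.
\<close>

lemma continuous_factor_through_compact_image:
  fixes f :: "'a::t2_space \<Rightarrow> 'b::euclidean_space" and h :: "'a \<Rightarrow> 'c::euclidean_space"
  assumes "compact S" "continuous_on S f" "continuous_on S h"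
    and wd: "\<And>x y. x \<in> S \<Longrightarrow> y \<in> S \<Longrightarrow> f x = f y \<Longrightarrow> h x = h y"
  obtains g where "continuous_on (f ` S) g" "\<And>x. x \<in> S \<Longrightarrow> g (f x) = h x"
proof -
  define g where "g y = h (SOME x. x \<in> S \<and> f x = y)" for y
  have g: "g (f x) = h x" if "x \<in> S" for x
  proof -
    have "(SOME x'. x' \<in> S \<and> f x' = f x) \<in> S \<and> f (SOME x'. x' \<in> S \<and> f x' = f x) = f x"
      by (rule someI[of _ x]) (use that in auto)
    then show ?thesis using wd that unfolding g_def by blast
  qed
  have "(\<lambda>y. (y, g y)) ` f ` S = (\<lambda>x. (f x, h x)) ` S"
    using g by (auto simp: image_iff)
  moreover have "compact ((\<lambda>x. (f x, h x)) ` S)"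
    by (intro compact_continuous_image continuous_on_Pair assms)
  ultimately have cl: "closed ((\<lambda>y. (y, g y)) ` f ` S)" using compact_imp_closed by metis
  have "compact (h ` S)" by (intro compact_continuous_image assms)
  moreover have "g \<in> f ` S \<rightarrow> h ` S" using g by auto
  moreover have "(\<lambda>y. (y, g y)) ` f ` S \<subseteq> f ` S \<times> h ` S" using g by auto
  ultimately have "continuous_on (f ` S) g"
    using continuous_closed_graph_eq[of "h ` S" g "f ` S"] closed_subset[OF _ cl] by simp
  then show ?thesis using g that by blast
qed

lemma knot_param_continuous: "knot_param \<gamma> \<Longrightarrow> continuous_on S \<gamma>"
  unfolding knot_param_def using C1_differentiable_imp_continuous_on continuous_on_subset by blast

lemma periodic_shift_int:
  fixes f :: "real \<Rightarrow> 'a"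
  assumes "\<And>s. f (s + 1) = f s"
  shows "f (s + of_int k) = f s"
proof (induction k rule: int_induct[where k = 0])
  case (step1 i)
  then show ?case using assms[of "s + of_int i"] by (simp add: add.assoc)
next
  case (step2 i)
  then show ?case using assms[of "s + of_int (i - 1)"] by (simp add: add.assoc)
qed auto

lemma periodic_frac:
  fixes f :: "real \<Rightarrow> 'a"
  assumes "\<And>s. f (s + 1) = f s"
  shows "f (frac s) = f s"
  using periodic_shift_int[where f = f, OF assms, of s "- \<lfloor>s\<rfloor>"] by (simp add: frac_def)

lemma periodic_range:
  fixes f :: "real \<Rightarrow> 'a"
  assumes "\<And>s. f (s + 1) = f s"
  shows "range f = f ` {0..<1}" "range f = f ` {0..1}"
proof -
  have *: "f s \<in> f ` {0..<1}" for s
    using periodic_frac[where f = f, OF assms, of s] frac_ge_0[of s] frac_lt_1[of s]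
    by (metis atLeastLessThan_iff image_eqI)
  then show "range f = f ` {0..<1}" by blast
  have "f ` {0..<1} \<subseteq> f ` {0..1}" by (intro image_mono) auto
  then show "range f = f ` {0..1}" using * by blast
qed

lemma knot_param_range: "knot_param \<gamma> \<Longrightarrow> range \<gamma> = \<gamma> ` {0..1}"
  unfolding knot_param_def by (intro periodic_range(2)) blast

lemma compact_knot: "knot_param \<gamma> \<Longrightarrow> compact (range \<gamma>)"
  unfolding knot_param_range by (intro compact_continuous_image knot_param_continuous) auto

lemma connected_knot: "knot_param \<gamma> \<Longrightarrow> connected (range \<gamma>)"
  unfolding knot_param_range by (intro connected_continuous_image knot_param_continuous) auto

lemma link_image_not_connected:
  assumes "link_param n \<gamma>" "n \<ge> 2"
  shows "\<not> connected (link_image n \<gamma>)"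
proof
  assume c: "connected (link_image n \<gamma>)"
  let ?A = "range (\<gamma> 0)" and ?B = "\<Union>i\<in>{1..<n}. range (\<gamma> i)"
  have "closed (range (\<gamma> i))" if "i < n" for i
    using assms(1) compact_knot compact_imp_closed that unfolding link_param_def by blast
  then have "closed ?A" "closed ?B" using assms(2) by (auto intro!: closed_UN)
  moreover have "?A \<inter> ?B = {}" using assms unfolding link_param_def by fastforce
  moreover have "link_image n \<gamma> = ?A \<union> ?B"
  proof -
    have "{..<n} = insert 0 {1..<n}" using assms(2) by auto
    then show ?thesis unfolding link_image_def by auto
  qed
  moreover have "?B \<noteq> {}" using assms(2) by force
  ultimately show False
    using connected_closedD[OF c, of ?A ?B] by auto
qed

text \<open>
  Homeomorphisms preserve connectedness, and a link is connected if and only if it has one component.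
\<close>

lemma homeomorphic_link_component_number:
  assumes "is_link n K" "homeomorphism UNIV UNIV h g" "h ` K = link_image m \<gamma>" "link_param m \<gamma>" "n \<ge> 1"
  shows "n = 1 \<Longrightarrow> m = 1" "n \<ge> 2 \<Longrightarrow> m \<ge> 2"
proof -
  obtain \<beta> where \<beta>: "link_param n \<beta>" "K = link_image n \<beta>" using assms(1) unfolding is_link_def by blast
  have "K \<noteq> {}" using assms(5) unfolding \<beta>(2) link_image_def by force
  then have m0: "m \<noteq> 0" using assms(3) unfolding link_image_def by force
  have hc: "continuous_on S h" "continuous_on S g" for S
    using assms(2) continuous_on_subset unfolding homeomorphism_def by blast+
  have K: "K = g ` link_image m \<gamma>"
    by (simp add: image_image homeomorphism_apply1[OF assms(2)] flip: assms(3))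
  have conn: "connected K \<longleftrightarrow> connected (link_image m \<gamma>)"
    using connected_continuous_image[OF hc(1), of K] connected_continuous_image[OF hc(2), of "link_image m \<gamma>"]
      assms(3) K by metis
  have one: "connected (link_image 1 \<delta>)" if "link_param 1 \<delta>" for \<delta>
    using that connected_knot unfolding link_param_def link_image_def by (simp add: lessThan_Suc)
  show "m = 1" if "n = 1"
    using link_image_not_connected[OF assms(4)] one[of \<beta>] \<beta> that conn m0
    by (metis One_nat_def Suc_leI le_neq_implies_less neq0_conv Suc_1)
  show "m \<ge> 2" if "n \<ge> 2"
    using link_image_not_connected[OF \<beta>(1) that] one[of \<gamma>] assms(4) \<beta> conn m0
    by (metis One_nat_def Suc_leI le_neq_implies_less neq0_conv Suc_1)
qed

text \<open>
  As the shadow is simple, the height is a function on it, which extends to the plane by Tietze's theorem;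
  so a vertical shear replaces the height by any other one.
\<close>

lemma injectively_projected_knot_trivial:
  assumes "knot_param \<gamma>" "inj_on (fst \<circ> \<gamma>) {0..<1}"
  shows "trivial_knot (range \<gamma>)"
proof -
  have per: "\<gamma> (s + 1) = \<gamma> s" for s using assms(1) unfolding knot_param_def by blast
  define z where "z = fst \<circ> \<gamma>"
  have z: "continuous_on S z" for S
    unfolding z_def comp_def using knot_param_continuous[OF assms(1)] continuous_on_fst by blast
  have z01: "z 1 = z 0" using per[of 0] by (simp add: z_def)
  \<comment> \<open>the change of height that leaves one maximum, at \<open>s = 1/2\<close>, and one minimum, at \<open>s = 0\<close>\<close>
  define h where "h s = 1 - \<bar>4 * s - 2\<bar> - snd (\<gamma> s)" for s
  have eq: "x = y \<or> {x, y} = {0, 1}" if "x \<in> {0..1}" "y \<in> {0..1}" "z x = z y" for x y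
  proof -
    have "x = y" if "x \<noteq> 1" "y \<noteq> 1"
      using inj_onD[OF assms(2), of x y] \<open>x \<in> {0..1}\<close> \<open>y \<in> {0..1}\<close> \<open>z x = z y\<close> that by (auto simp: z_def)
    moreover have "x = 0" if "y = 1" "x \<noteq> 1"
      using inj_onD[OF assms(2), of x 0] \<open>x \<in> {0..1}\<close> \<open>z x = z y\<close> that z01 by (auto simp: z_def)
    moreover have "y = 0" if "x = 1" "y \<noteq> 1"
      using inj_onD[OF assms(2), of y 0] \<open>y \<in> {0..1}\<close> \<open>z x = z y\<close> that z01 by (auto simp: z_def)
    ultimately show ?thesis by blast
  qed
  have h01: "h 0 = h 1" using per[of 0] by (simp add: h_def)
  obtain g where g: "continuous_on (z ` {0..1}) g" "\<And>s. s \<in> {0..1} \<Longrightarrow> g (z s) = h s"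
  proof (rule continuous_factor_through_compact_image[of "{0..1::real}" z h])
    show "continuous_on {0..1} h"
      unfolding h_def by (intro continuous_intros knot_param_continuous[OF assms(1)])
    show "h x = h y" if "x \<in> {0..1}" "y \<in> {0..1}" "z x = z y" for x y
      using eq[OF that] h01 by (auto simp: doubleton_eq_iff)
  qed (use z in auto)
  have "closed (z ` {0..1})" by (intro compact_imp_closed compact_continuous_image z) auto
  then have cl: "closedin (top_of_set UNIV) (z ` {0..1})" by (simp flip: closed_closedin)
  obtain G where G: "continuous_on UNIV G" "\<And>x. x \<in> z ` {0..1} \<Longrightarrow> G x = g x"
    using Tietze_unbounded[OF g(1) cl] by blast
  have "(\<lambda>(z, x). (z, x + G z)) ` \<gamma> ` {0..1} = (\<lambda>s. (z s, 1 - \<bar>4 * s - 2\<bar>)) ` {0..1}"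
    unfolding image_image
  proof (rule image_cong)
    fix s :: real assume "s \<in> {0..1}"
    then have "G (z s) = h s" using G(2) g(2) by auto
    then show "(case \<gamma> s of (z, x) \<Rightarrow> (z, x + G z)) = (z s, 1 - \<bar>4 * s - 2\<bar>)"
      by (simp add: case_prod_unfold z_def h_def)
  qed simp
  with ambient_isotopic_vertical_shear[OF G(1), of "\<gamma> ` {0..1}"]
  have "ambient_isotopic (range \<gamma>) ((\<lambda>s. (z s, 1 - \<bar>4 * s - 2\<bar>)) ` {0..1})"
    by (simp only: knot_param_range[OF assms(1)])
  moreover have "inj_on z {0..<1}" using assms(2) by (simp add: z_def)
  ultimately show ?thesis
    unfolding trivial_knot_def using one_bridge_trivial[OF z z01] ambient_isotopic_trans by blast
qed

text \<open>
  By Tietze's theorem a vertical shear can lift the first component far above the others, so that a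
  large ball separates it from them. The homeomorphism \<open>h\<close> is the inverse of this shear after a
  similarity that takes the unit ball to the large ball.
\<close>

lemma disjointly_projected_link_split:
  assumes "link_param n \<gamma>" "n \<ge> 2"
    and disj: "\<And>i. 0 < i \<Longrightarrow> i < n \<Longrightarrow> fst ` range (\<gamma> 0) \<inter> fst ` range (\<gamma> i) = {}"
  shows "split_link (link_image n \<gamma>)"
proof -
  let ?A = "range (\<gamma> 0)" and ?B = "\<Union>i\<in>{1..<n}. range (\<gamma> i)"
  have L: "link_image n \<gamma> = ?A \<union> ?B"
  proof -
    have "{..<n} = insert 0 {1..<n}" using assms(2) by auto
    then show ?thesis unfolding link_image_def by auto
  qed
  have comp: "compact ?A" "compact ?B"
  proof -
    have "compact (range (\<gamma> i))" if "i < n" for i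
      using assms(1) compact_knot that unfolding link_param_def by blast
    then show "compact ?A" "compact ?B" using assms(2) by (auto intro!: compact_UN)
  qed
  have cf: "compact (fst ` ?A)" "compact (fst ` ?B)"
    by (intro compact_continuous_image comp continuous_intros)+
  have "fst ` ?A \<inter> fst ` ?B = {}"
  proof (rule equals0I)
    fix x assume x: "x \<in> fst ` ?A \<inter> fst ` ?B"
    then obtain i where "i \<in> {1..<n}" "x \<in> fst ` range (\<gamma> i)" by blast
    then show False using disj[of i] x by auto
  qed
  \<comment> \<open>after a lift of \<open>?A\<close> by \<open>4 r\<close>, the ball of radius \<open>2 r\<close> around \<open>(0, 4 r)\<close> contains \<open>?A\<close> and
    misses \<open>?B\<close>\<close>
  obtain r where r: "r > 0" "\<And>x. x \<in> ?A \<union> ?B \<Longrightarrow> norm x < r"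
    using bounded_pos_less[of "?A \<union> ?B"] compact_imp_bounded comp by (metis bounded_Un)
  define c where "c z = (if z \<in> fst ` ?A then 4 * r else 0)" for z :: complex
  have "continuous_on (fst ` ?A \<union> fst ` ?B) c"
    unfolding c_def
  proof (rule continuous_on_cases)
    show "closed (fst ` ?A)" "closed (fst ` ?B)" using cf compact_imp_closed by blast+
    show "\<forall>z. z \<in> fst ` ?A \<and> z \<notin> fst ` ?A \<or> z \<in> fst ` ?B \<and> z \<in> fst ` ?A \<longrightarrow> 4 * r = 0"
      using \<open>fst ` ?A \<inter> fst ` ?B = {}\<close> by blast
  qed (intro continuous_on_const)+
  moreover have "closed (fst ` ?A \<union> fst ` ?B)" using cf compact_imp_closed by blast
  then have "closedin (top_of_set UNIV) (fst ` ?A \<union> fst ` ?B)" by (simp flip: closed_closedin)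
  ultimately obtain G where G: "continuous_on UNIV G" "\<And>x. x \<in> fst ` ?A \<union> fst ` ?B \<Longrightarrow> G x = c x"
    using Tietze_unbounded[of "fst ` ?A \<union> fst ` ?B" c UNIV] by blast
  define h where "h p = (2 * r * fst p, 2 * r * snd p + 4 * r - G (2 * r * fst p))" for p :: R3
  define k where "k p = (fst p / (2 * r), (snd p - 4 * r + G (fst p)) / (2 * r))" for p :: R3
  have hk: "h (k p) = p" "k (h p) = p" for p using r(1) by (simp_all add: h_def k_def)
  have hom: "homeomorphism UNIV UNIV h k"
    unfolding homeomorphism_def
  proof (intro conjI ballI)
    show "continuous_on UNIV h"
      unfolding h_def by (intro continuous_intros continuous_on_compose2[OF G(1)]) auto
    show "continuous_on UNIV k"
      unfolding k_def by (intro continuous_intros continuous_on_compose2[OF G(1)]) (use r(1) in auto)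
    show "range h = UNIV" "range k = UNIV" using hk by (metis surjI)+
  qed (use hk in auto)
  have inA: "norm (k p) < 1" if "p \<in> ?A" for p
  proof -
    have "G (fst p) = 4 * r" using G(2)[of "fst p"] that by (simp add: c_def)
    then have "(2 * r) *\<^sub>R k p = p"
      using r(1) by (cases p) (simp add: k_def scaleR_conv_of_real)
    then have "2 * r * norm (k p) < r" using r(2)[of p] that r(1) by (metis UnI1 abs_of_pos mult_pos_pos norm_scaleR zero_less_numeral)
    then show ?thesis using r(1) by (simp add: mult_less_cancel_right_pos)
  qed
  have inB: "norm (k p) > 1" if "p \<in> ?B" for p
  proof -
    have "fst p \<in> fst ` ?B" using that by (rule imageI)
    moreover then have "fst p \<notin> fst ` ?A" using \<open>fst ` ?A \<inter> fst ` ?B = {}\<close> by blast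
    ultimately have "G (fst p) = 0" using G(2)[of "fst p"] by (simp add: c_def)
    then have "snd (k p) = (snd p - 4 * r) / (2 * r)" by (simp add: k_def)
    moreover have "norm (snd q) \<le> norm q" for q :: R3 by (metis norm_snd_le prod.collapse)
    note snd_le = this
    from snd_le[of p] have "\<bar>snd p\<bar> < r" using r(2)[of p] that by auto
    then have "snd p - 4 * r < - 1 * (2 * r)" using r(1) by linarith
    ultimately have "snd (k p) < - 1" using r(1) by (simp only: pos_divide_less_eq[of "2 * r"] mult_pos_pos zero_less_numeral)
    then show ?thesis using snd_le[of "k p"] by simp
  qed
  show ?thesis
    unfolding split_link_def
  proof (intro exI conjI)
    show "homeomorphism UNIV UNIV h k" by (fact hom)
    have "norm (k p) \<noteq> 1" if "p \<in> link_image n \<gamma>" for p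
      using that inA[of p] inB[of p] unfolding L by (metis UnE less_irrefl)
    moreover have "norm (k p) = 1" if "p \<in> h ` sphere 0 1" for p
      using that hk by auto
    ultimately show "link_image n \<gamma> \<inter> h ` sphere 0 1 = {}" by blast
    have "\<gamma> 0 0 \<in> h ` ball 0 1" using inA[of "\<gamma> 0 0"] hk by (intro image_eqI[of _ _ "k (\<gamma> 0 0)"]) auto
    then show "link_image n \<gamma> \<inter> h ` ball 0 1 \<noteq> {}" unfolding L by blast
    have B1: "\<gamma> 1 0 \<in> ?B" using assms(2) by (intro UN_I[of 1]) auto
    then have "\<gamma> 1 0 \<in> h ` (- cball 0 1)"
      using inB[OF B1] hk by (intro image_eqI[of _ _ "k (\<gamma> 1 0)"]) auto
    then show "link_image n \<gamma> \<inter> h ` (- cball 0 1) \<noteq> {}" unfolding L using B1 by blast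
  qed
qed

lemma split_link_homeomorphic:
  assumes "split_link (h ` K)" "homeomorphism UNIV UNIV h g"
  shows "split_link K"
proof -
  obtain f k where f: "homeomorphism UNIV UNIV (f :: R3 \<Rightarrow> R3) k" "h ` K \<inter> f ` sphere 0 1 = {}"
     "h ` K \<inter> f ` ball 0 1 \<noteq> {}" "h ` K \<inter> f ` (- cball 0 1) \<noteq> {}"
    using assms(1) unfolding split_link_def by blast
  have gh: "g (h x) = x" "h (g x) = x" for x
    using homeomorphism_apply1[OF assms(2)] homeomorphism_apply2[OF assms(2)] by auto
  have "y \<in> h ` K \<longleftrightarrow> g y \<in> K" for y using gh by (metis image_iff)
  moreover have "Y \<inter> f ` X = {} \<longleftrightarrow> (\<forall>x\<in>X. f x \<notin> Y)" for X Y by auto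
  moreover have "K \<inter> (g \<circ> f) ` X = {} \<longleftrightarrow> (\<forall>x\<in>X. g (f x) \<notin> K)" for X
    unfolding comp_def by blast
  ultimately have move: "K \<inter> (g \<circ> f) ` X = {} \<longleftrightarrow> h ` K \<inter> f ` X = {}" for X by simp
  have "homeomorphism UNIV UNIV (g \<circ> f) (k \<circ> h)"
    using homeomorphism_compose[OF f(1)] assms(2) homeomorphism_symD by blast
  then show ?thesis using f unfolding split_link_def move[symmetric] by blast
qed

lemma multiple_points_exist:
  assumes K: "(is_knot K \<and> \<not> trivial_knot K) \<or> (\<exists>n\<ge>2. is_link n K \<and> \<not> split_link K)"
    and D: "triple_crossing_diagram_of D K"
  shows "multiple_points D \<noteq> {}"
proof
  assume none: "multiple_points D = {}"
  obtain \<gamma> where g: "link_param (ncomp D) \<gamma>" "ambient_isotopic K (link_image (ncomp D) \<gamma>)" "projects_to \<gamma> D"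
    using D unfolding triple_crossing_diagram_of_def by blast
  obtain h k where h: "homeomorphism UNIV UNIV h k" "h ` K = link_image (ncomp D) \<gamma>"
    using ambient_isotopic_imp_homeomorphism[OF g(2)] by blast
  have inj: "i = j \<and> s = t" if "i < ncomp D" "j < ncomp D" "s \<in> {0..<1}" "t \<in> {0..<1}"
    "fst (\<gamma> i s) = fst (\<gamma> j t)" for i j s t
  proof -
    have "(i, s) \<in> strands D (fst (\<gamma> i s))" "(j, t) \<in> strands D (fst (\<gamma> i s))"
      using that g(3) by (auto simp: strands_def point_of_def projects_to_def)
    then have "(i, s) = (j, t)" using none unfolding multiple_points_def by blast
    then show ?thesis by simp
  qed
  show False
    using K
  proof
    assume K1: "is_knot K \<and> \<not> trivial_knot K"
    then have "ncomp D = 1"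
      using homeomorphic_link_component_number(1)[OF _ h g(1)] unfolding is_knot_def by blast
    then have "knot_param (\<gamma> 0)" "link_image (ncomp D) \<gamma> = range (\<gamma> 0)" "inj_on (fst \<circ> \<gamma> 0) {0..<1}"
      using g(1) inj unfolding link_param_def link_image_def inj_on_def by (auto simp: lessThan_Suc)
    then have "trivial_knot (link_image (ncomp D) \<gamma>)"
      using injectively_projected_knot_trivial by simp
    then show False
      using ambient_isotopic_trans[OF g(2)] K1 unfolding trivial_knot_def by blast
  next
    assume "\<exists>n\<ge>2. is_link n K \<and> \<not> split_link K"
    then obtain n where n: "n \<ge> 2" "is_link n K" "\<not> split_link K" by blast
    then have m: "ncomp D \<ge> 2" using homeomorphic_link_component_number(2)[OF n(2) h g(1)] by simp
    have "fst ` range (\<gamma> 0) \<inter> fst ` range (\<gamma> i) = {}" if i: "0 < i" "i < ncomp D" for i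
    proof (rule ccontr)
      have per: "\<And>j. j < ncomp D \<Longrightarrow> range (\<gamma> j) = \<gamma> j ` {0..<1}"
        using g(1) unfolding link_param_def knot_param_def by (intro periodic_range(1)) blast
      assume "fst ` range (\<gamma> 0) \<inter> fst ` range (\<gamma> i) \<noteq> {}"
      then obtain x where "x \<in> fst ` \<gamma> 0 ` {0..<1}" "x \<in> fst ` \<gamma> i ` {0..<1}"
        using per[of 0] per[of i] i by auto
      then obtain s t where "s \<in> {0..<1}" "t \<in> {0..<1}" "fst (\<gamma> 0 s) = fst (\<gamma> i t)"
        by (elim imageE) metis
      then show False using inj[of 0 i s t] i by auto
    qed
    then have "split_link (link_image (ncomp D) \<gamma>)"
      using disjointly_projected_link_split[OF g(1) m] by blast
    then show False using split_link_homeomorphic[of h K k] h n(3) by simp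
  qed
qed


section \<open>Linear algebra\<close>

text \<open>
  Gaussian elimination: an equation with a non-zero coefficient is solved for one unknown, which is
  substituted into the others.
\<close>

lemma homogeneous_system_nontrivial_solution:
  fixes c :: "'a \<Rightarrow> 'b \<Rightarrow> real"
  assumes "finite A" "finite B" "card A < card B"
  shows "\<exists>x. (\<exists>j\<in>B. x j \<noteq> 0) \<and> (\<forall>i\<in>A. (\<Sum>j\<in>B. c i j * x j) = 0)"
  using assms
proof (induction A arbitrary: B c rule: finite_induct)
  case empty
  then have "B \<noteq> {}" by auto
  then show ?case by (intro exI[of _ "\<lambda>_. 1"]) auto
next
  case (insert a A)
  show ?case
  proof (cases "\<forall>j\<in>B. c a j = 0")
    case True
    obtain x where "\<exists>j\<in>B. x j \<noteq> 0" "\<forall>i\<in>A. (\<Sum>j\<in>B. c i j * x j) = 0"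
      using insert.IH[of B c] insert.prems insert.hyps by auto
    then show ?thesis using True by (intro exI[of _ x]) auto
  next
    case False
    then obtain k where k: "k \<in> B" "c a k \<noteq> 0" by auto
    define B' where "B' = B - {k}"
    have fB': "finite B'" "card A < card B'" "k \<notin> B'" "B = insert k B'"
      using insert.prems insert.hyps k unfolding B'_def by auto
    obtain x where x: "\<exists>j\<in>B'. x j \<noteq> 0"
        "\<forall>i\<in>A. (\<Sum>j\<in>B'. (c i j - c i k * c a j / c a k) * x j) = 0"
      using insert.IH[of B' "\<lambda>i j. c i j - c i k * c a j / c a k"] fB' by blast
    define y where "y = x(k := - (\<Sum>j\<in>B'. c a j * x j) / c a k)"
    have yx: "\<And>i. (\<Sum>j\<in>B'. c i j * y j) = (\<Sum>j\<in>B'. c i j * x j)"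
      using fB'(3) by (intro sum.cong) (auto simp: y_def)
    have yB: "(\<Sum>j\<in>B. c i j * y j) = c i k * y k + (\<Sum>j\<in>B'. c i j * x j)" for i
      using fB' yx by simp
    have "(\<Sum>j\<in>B. c i j * y j) = 0" if "i \<in> insert a A" for i
    proof (cases "i = a")
      case True
      have "c a k * y k = - (\<Sum>j\<in>B'. c a j * x j)" using k by (simp add: y_def)
      then show ?thesis using True yB[of a] by simp
    next
      case False
      then have "i \<in> A" using that by auto
      then have "(\<Sum>j\<in>B'. c i j * x j) - (\<Sum>j\<in>B'. c i k * c a j / c a k * x j) = 0"
        using x(2) by (simp add: left_diff_distrib sum_subtractf)
      moreover have "(\<Sum>j\<in>B'. c i k * c a j / c a k * x j) = c i k / c a k * (\<Sum>j\<in>B'. c a j * x j)"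
        by (simp add: sum_distrib_left algebra_simps)
      moreover have "c i k * y k = - (c i k / c a k * (\<Sum>j\<in>B'. c a j * x j))" by (simp add: y_def)
      ultimately show ?thesis using yB[of i] by linarith
    qed
    moreover have "\<exists>j\<in>B. y j \<noteq> 0"
      using x(1) fB'(3,4) by (auto simp: y_def)
    ultimately show ?thesis by blast
  qed
qed


section \<open>Discharging on a combinatorial map of degree six\<close>

lemma periodic_orbit_segment:
  assumes "(f ^^ n) x = x" "n > 0"
  shows "range (\<lambda>k. (f ^^ k) x) = (\<lambda>k. (f ^^ k) x) ` {..<n}"
proof -
  have "(f ^^ k) x = (f ^^ (k mod n)) x" for k
    using assms(1) by (simp add: funpow_mod_eq)
  then show ?thesis using assms(2) by fastforce
qed

text \<open>
  A combinatorial map whose vertices have degree six: \<open>opp\<close> reverses darts, and \<open>rot\<close> turns to the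
  next dart at the same vertex. The faces are the orbits of the walk that reverses and turns.
\<close>

locale sextic_map =
  fixes S :: "'d set" and opp rot :: "'d \<Rightarrow> 'd"
  assumes finite_darts: "finite S"
    and opp_in: "d \<in> S \<Longrightarrow> opp d \<in> S"
    and opp_opp: "d \<in> S \<Longrightarrow> opp (opp d) = d"
    and opp_neq: "d \<in> S \<Longrightarrow> opp d \<noteq> d"
    and rot_in: "d \<in> S \<Longrightarrow> rot d \<in> S"
    and rot_6: "d \<in> S \<Longrightarrow> rot (rot (rot (rot (rot (rot d))))) = d"
    and rot_neq: "d \<in> S \<Longrightarrow> rot d \<noteq> d"
    and rot_rot_neq: "d \<in> S \<Longrightarrow> rot (rot d) \<noteq> d"
begin

definition walk :: "'d \<Rightarrow> 'd" where "walk d = rot (opp d)"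

definition walk_orbit :: "'d \<Rightarrow> 'd set" where "walk_orbit d = range (\<lambda>k. (walk ^^ k) d)"

lemma rot_inj: "d \<in> S \<Longrightarrow> e \<in> S \<Longrightarrow> rot d = rot e \<Longrightarrow> d = e"
  by (metis rot_6)

lemma opp_inj: "d \<in> S \<Longrightarrow> e \<in> S \<Longrightarrow> opp d = opp e \<Longrightarrow> d = e"
  by (metis opp_opp)

lemma walk_in: "d \<in> S \<Longrightarrow> walk d \<in> S"
  by (simp add: walk_def rot_in opp_in)

lemma walk_inj: "d \<in> S \<Longrightarrow> e \<in> S \<Longrightarrow> walk d = walk e \<Longrightarrow> d = e"
  unfolding walk_def using rot_inj opp_inj opp_in by metis

lemma walk_pow_in: "d \<in> S \<Longrightarrow> (walk ^^ k) d \<in> S"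
  by (induction k) (auto simp: walk_in)

lemma walk_pow_inj: "d \<in> S \<Longrightarrow> e \<in> S \<Longrightarrow> (walk ^^ k) d = (walk ^^ k) e \<Longrightarrow> d = e"
  by (induction k) (auto dest: walk_inj[OF walk_pow_in walk_pow_in])

lemma walk_periodic:
  assumes "d \<in> S" obtains n where "n > 0" "(walk ^^ n) d = d"
proof -
  have "\<not> inj (\<lambda>k. (walk ^^ k) d)"
    using finite_subset[of "range (\<lambda>k. (walk ^^ k) d)" S] finite_darts walk_pow_in[OF assms]
      range_inj_infinite by blast
  then obtain i j where ij: "i < j" "(walk ^^ i) d = (walk ^^ j) d"
    unfolding inj_def by (metis linorder_neqE_nat)
  then have "(walk ^^ i) d = (walk ^^ i) ((walk ^^ (j - i)) d)"
    by (metis add_diff_inverse_nat comp_apply funpow_add less_imp_not_less)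
  then have "(walk ^^ (j - i)) d = d"
    using walk_pow_inj assms walk_pow_in by metis
  then show ?thesis using ij that[of "j - i"] by auto
qed

lemma walk_orbit_subset: "d \<in> S \<Longrightarrow> walk_orbit d \<subseteq> S"
  unfolding walk_orbit_def using walk_pow_in by auto

lemma finite_walk_orbit: "d \<in> S \<Longrightarrow> finite (walk_orbit d)"
  using walk_orbit_subset finite_darts finite_subset by metis

lemma walk_orbit_self: "d \<in> walk_orbit d"
  unfolding walk_orbit_def by (metis funpow_0 rangeI)

lemma walk_orbit_eq_segment:
  "(walk ^^ n) d = d \<Longrightarrow> n > 0 \<Longrightarrow> walk_orbit d = (\<lambda>k. (walk ^^ k) d) ` {..<n}"
  unfolding walk_orbit_def by (rule periodic_orbit_segment)

lemma card_walk_orbit_le: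
  assumes "(walk ^^ n) d = d" "n > 0"
  shows "card (walk_orbit d) \<le> n"
  using walk_orbit_eq_segment[OF assms] card_image_le[of "{..<n}"] by fastforce

lemma walk_orbit_mono: "e \<in> walk_orbit d \<Longrightarrow> walk_orbit e \<subseteq> walk_orbit d"
proof
  fix f assume "e \<in> walk_orbit d" "f \<in> walk_orbit e"
  then obtain i j where "e = (walk ^^ i) d" "f = (walk ^^ j) e" by (auto simp: walk_orbit_def)
  then have "f = (walk ^^ (j + i)) d" by (simp add: funpow_add)
  then show "f \<in> walk_orbit d" by (auto simp: walk_orbit_def)
qed

lemma walk_orbit_eq:
  assumes "d \<in> S" "e \<in> walk_orbit d"
  shows "walk_orbit e = walk_orbit d"
proof -
  obtain n where n: "n > 0" "(walk ^^ n) d = d" using walk_periodic assms by blast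
  obtain k where k: "k < n" "e = (walk ^^ k) d"
    using assms(2) walk_orbit_eq_segment[OF n(2,1)] by auto
  then have "(walk ^^ (n - k)) e = (walk ^^ (n - k + k)) d"
    by (simp only: funpow_add comp_apply)
  then have "(walk ^^ (n - k)) e = d" using n k by simp
  then have "d \<in> walk_orbit e" unfolding walk_orbit_def by (intro range_eqI[of _ _ "n - k"]) simp
  then show ?thesis using walk_orbit_mono assms(2) by blast
qed

lemma walk_in_orbit: "walk d \<in> walk_orbit d"
  unfolding walk_orbit_def by (intro range_eqI[of _ _ 1]) simp

lemma card_walk_orbit_pos: "d \<in> S \<Longrightarrow> card (walk_orbit d) > 0"
  using finite_walk_orbit walk_orbit_self by (metis card_gt_0_iff empty_iff)

lemma monogonI: "walk d = d \<Longrightarrow> d \<in> S \<Longrightarrow> card (walk_orbit d) = 1"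
  using card_walk_orbit_le[of 1 d] card_walk_orbit_pos[of d] by simp

lemma bigonD:
  assumes "card (walk_orbit d) = 2" "d \<in> S"
  shows "walk (walk d) = d" "walk d \<noteq> d" "walk_orbit d = {d, walk d}"
proof -
  show ne: "walk d \<noteq> d" using monogonI assms by fastforce
  have "{d, walk d} \<subseteq> walk_orbit d" using walk_orbit_self walk_in_orbit by blast
  moreover have "card {d, walk d} = 2" using ne by auto
  ultimately show eq: "walk_orbit d = {d, walk d}"
    using assms finite_walk_orbit card_subset_eq by metis
  have "walk (walk d) \<in> walk_orbit d"
    using walk_in_orbit walk_orbit_eq[OF assms(2)] walk_in_orbit by blast
  then show "walk (walk d) = d"
    using eq ne walk_inj assms(2) walk_in by (metis insertE singletonD)
qed

text \<open>
  Around a single vertex with darts \<open>r\<^sub>0, \<dots>, r\<^sub>5\<close>, two bigons sharing a loop \<open>r\<^sub>0 r\<^sub>k\<close> force the pairs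
  \<open>r\<^sub>1 r\<^bsub>k-1\<^esub>\<close> and \<open>r\<^bsub>k+1\<^esub> r\<^sub>5\<close> to be edges too. For even \<open>k\<close> some dart would be its own opposite, and for odd
  \<open>k\<close> two consecutive darts form an edge, which bounds a monogon.
\<close>

lemma adjacent_bigons_at_one_vertex:
  assumes "d \<in> S" "card (walk_orbit d) = 2" "card (walk_orbit (opp d)) = 2"
    and "(rot ^^ k) d = opp d"
  shows "\<exists>e\<in>S. card (walk_orbit e) = 1"
proof -
  have "(rot ^^ 6) d = d" using rot_6[OF assms(1)] by (simp add: eval_nat_numeral)
  then have "(rot ^^ (k mod 6)) d = opp d" using assms(4) by (simp add: funpow_mod_eq)
  moreover have "k mod 6 < 6" by simp
  ultimately obtain j where j: "j < 6" "(rot ^^ j) d = opp d" by blast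
  have w1: "walk (walk d) = d" using bigonD assms by blast
  have w2: "walk (walk (opp d)) = opp d" using bigonD assms opp_in by blast
  have dS [simp]: "d \<in> S" by fact
  define r where "r = (\<lambda>i. (rot ^^ i) d)"
  have rS [simp]: "r i \<in> S" for i by (induction i) (auto simp: r_def rot_in)
  have rr: "rot (r i) = r (Suc i)" for i by (simp add: r_def)
  have r0: "r 0 = d" by (simp add: r_def)
  have r6: "r 6 = d" using rot_6[OF dS] by (simp add: r_def eval_nat_numeral)
  have rj: "r j = opp d" using j by (simp add: r_def)
  have mono: "\<exists>e\<in>S. card (walk_orbit e) = 1" if "opp (r i) = r (Suc i)" for i
  proof -
    have "opp (r (Suc i)) = r i" using that opp_opp[OF rS] by metis
    then have "walk (r (Suc i)) = r (Suc i)" by (simp add: walk_def rr)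
    then show ?thesis using monogonI[OF _ rS] rS by blast
  qed
  have e1: "rot (opp (r (Suc j))) = d"
    using w1 by (simp add: walk_def rr flip: rj)
  have e2: "opp (r (Suc j)) = r 5"
  proof -
    have "rot (r 5) = d" using r6 rr[of 5] by simp
    then show ?thesis using e1 rot_inj rS opp_in by metis
  qed
  have "walk (opp d) = r 1" using opp_opp[OF dS] by (simp add: walk_def r_def)
  then have e3: "rot (opp (r 1)) = r j" using w2 rj by (simp add: walk_def)
  have e4: "opp (r 1) = r (j - 1)" if "j > 0"
  proof -
    have "rot (r (j - 1)) = r j" using that rr[of "j - 1"] by simp
    then show ?thesis using e3 rot_inj rS opp_in by metis
  qed
  have j0: "j \<noteq> 0" using rj opp_neq[OF dS] r0 by metis
  have "j = 1 \<or> j = 2 \<or> j = 3 \<or> j = 4 \<or> j = 5" using j j0 by auto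
  then show ?thesis
  proof (elim disjE)
    assume "j = 1" then show ?thesis using mono[of 0] rj r0 by simp
  next
    assume "j = 2" then show ?thesis using e4 opp_neq[OF rS] by force
  next
    assume "j = 3" then show ?thesis using mono[of 4] e2 by simp
  next
    assume "j = 4" then show ?thesis using e2 opp_neq[OF rS] by force
  next
    assume "j = 5"
    then have "opp (r 5) = r 6" using rj r6 opp_opp[OF dS] by metis
    then show ?thesis using mono[of 5] by simp
  qed
qed

lemma adjacent_bigons_distinct:
  assumes "d \<in> S" "card (walk_orbit d) = 2"
  shows "walk_orbit d \<noteq> walk_orbit (opp d)"
proof
  assume "walk_orbit d = walk_orbit (opp d)"
  then have "opp d \<in> {d, walk d}" using bigonD assms walk_orbit_self by blast
  then have "rot (opp d) = opp d" using opp_neq[OF assms(1)] by (auto simp: walk_def)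
  then show False using rot_neq opp_in assms(1) by blast
qed

text \<open>
  A bigon cannot meet two consecutive edges of a walk, because its corner would fill the vertex
  between them. If it meets the first and the third of three such edges, then the middle edge is a
  loop whose bigon encloses a monogon.
\<close>

lemma three_consecutive_bigons_distinct:
  assumes x: "x \<in> S" "card (walk_orbit x) \<ge> 4"
    and b: "card (walk_orbit (opp x)) = 2" "card (walk_orbit (opp (walk x))) = 2"
      "card (walk_orbit (opp (walk (walk x)))) = 2"
    and no_monogon: "\<And>e. e \<in> S \<Longrightarrow> card (walk_orbit e) \<noteq> 1"
  shows "distinct [walk_orbit (opp x), walk_orbit (opp (walk x)), walk_orbit (opp (walk (walk x)))]"
proof -
  have consecutive: "walk_orbit (opp y) \<noteq> walk_orbit (opp (walk y))"
    if y: "y \<in> S" "walk y \<noteq> y" "card (walk_orbit (opp y)) = 2" for y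
  proof
    assume "walk_orbit (opp y) = walk_orbit (opp (walk y))"
    then have "opp (walk y) \<in> {opp y, walk (opp y)}"
      using bigonD[OF y(3)] opp_in[OF y(1)] walk_orbit_self by blast
    moreover have "opp (walk y) \<noteq> opp y" using y opp_inj walk_in by blast
    ultimately have "opp (walk y) = walk (opp y)" by blast
    then have "walk (walk (opp y)) = rot (walk y)"
      using opp_opp[OF walk_in[OF y(1)]] by (metis walk_def)
    then have "rot (rot (opp y)) = opp y"
      using bigonD(1)[OF y(3)] opp_in[OF y(1)] by (simp add: walk_def)
    then show False using rot_rot_neq opp_in y(1) by blast
  qed
  have n1: "walk x \<noteq> x" using card_walk_orbit_le[of 1 x] x by auto
  have n2: "walk (walk x) \<noteq> walk x" using n1 walk_inj x walk_in by blast
  have n3: "walk (walk x) \<noteq> x" using card_walk_orbit_le[of 2 x] x by (auto simp: eval_nat_numeral)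
  have "walk_orbit (opp x) \<noteq> walk_orbit (opp (walk (walk x)))"
  proof
    let ?a = "opp x" and ?y = "walk x" and ?w = "walk (walk x)"
    assume eq: "walk_orbit (opp x) = walk_orbit (opp (walk (walk x)))"
    have S [simp]: "x \<in> S" "?a \<in> S" "?y \<in> S" "?w \<in> S" "opp ?y \<in> S" "opp ?w \<in> S"
      using x walk_in opp_in by auto
    have "?a \<in> {opp ?w, walk (opp ?w)}"
      using eq bigonD(3)[OF b(3)] walk_orbit_self by (metis S(6))
    moreover have "?a \<noteq> opp ?w" using n3 opp_inj S by metis
    ultimately have "?a = rot ?w" using opp_opp[OF S(4)] by (auto simp: walk_def)
    then have z: "rot (rot (opp ?y)) = ?a" by (simp add: walk_def)
    have y: "?y = rot ?a" by (simp add: walk_def)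
    \<comment> \<open>with \<open>a = r\<^sub>0\<close> the middle edge is \<open>r\<^sub>1 r\<^sub>4\<close>, and its bigon forces the edge \<open>r\<^sub>2 r\<^sub>3\<close>\<close>
    have z4: "opp ?y = rot (rot (rot (rot ?a)))"
    proof -
      have "rot (rot (opp ?y)) = rot (rot (rot (rot (rot (rot ?a)))))"
        using z rot_6[OF S(2)] by simp
      then show ?thesis using rot_inj rot_in S by metis
    qed
    define e where "e = rot (rot ?a)"
    have eS [simp]: "e \<in> S" unfolding e_def using rot_in S by simp
    have "walk (opp ?y) = e" using y opp_opp[OF S(3)] unfolding walk_def e_def by simp
    then have "walk e = opp ?y" using bigonD(1)[OF b(2)] S by metis
    then have "rot (opp e) = rot (rot e)" using z4 by (simp add: walk_def e_def)
    then have "opp e = rot e" using rot_inj rot_in opp_in eS by metis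
    then have "walk (rot e) = rot e"
      using opp_opp[OF eS] by (simp add: walk_def)
    then show False using monogonI no_monogon rot_in eS by blast
  qed
  then show ?thesis
    using consecutive[OF x(1) n1 b(1)] consecutive[OF walk_in[OF x(1)] n2 b(2)] by simp
qed

definition orbits :: "'d set set" where "orbits = walk_orbit ` S"

lemma finite_orbits: "finite orbits" unfolding orbits_def using finite_darts by simp

lemma orbit_of_member: "W \<in> orbits \<Longrightarrow> d \<in> W \<Longrightarrow> d \<in> S \<and> W = walk_orbit d"
  unfolding orbits_def using walk_orbit_eq walk_orbit_subset by blast

lemma orbits_disjoint: "V \<in> orbits \<Longrightarrow> W \<in> orbits \<Longrightarrow> V \<noteq> W \<Longrightarrow> V \<inter> W = {}"
  using orbit_of_member by blast

lemma Union_orbits: "\<Union> orbits = S"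
  unfolding orbits_def using walk_orbit_self walk_orbit_subset by blast

lemma finite_orbit: "W \<in> orbits \<Longrightarrow> finite W"
  unfolding orbits_def using finite_walk_orbit by auto

lemma sum_over_orbits: "(\<Sum>d\<in>S. f d) = (\<Sum>W\<in>orbits. \<Sum>d\<in>W. f d)"
proof -
  have "sum f (\<Union> orbits) = (\<Sum>W\<in>orbits. sum f W)"
    using finite_orbit orbits_disjoint sum.Union_disjoint[of orbits f] by (simp add: comp_def)
  then show ?thesis by (simp only: Union_orbits)
qed

text \<open>
  Each bigon gives half of its surplus to each of the two faces across its edges, which have at least
  four edges when no bigon touches a bigon or a triangle. A face with \<open>m \<ge> 4\<close> edges, of which no three
  consecutive ones border bigons, has at most \<open>m - 2\<close> bigon neighbours, and \<open>(m - 2) / 2 \<le> m - 3\<close>.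
  So no face would keep a surplus, against Euler.
\<close>

lemma discharging:
  assumes euler: "card S < 3 * card orbits"
  shows "(\<exists>d\<in>S. card (walk_orbit d) = 1) \<or>
    (\<exists>d\<in>S. card (walk_orbit d) = 2 \<and> card (walk_orbit (opp d)) \<in> {2, 3}) \<or>
    (\<exists>d\<in>S. card (walk_orbit d) \<ge> 4 \<and> card (walk_orbit (opp d)) = 2 \<and>
       card (walk_orbit (opp (walk d))) = 2 \<and> card (walk_orbit (opp (walk (walk d)))) = 2)"
proof (rule ccontr)
  assume neg: "\<not> ?thesis"
  note neg1 = neg[unfolded de_Morgan_disj, THEN conjunct1]
    and neg2 = neg[unfolded de_Morgan_disj, THEN conjunct2, THEN conjunct1]
    and neg3 = neg[unfolded de_Morgan_disj, THEN conjunct2, THEN conjunct2]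
  have no1: "card (walk_orbit d) \<noteq> 1" if "d \<in> S" for d using that neg1 by blast
  have no23: "card (walk_orbit (opp d)) \<notin> {2, 3}" if "d \<in> S" "card (walk_orbit d) = 2" for d
    using that neg2 by blast
  have no4: "\<not> (card (walk_orbit (opp d)) = 2 \<and> card (walk_orbit (opp (walk d))) = 2 \<and>
      card (walk_orbit (opp (walk (walk d)))) = 2)" if "d \<in> S" "card (walk_orbit d) \<ge> 4" for d
    using that neg3 by blast
  \<comment> \<open>\<open>B\<close> holds the darts across which a bigon gives away half a unit\<close>
  define B where "B = {d\<in>S. card (walk_orbit (opp d)) = 2}"
  define O2 where "O2 = {W\<in>orbits. card W = 2}"
  define O3 where "O3 = {W\<in>orbits. card W = 3}"
  define O4 where "O4 = {W\<in>orbits. card W \<ge> 4}"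
  have fin: "finite O2" "finite O3" "finite O4" "finite B"
    using finite_orbits finite_darts by (auto simp: O2_def O3_def O4_def B_def)
  have cases4: "card W = 2 \<or> card W = 3 \<or> card W \<ge> 4" if "W \<in> orbits" for W
  proof -
    obtain d where "d \<in> S" "W = walk_orbit d" using \<open>W \<in> orbits\<close> by (auto simp: orbits_def)
    then have "card W > 0" "card W \<noteq> 1" using no1 card_walk_orbit_pos by auto
    then show ?thesis by linarith
  qed
  have split: "orbits = O2 \<union> O3 \<union> O4" using cases4 by (auto simp: O2_def O3_def O4_def)
  have sumsplit: "(\<Sum>W\<in>orbits. f W) = (\<Sum>W\<in>O2. f W) + (\<Sum>W\<in>O3. f W) + (\<Sum>W\<in>O4. f W)"
    for f :: "'d set \<Rightarrow> int"
    unfolding split using fin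
    by (subst sum.union_disjoint; (subst sum.union_disjoint)?) (auto simp: O2_def O3_def O4_def)
  have few: "card (W \<inter> B) \<le> card W - 2" if W: "W \<in> O4" for W
  proof (rule ccontr)
    assume "\<not> card (W \<inter> B) \<le> card W - 2"
    then have big: "card (W \<inter> B) \<ge> card W - 1" "card W \<ge> 4" using W by (auto simp: O4_def)
    have Wo: "W \<in> orbits" "finite W" using W finite_orbit by (auto simp: O4_def)
    have "card (W - B) \<le> 1" using big card_Int_Diff[OF Wo(2), of B] by linarith
    moreover obtain y0 where "y0 \<in> W" using big by fastforce
    ultimately have "\<exists>y\<in>W. W - B \<subseteq> {y}"
    proof (cases "W - B = {}")
      case False
      then obtain y where "y \<in> W - B" by blast
      moreover have "\<forall>u\<in>W - B. \<forall>v\<in>W - B. u = v"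
        using \<open>card (W - B) \<le> 1\<close> card_le_Suc0_iff_eq[of "W - B"] Wo(2) by simp
      ultimately show ?thesis by blast
    qed (use \<open>y0 \<in> W\<close> in blast)
    then obtain y where y: "y \<in> W" "W - B \<subseteq> {y}" by blast
    have yS: "y \<in> S" "W = walk_orbit y" using orbit_of_member[OF Wo(1) y(1)] by auto
    have c1: "walk y \<noteq> y" using card_walk_orbit_le[of 1 y] big yS by auto
    have c2: "walk (walk y) \<noteq> y" using card_walk_orbit_le[of 2 y] big yS by (auto simp: eval_nat_numeral)
    have c3: "walk (walk (walk y)) \<noteq> y" using card_walk_orbit_le[of 3 y] big yS by (auto simp: eval_nat_numeral)
    have w1: "walk y \<in> W" using yS walk_in_orbit by simp
    have w2: "walk (walk y) \<in> W" using w1 orbit_of_member[OF Wo(1)] walk_in_orbit by blast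
    have w3: "walk (walk (walk y)) \<in> W" using w2 orbit_of_member[OF Wo(1)] walk_in_orbit by blast
    have "walk y \<in> B" "walk (walk y) \<in> B" "walk (walk (walk y)) \<in> B"
      using y(2) w1 w2 w3 c1 c2 c3 by auto
    moreover have "card (walk_orbit (walk y)) \<ge> 4"
      using w1 orbit_of_member[OF Wo(1)] big by auto
    ultimately show False using no4[of "walk y"] walk_in[OF yS(1)] by (auto simp: B_def)
  qed
  have "B \<subseteq> \<Union> O4"
  proof
    fix d assume d: "d \<in> B"
    then have dS: "d \<in> S" "opp d \<in> S" "card (walk_orbit (opp d)) = 2" using opp_in by (auto simp: B_def)
    then have "card (walk_orbit d) \<notin> {2, 3}" using no23[of "opp d"] opp_opp by auto
    moreover have "walk_orbit d \<in> orbits" using dS by (auto simp: orbits_def)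
    ultimately have "walk_orbit d \<in> O4" using cases4 by (auto simp: O4_def)
    then show "d \<in> \<Union> O4" using walk_orbit_self by blast
  qed
  then have "B = (\<Union>W\<in>O4. W \<inter> B)" by blast
  then have "card B \<le> (\<Sum>W\<in>O4. card (W \<inter> B))" using card_UN_le[OF fin(3), of "\<lambda>W. W \<inter> B"] by simp
  also have "\<dots> \<le> (\<Sum>W\<in>O4. card W - 2)" by (intro sum_mono few)
  finally have le1: "int (card B) \<le> (\<Sum>W\<in>O4. int (card W) - 2)"
  proof -
    assume "card B \<le> (\<Sum>W\<in>O4. card W - 2)"
    then have "int (card B) \<le> (\<Sum>W\<in>O4. int (card W - 2))" by (metis of_nat_mono of_nat_sum)
    also have "\<dots> = (\<Sum>W\<in>O4. int (card W) - 2)" by (intro sum.cong) (auto simp: O4_def of_nat_diff)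
    finally show ?thesis .
  qed
  have "opp ` (\<Union>O2) \<subseteq> B"
  proof
    fix e assume "e \<in> opp ` (\<Union>O2)"
    then obtain d W where d: "e = opp d" "d \<in> W" "W \<in> orbits" "card W = 2" by (auto simp: O2_def)
    then have "d \<in> S" "W = walk_orbit d" using orbit_of_member by auto
    then show "e \<in> B" using d opp_in opp_opp by (auto simp: B_def)
  qed
  moreover have "inj_on opp (\<Union>O2)"
  proof (rule inj_onI)
    fix d e assume "d \<in> \<Union>O2" "e \<in> \<Union>O2" "opp d = opp e"
    moreover then have "d \<in> S" "e \<in> S" using orbit_of_member by (auto simp: O2_def)
    ultimately show "d = e" using opp_inj by blast
  qed
  ultimately have "card (\<Union>O2) \<le> card B" using card_inj_on_le[of opp "\<Union>O2" B] fin(4) by simp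
  moreover have "card (\<Union>O2) = (\<Sum>W\<in>O2. card W)"
  proof (rule card_Union_disjoint)
    show "pairwise disjnt O2" using orbits_disjoint by (auto simp: O2_def pairwise_def disjnt_def)
    show "finite W" if "W \<in> O2" for W using that finite_orbit by (simp add: O2_def)
  qed
  moreover have "(\<Sum>W\<in>O2. card W) = 2 * card O2" by (simp add: O2_def)
  ultimately have le2: "2 * int (card O2) \<le> int (card B)" by simp
  have "card S = (\<Sum>W\<in>orbits. card W)"
    using sum_over_orbits[of "\<lambda>_. 1::nat"] by simp
  then have "3 * int (card orbits) - int (card S) = (\<Sum>W\<in>orbits. 3 - int (card W))"
    by (simp add: sum_subtractf)
  also have "\<dots> = (\<Sum>W\<in>O2. 3 - int (card W)) + (\<Sum>W\<in>O3. 3 - int (card W)) + (\<Sum>W\<in>O4. 3 - int (card W))"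
    by (rule sumsplit)
  also have "(\<Sum>W\<in>O2. 3 - int (card W)) = int (card O2)" by (simp add: O2_def)
  also have "(\<Sum>W\<in>O3. 3 - int (card W)) = 0" by (simp add: O3_def)
  finally have "2 * (3 * int (card orbits) - int (card S))
      = 2 * int (card O2) + (\<Sum>W\<in>O4. 2 * (3 - int (card W)))"
    by (simp add: sum_distrib_left)
  also have "\<dots> \<le> (\<Sum>W\<in>O4. int (card W) - 2) + (\<Sum>W\<in>O4. 2 * (3 - int (card W)))"
    using le1 le2 by linarith
  also have "\<dots> = (\<Sum>W\<in>O4. 4 - int (card W))" by (simp flip: sum.distrib)
  also have "\<dots> \<le> 0" by (rule sum_nonpos) (auto simp: O4_def)
  finally have "3 * int (card orbits) \<le> int (card S)" by simp
  then show False using euler by linarith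
qed

end


section \<open>Edges of a diagram\<close>

locale triple_projection =
  fixes D :: diagram
  assumes periodic: "i < ncomp D \<Longrightarrow> curve D i (s + 1) = curve D i s"
    and smooth: "i < ncomp D \<Longrightarrow> curve D i C1_differentiable_on UNIV"
    and triple: "triple_point_projection D"
begin

abbreviation "MP \<equiv> multiple_points D"

lemma finite_MP: "finite MP"
  using triple unfolding triple_point_projection_def projection_def by blast

lemma card_strands: "p \<in> MP \<Longrightarrow> card (strands D p) = 3"
  using triple unfolding triple_point_projection_def by blast

lemma finite_strands: "p \<in> MP \<Longrightarrow> finite (strands D p)"
  using card_strands card.infinite by fastforce

lemma curve_derivative:
  "i < ncomp D \<Longrightarrow> (curve D i has_vector_derivative vector_derivative (curve D i) (at s)) (at s)"
  using smooth unfolding C1_differentiable_on_eq by (simp add: vector_derivative_works)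

lemma continuous_curve_derivative:
  "i < ncomp D \<Longrightarrow> continuous_on UNIV (\<lambda>s. vector_derivative (curve D i) (at s))"
  using smooth unfolding C1_differentiable_on_eq by blast

lemma continuous_curve: "i < ncomp D \<Longrightarrow> continuous_on A (curve D i)"
  using smooth C1_differentiable_imp_continuous_on continuous_on_subset by blast

lemma curve_frac: "i < ncomp D \<Longrightarrow> curve D i (frac s) = curve D i s"
  by (rule periodic_frac) (rule periodic)

lemma curve_cong: "i < ncomp D \<Longrightarrow> frac x = frac y \<Longrightarrow> curve D i x = curve D i y"
  by (metis curve_frac)

lemma strand_of_param: "i < ncomp D \<Longrightarrow> (i, frac s) \<in> strands D (curve D i s)"
  by (simp add: strands_def point_of_def curve_frac frac_lt_1)

lemma curve_injective:
  assumes "i < ncomp D" "j < ncomp D" "curve D i x = curve D j y" "curve D i x \<notin> MP"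
  shows "i = j" "frac x = frac y"
proof -
  have "(i, frac x) = (j, frac y)"
    using strand_of_param[OF assms(1), of x] strand_of_param[OF assms(2), of y] assms(3,4)
    unfolding multiple_points_def by (metis (mono_tags, lifting) mem_Collect_eq)
  then show "i = j" "frac x = frac y" by auto
qed

abbreviation "CP \<equiv> crossing_params D"

lemma CP_range: "s \<in> CP i \<Longrightarrow> 0 \<le> s \<and> s < 1"
  by (simp add: crossing_params_def)

lemma CP_frac [simp]: "s \<in> CP i \<Longrightarrow> frac s = s"
  using CP_range by (simp add: frac_eq)

lemma frac_in_CP: "i < ncomp D \<Longrightarrow> frac x \<in> CP i \<longleftrightarrow> curve D i x \<in> MP"
  by (simp add: crossing_params_def curve_frac frac_lt_1)

lemma finite_CP: "i < ncomp D \<Longrightarrow> finite (CP i)"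
proof (rule finite_subset)
  assume i: "i < ncomp D"
  show "CP i \<subseteq> snd ` (\<Union>p\<in>MP. strands D p)"
  proof
    fix s assume s: "s \<in> CP i"
    then have "(i, s) \<in> strands D (curve D i s)" using strand_of_param[OF i, of s] by simp
    moreover have "curve D i s \<in> MP" using s by (simp add: crossing_params_def)
    ultimately show "s \<in> snd ` (\<Union>p\<in>MP. strands D p)" by force
  qed
  show "finite (snd ` (\<Union>p\<in>MP. strands D p))" using finite_MP finite_strands by blast
qed

lemma darts_iff: "((i, s), b) \<in> darts D \<longleftrightarrow> i < ncomp D \<and> s \<in> CP i"
  by (auto simp: darts_def strands_def point_of_def crossing_params_def)

lemma finite_darts_D: "finite (darts D)"
proof -
  have "darts D = (\<Union>p\<in>MP. strands D p) \<times> UNIV" unfolding darts_def by auto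
  then show ?thesis using finite_MP finite_strands by auto
qed

text \<open>
  The first passage through a crossing after leaving \<open>x\<close> in the direction \<open>\<sigma>\<close>, which is \<open>1\<close> or \<open>-1\<close>, is at
  parameter distance \<open>u\<close>. Measuring the distance instead of the parameter makes the passage through
  the parameter 0 invisible and turns reversal into a change of sign.
\<close>

definition hit :: "nat \<Rightarrow> real \<Rightarrow> real \<Rightarrow> real \<Rightarrow> bool" where
  "hit i \<sigma> x u \<longleftrightarrow> 0 < u \<and> u \<le> 1 \<and> frac (x + \<sigma> * u) \<in> CP i \<and> (\<forall>u'. 0 < u' \<and> u' < u \<longrightarrow> frac (x + \<sigma> * u') \<notin> CP i)"

lemma hit_unique: "hit i \<sigma> x u \<Longrightarrow> hit i \<sigma> x u' \<Longrightarrow> u = u'"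
  unfolding hit_def by (meson linorder_neqE_linordered_idom)

lemma frac_add_of_int: "frac (x + of_int k) = frac x" for x :: real
  by (simp add: frac_def)

lemma frac_shift: "frac (frac x + y) = frac (x + y)" "frac (y + frac x) = frac (y + x)"
  "frac (frac x - y) = frac (x - y)" for x y :: real
proof -
  have "frac x + y = (x + y) + of_int (- \<lfloor>x\<rfloor>)" "frac x - y = (x - y) + of_int (- \<lfloor>x\<rfloor>)"
    by (auto simp: frac_def)
  then show "frac (frac x + y) = frac (x + y)" "frac (frac x - y) = frac (x - y)"
    by (metis frac_add_of_int)+
  then show "frac (y + frac x) = frac (y + x)" by (simp add: add.commute)
qed

lemma hit_exists:
  assumes i: "i < ncomp D" and ne: "CP i \<noteq> {}" and \<sigma>: "\<sigma> = 1 \<or> \<sigma> = -1"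
  shows "\<exists>u. hit i \<sigma> x u"
proof -
  define U where "U = {u. 0 < u \<and> u \<le> 1 \<and> frac (x + \<sigma> * u) \<in> CP i}"
  \<comment> \<open>the distance to \<open>y\<close>; from \<open>x\<close> to itself it is a full period\<close>
  define f where "f y = (if frac (\<sigma> * (y - x)) = 0 then 1 else frac (\<sigma> * (y - x)))" for y
  have fU: "f y \<in> U" if "y \<in> CP i" for y
  proof -
    have "f y = \<sigma> * (y - x) + of_int k" if "k = (if frac (\<sigma> * (y - x)) = 0 then 1 else 0) - \<lfloor>\<sigma> * (y - x)\<rfloor>" for k
      using that by (auto simp: f_def frac_def)
    then obtain k :: int where k: "f y = \<sigma> * (y - x) + of_int k" by blast
    then have "x + \<sigma> * f y = y + of_int ((if \<sigma> = 1 then 1 else -1) * k)" using \<sigma> by (auto simp: algebra_simps)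
    then have "frac (x + \<sigma> * f y) = y" using that by (metis CP_frac frac_add_of_int)
    moreover have "0 < f y" "f y \<le> 1"
      using frac_ge_0[of "\<sigma> * (y - x)"] frac_lt_1[of "\<sigma> * (y - x)"] by (auto simp: f_def less_eq_real_def)
    ultimately show ?thesis using that by (simp add: U_def)
  qed
  have "U \<subseteq> f ` CP i"
  proof
    fix u assume u: "u \<in> U"
    have "\<sigma> * (frac (x + \<sigma> * u) - x) = u + of_int (- (if \<sigma> = 1 then 1 else -1) * \<lfloor>x + \<sigma> * u\<rfloor>)"
      using \<sigma> by (auto simp: frac_def algebra_simps)
    then have "frac (\<sigma> * (frac (x + \<sigma> * u) - x)) = frac u" by (metis frac_add_of_int)
    moreover have "frac u = (if u = 1 then 0 else u)" using u by (auto simp: U_def frac_eq)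
    ultimately have "f (frac (x + \<sigma> * u)) = u" using u by (auto simp: f_def U_def)
    then show "u \<in> f ` CP i" using u by (force simp: U_def)
  qed
  then have "finite U" using finite_CP[OF i] finite_surj by blast
  moreover have "U \<noteq> {}" using fU ne by blast
  ultimately have "Min U \<in> U" "\<And>u. u \<in> U \<Longrightarrow> Min U \<le> u" by auto
  then have "hit i \<sigma> x (Min U)" unfolding hit_def U_def by force
  then show ?thesis by blast
qed

lemma hit_next:
  assumes i: "i < ncomp D" and s: "s \<in> CP i"
  obtains u where "hit i 1 s u" "next_param D i s = frac (s + u)"
proof -
  define A where "A = {s' \<in> CP i. s < s'}"
  have fin: "finite A" "finite (CP i)" using finite_CP[OF i] by (auto simp: A_def)
  show ?thesis
  proof (cases "A = {}")
    case False
    let ?n = "Min A"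
    have n: "?n \<in> A" "\<And>y. y \<in> A \<Longrightarrow> ?n \<le> y" using fin False by auto
    have "hit i 1 s (?n - s)"
      unfolding hit_def
    proof (intro conjI allI impI)
      show "0 < ?n - s" "?n - s \<le> 1" "frac (s + 1 * (?n - s)) \<in> CP i"
        using n(1) CP_range[of ?n i] CP_range[OF s] by (auto simp: A_def)
      fix u assume u: "0 < u \<and> u < ?n - s"
      then have "frac (s + 1 * u) = s + u" using n(1) CP_range[of ?n i] CP_range[OF s] by (auto simp: A_def frac_eq)
      moreover have "s + u \<notin> A" using n(2)[of "s + u"] u by auto
      ultimately show "frac (s + 1 * u) \<notin> CP i" using u by (simp add: A_def)
    qed
    moreover have "?n \<in> CP i" using n(1) by (auto simp: A_def)
    then have "frac (s + (?n - s)) = ?n" by simp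
    then have "next_param D i s = frac (s + (?n - s))"
      unfolding next_param_def Let_def A_def[symmetric] using False by simp
    ultimately show ?thesis using that by blast
  next
    case True
    let ?n = "Min (CP i)"
    have n: "?n \<in> CP i" "\<And>y. y \<in> CP i \<Longrightarrow> ?n \<le> y" using fin s Min_in by auto
    have r: "0 \<le> ?n" "?n \<le> s" "s < 1" using n CP_range s by blast+
    have "frac (?n + of_int 1) = ?n" using n(1) by (metis CP_frac frac_add_of_int)
    then have e: "frac (s + (?n + 1 - s)) = ?n" by simp
    have "hit i 1 s (?n + 1 - s)"
      unfolding hit_def
    proof (intro conjI allI impI)
      show "0 < ?n + 1 - s" "?n + 1 - s \<le> 1" "frac (s + 1 * (?n + 1 - s)) \<in> CP i"
        using r e n(1) by auto
      fix u assume u: "0 < u \<and> u < ?n + 1 - s"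
      show "frac (s + 1 * u) \<notin> CP i"
      proof (cases "s + u < 1")
        case True
        then have "frac (s + 1 * u) = s + u" using r u by (simp add: frac_eq)
        then show ?thesis using \<open>A = {}\<close> u by (auto simp: A_def)
      next
        case False
        have "frac (s + u - 1 + of_int 1) = frac (s + u - 1)" by (rule frac_add_of_int)
        then have "frac (s + 1 * u) = s + u - 1" using r u False by (simp add: frac_eq)
        then show ?thesis using n(2)[of "s + u - 1"] u by auto
      qed
    qed
    moreover have "next_param D i s = frac (s + (?n + 1 - s))"
      unfolding e using True by (simp add: next_param_def A_def Let_def)
    ultimately show ?thesis using that by blast
  qed
qed

lemma hit_prev:
  assumes i: "i < ncomp D" and s: "s \<in> CP i"
  obtains u where "hit i (-1) s u" "prev_param D i s = frac (s - u)"
proof -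
  define A where "A = {s' \<in> CP i. s' < s}"
  have fin: "finite A" "finite (CP i)" using finite_CP[OF i] by (auto simp: A_def)
  show ?thesis
  proof (cases "A = {}")
    case False
    let ?n = "Max A"
    have n: "?n \<in> A" "\<And>y. y \<in> A \<Longrightarrow> y \<le> ?n" using fin False by auto
    have "hit i (-1) s (s - ?n)"
      unfolding hit_def
    proof (intro conjI allI impI)
      show "0 < s - ?n" "s - ?n \<le> 1" "frac (s + - 1 * (s - ?n)) \<in> CP i"
        using n(1) CP_range[of ?n i] CP_range[OF s] by (auto simp: A_def)
      fix u assume u: "0 < u \<and> u < s - ?n"
      then have "frac (s + - 1 * u) = s - u" using n(1) CP_range[of ?n i] CP_range[OF s] by (auto simp: A_def frac_eq)
      moreover have "s - u \<notin> A" using n(2)[of "s - u"] u by auto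
      ultimately show "frac (s + - 1 * u) \<notin> CP i" using u by (simp add: A_def)
    qed
    moreover have "?n \<in> CP i" using n(1) by (auto simp: A_def)
    then have "frac (s - (s - ?n)) = ?n" by simp
    then have "prev_param D i s = frac (s - (s - ?n))"
      unfolding prev_param_def Let_def A_def[symmetric] using False by simp
    ultimately show ?thesis using that by blast
  next
    case True
    let ?n = "Max (CP i)"
    have n: "?n \<in> CP i" "\<And>y. y \<in> CP i \<Longrightarrow> y \<le> ?n" using fin s Max_in by auto
    have r: "?n < 1" "s \<le> ?n" "0 \<le> s" using n CP_range s by blast+
    have "frac (?n + of_int (-1)) = ?n" using n(1) by (metis CP_frac frac_add_of_int)
    then have e: "frac (s - (s + 1 - ?n)) = ?n" by simp
    have "hit i (-1) s (s + 1 - ?n)"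
      unfolding hit_def
    proof (intro conjI allI impI)
      show "0 < s + 1 - ?n" "s + 1 - ?n \<le> 1" "frac (s + - 1 * (s + 1 - ?n)) \<in> CP i"
        using r e n(1) by (auto simp: algebra_simps)
      fix u assume u: "0 < u \<and> u < s + 1 - ?n"
      show "frac (s + - 1 * u) \<notin> CP i"
      proof (cases "s - u \<ge> 0")
        case True
        then have "frac (s + - 1 * u) = s - u" using r u by (simp add: frac_eq)
        then show ?thesis using \<open>A = {}\<close> u by (auto simp: A_def)
      next
        case False
        have "frac (s - u + 1 + of_int (-1)) = frac (s - u + 1)" by (rule frac_add_of_int)
        then have "frac (s + - 1 * u) = s - u + 1" using r u False by (simp add: frac_eq)
        then show ?thesis using n(2)[of "s - u + 1"] u by auto
      qed
    qed
    moreover have "prev_param D i s = frac (s - (s + 1 - ?n))"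
      unfolding e using True by (simp add: prev_param_def A_def Let_def)
    ultimately show ?thesis using that by blast
  qed
qed

definition dart_sign :: "dart \<Rightarrow> real" where "dart_sign d = (if snd d then 1 else -1)"

definition stride :: "dart \<Rightarrow> real" where
  "stride d = (THE u. hit (fst (fst d)) (dart_sign d) (snd (fst d)) u)"

lemma dart_sign_cases: "dart_sign d = 1 \<or> dart_sign d = -1" by (simp add: dart_sign_def)

lemma stride_hit:
  assumes "d \<in> darts D"
  shows "hit (fst (fst d)) (dart_sign d) (snd (fst d)) (stride d)"
proof -
  obtain i s b where d: "d = ((i, s), b)" by (metis prod.exhaust)
  then have "i < ncomp D" "CP i \<noteq> {}" using assms darts_iff by auto
  then have "\<exists>!u. hit (fst (fst d)) (dart_sign d) (snd (fst d)) u"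
    using hit_exists[OF _ _ dart_sign_cases] hit_unique d by (metis fst_conv)
  then show ?thesis unfolding stride_def by (rule theI')
qed

lemma hit_reverse:
  assumes "hit i \<sigma> s u" "s \<in> CP i"
  shows "hit i (- \<sigma>) (frac (s + \<sigma> * u)) u"
proof -
  have e: "frac (frac (s + \<sigma> * u) + - \<sigma> * u') = frac (s + \<sigma> * (u - u'))" for u'
    unfolding frac_shift by (rule arg_cong[of _ _ frac]) (simp add: algebra_simps)
  show ?thesis
    unfolding hit_def e
  proof (intro conjI allI impI)
    show "frac (s + \<sigma> * (u - u)) \<in> CP i" using assms(2) by simp
    fix u' assume "0 < u' \<and> u' < u"
    then have "0 < u - u' \<and> u - u' < u" by auto
    then show "frac (s + \<sigma> * (u - u')) \<notin> CP i" using assms(1) unfolding hit_def by blast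
  qed (use assms(1) in \<open>auto simp: hit_def\<close>)
qed

lemma opp_eq:
  assumes "d \<in> darts D"
  shows "opp D d = ((fst (fst d), frac (snd (fst d) + dart_sign d * stride d)), \<not> snd d)"
proof -
  obtain i s b where d: "d = ((i, s), b)" by (metis prod.exhaust)
  then have i: "i < ncomp D" "s \<in> CP i" using assms darts_iff by auto
  have h: "hit i (dart_sign d) s (stride d)" using stride_hit[OF assms] d by simp
  show ?thesis
  proof (cases b)
    case True
    obtain u where u: "hit i 1 s u" "next_param D i s = frac (s + u)" using hit_next[OF i] by blast
    then have "u = stride d" using h True hit_unique d by (auto simp: dart_sign_def)
    then show ?thesis using d True u by (simp add: dart_sign_def)
  next
    case False
    obtain u where u: "hit i (-1) s u" "prev_param D i s = frac (s - u)" using hit_prev[OF i] by blast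
    then have "u = stride d" using h False hit_unique d by (auto simp: dart_sign_def)
    then show ?thesis using d False u by (simp add: dart_sign_def)
  qed
qed

lemma opp_in_darts: "d \<in> darts D \<Longrightarrow> opp D d \<in> darts D"
  using opp_eq[of d] stride_hit[of d] darts_iff[of "fst (fst d)" "snd (fst d)" "snd d"] darts_iff
  by (simp add: hit_def)

lemma dart_sign_opp: "d \<in> darts D \<Longrightarrow> dart_sign (opp D d) = - dart_sign d"
  using opp_eq by (simp add: dart_sign_def)

lemma stride_opp:
  assumes "d \<in> darts D"
  shows "stride (opp D d) = stride d"
proof -
  have "snd (fst d) \<in> CP (fst (fst d))" using assms darts_iff[of "fst (fst d)" "snd (fst d)" "snd d"] by simp
  from hit_reverse[OF stride_hit[OF assms] this]
  have "hit (fst (fst (opp D d))) (dart_sign (opp D d)) (snd (fst (opp D d))) (stride d)"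
    using dart_sign_opp[OF assms] opp_eq[OF assms] by simp
  then show ?thesis using stride_hit[OF opp_in_darts[OF assms]] hit_unique by blast
qed

lemma opp_opp_D: "d \<in> darts D \<Longrightarrow> opp D (opp D d) = d"
proof -
  assume d: "d \<in> darts D"
  have s: "snd (fst d) \<in> CP (fst (fst d))" using d darts_iff[of "fst (fst d)" "snd (fst d)" "snd d"] by simp
  have "frac (frac (snd (fst d) + dart_sign d * stride d) + - dart_sign d * stride d) = frac (snd (fst d))"
    by (simp add: frac_shift)
  moreover have "opp D (opp D d) = ((fst (fst d), frac (frac (snd (fst d) + dart_sign d * stride d) + - dart_sign d * stride d)), snd d)"
    unfolding opp_eq[OF opp_in_darts[OF d]] dart_sign_opp[OF d] stride_opp[OF d] unfolding opp_eq[OF d] by simp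
  ultimately have "opp D (opp D d) = ((fst (fst d), snd (fst d)), snd d)"
    using s by simp
  then show ?thesis by simp
qed

lemma opp_neq_D: "d \<in> darts D \<Longrightarrow> opp D d \<noteq> d"
  using opp_eq by (metis snd_conv)

lemma stride_pos: "d \<in> darts D \<Longrightarrow> 0 < stride d" "d \<in> darts D \<Longrightarrow> stride d \<le> 1"
  using stride_hit by (auto simp: hit_def)

text \<open>
  The arc of a dart is parametrised by \<open>{0..1}\<close>, so that opposite darts have reversed parametrisations.
\<close>

definition edge :: "dart \<Rightarrow> real \<Rightarrow> complex" where
  "edge d t = curve D (fst (fst d)) (snd (fst d) + dart_sign d * stride d * t)"

lemma comp_less: "d \<in> darts D \<Longrightarrow> fst (fst d) < ncomp D"
  using darts_iff by (metis prod.collapse)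

lemma param_in_CP: "d \<in> darts D \<Longrightarrow> snd (fst d) \<in> CP (fst (fst d))"
  using darts_iff by (metis prod.collapse)

lemma edge_0: "edge d 0 = origin D d"
  by (simp add: edge_def origin_def point_of_def)

lemma edge_opp:
  assumes d: "d \<in> darts D"
  shows "edge (opp D d) t = edge d (1 - t)"
proof -
  have e: "fst (fst (opp D d)) = fst (fst d)" "snd (fst (opp D d)) = frac (snd (fst d) + dart_sign d * stride d)"
    by (simp_all add: opp_eq[OF d])
  have "frac (frac (snd (fst d) + dart_sign d * stride d) + - dart_sign d * stride d * t)
      = frac (snd (fst d) + dart_sign d * stride d * (1 - t))"
    unfolding frac_shift by (rule arg_cong[of _ _ frac]) (simp add: algebra_simps)
  from curve_cong[OF comp_less[OF d] this] show ?thesis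
    unfolding edge_def dart_sign_opp[OF d] stride_opp[OF d] e .
qed

lemma edge_1: "d \<in> darts D \<Longrightarrow> edge d 1 = origin D (opp D d)"
  using edge_opp[of d 0] edge_0[of "opp D d"] by simp

lemma origin_in_MP: "d \<in> darts D \<Longrightarrow> origin D d \<in> MP"
  by (auto simp: darts_def origin_def strands_def)

lemma edge_interior:
  assumes "d \<in> darts D" "0 < t" "t < 1"
  shows "edge d t \<notin> MP"
proof -
  have "0 < stride d * t" "stride d * t < stride d" using stride_pos[OF assms(1)] assms by auto
  then have "frac (snd (fst d) + dart_sign d * (stride d * t)) \<notin> CP (fst (fst d))"
    using stride_hit[OF assms(1)] unfolding hit_def by blast
  then show ?thesis unfolding edge_def using frac_in_CP[OF comp_less[OF assms(1)]] by (simp add: mult.assoc)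
qed

lemma edge_injective_forward:
  assumes d: "d \<in> darts D" "d' \<in> darts D" and t: "0 < t" "t < 1" "0 < t'" "t' < 1"
    and eq: "edge d t = edge d' t'" and fwd: "snd d" "snd d'" and le: "stride d * t \<le> stride d' * t'"
  shows "d = d' \<and> t = t'"
proof -
  have i: "fst (fst d) = fst (fst d')"
    and f: "frac (snd (fst d) + stride d * t) = frac (snd (fst d') + stride d' * t')"
    using curve_injective[OF comp_less[OF d(1)] comp_less[OF d(2)] eq[unfolded edge_def]]
      edge_interior[OF d(1) t(1,2)] fwd unfolding edge_def by (auto simp: dart_sign_def)
  define u where "u = stride d' * t' - stride d * t"
  have "frac (snd (fst d)) = frac (frac (snd (fst d) + stride d * t) - stride d * t)" by (simp add: frac_shift)
  also have "\<dots> = frac (snd (fst d') + 1 * u)" unfolding f by (simp add: frac_shift u_def algebra_simps)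
  finally have hu: "frac (snd (fst d') + 1 * u) = snd (fst d)" using param_in_CP[OF d(1)] by simp
  have "u < stride d'"
    using t stride_pos[OF d(1)] stride_pos[OF d(2)] unfolding u_def
    by (smt (verit) mult_less_cancel_left2 mult_pos_pos)
  then have "u = 0"
    using stride_hit[OF d(2)] hu param_in_CP[OF d(1)] le fwd i unfolding hit_def u_def
    by (auto simp: dart_sign_def) (metis diff_gt_0_iff_gt less_eq_real_def)
  then have "snd (fst d) = snd (fst d')" using hu param_in_CP[OF d(2)] by simp
  then have "d = d'" using i fwd by (simp add: prod_eq_iff)
  then show ?thesis using \<open>u = 0\<close> stride_pos[OF d(2)] unfolding u_def by simp
qed

lemma edge_injective:
  assumes d: "d \<in> darts D" "d' \<in> darts D" and t: "0 < t" "t < 1" "0 < t'" "t' < 1"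
    and eq: "edge d t = edge d' t'"
  shows "d' = d \<and> t' = t \<or> d' = opp D d \<and> t' = 1 - t"
proof -
  define e s where "e = (if snd d then d else opp D d)" and "s = (if snd d then t else 1 - t)"
  define e' s' where "e' = (if snd d' then d' else opp D d')" and "s' = (if snd d' then t' else 1 - t')"
  have e: "e \<in> darts D" "snd e" "0 < s" "s < 1" "edge e s = edge d t"
    using d t opp_in_darts[OF d(1)] edge_opp[OF d(1), of "1 - t"] arg_cong[OF opp_eq[OF d(1)], of snd]
    by (simp_all add: e_def s_def)
  have e': "e' \<in> darts D" "snd e'" "0 < s'" "s' < 1" "edge e' s' = edge d' t'"
    using d t opp_in_darts[OF d(2)] edge_opp[OF d(2), of "1 - t'"] arg_cong[OF opp_eq[OF d(2)], of snd]
    by (simp_all add: e'_def s'_def)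
  have "e = e' \<and> s = s'"
    using edge_injective_forward[OF e(1) e'(1) e(3,4) e'(3,4)] edge_injective_forward[OF e'(1) e(1) e'(3,4) e(3,4)]
      e e' eq by (metis linear)
  then have *: "e = e'" "s = s'" by auto
  have inv: "opp D (opp D d) = d" "opp D (opp D d') = d'" using opp_opp_D d by auto
  consider "snd d = snd d'" | "snd d" "\<not> snd d'" | "\<not> snd d" "snd d'" by blast
  then show ?thesis
  proof cases
    case 1
    show ?thesis
    proof (cases "snd d")
      case True
      then show ?thesis using * 1 by (simp add: e_def e'_def s_def s'_def)
    next
      case False
      then have "opp D d = opp D d'" "t = t'" using * 1 by (simp_all add: e_def e'_def s_def s'_def)
      then show ?thesis using inv by metis
    qed
  next
    case 2
    then have "d = opp D d'" "t = 1 - t'" using * by (simp_all add: e_def e'_def s_def s'_def)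
    then show ?thesis using inv by simp
  next
    case 3
    then have "opp D d = d'" "1 - t = t'" using * by (simp_all add: e_def e'_def s_def s'_def)
    then show ?thesis by blast
  qed
qed

text \<open>
  The components without crossings carry no darts, but they are part of the projection and can lie
  inside the faces of the graph.
\<close>

definition free_circles :: "complex set" where
  "free_circles = (\<Union>i\<in>{i. i < ncomp D \<and> CP i = {}}. range (curve D i))"

abbreviation "P \<equiv> projection_image D"

lemma compact_free_circles: "compact free_circles"
proof -
  have "compact (range (curve D i))" if "i < ncomp D" for i
    unfolding periodic_range(2)[where f = "curve D i", OF periodic[OF that]]
    by (intro compact_continuous_image continuous_curve[OF that]) auto
  then show ?thesis unfolding free_circles_def by (intro compact_UN) auto
qed

lemma free_circles_disjoint_MP: "free_circles \<inter> MP = {}"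
  unfolding free_circles_def using frac_in_CP by blast

lemma free_circles_disjoint_edge:
  assumes "d \<in> darts D" "0 \<le> t" "t \<le> 1"
  shows "edge d t \<notin> free_circles"
proof
  assume f: "edge d t \<in> free_circles"
  have "edge d t \<notin> MP" using f free_circles_disjoint_MP by blast
  obtain j x where j: "j < ncomp D" "CP j = {}" "edge d t = curve D j x"
    using f by (auto simp: free_circles_def)
  then have "fst (fst d) = j"
    using curve_injective(1)[OF comp_less[OF assms(1)]] \<open>edge d t \<notin> MP\<close> unfolding edge_def by blast
  then show False using param_in_CP[OF assms(1)] j(2) by blast
qed

lemma continuous_edge: "d \<in> darts D \<Longrightarrow> continuous_on A (edge d)"
  unfolding edge_def by (intro continuous_on_compose2[OF continuous_curve[of _ UNIV]] continuous_intros comp_less) auto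

lemma edge_in_P: "d \<in> darts D \<Longrightarrow> edge d t \<in> P"
  unfolding projection_image_def edge_def using comp_less by blast

lemma MP_subset_P: "MP \<subseteq> P"
  by (auto simp: multiple_points_def strands_def point_of_def projection_image_def)

lemma P_eq: "P = free_circles \<union> (\<Union>d\<in>darts D. edge d ` {0..1})"
proof
  show "P \<subseteq> free_circles \<union> (\<Union>d\<in>darts D. edge d ` {0..1})"
  proof
    fix q assume "q \<in> P"
    then obtain i x where q: "i < ncomp D" "q = curve D i x" by (auto simp: projection_image_def)
    show "q \<in> free_circles \<union> (\<Union>d\<in>darts D. edge d ` {0..1})"
    proof (cases "CP i = {}")
      case True
      then show ?thesis using q by (auto simp: free_circles_def)
    next
      case False
      obtain u where u: "hit i (-1) x u" using hit_exists[OF q(1) False] by blast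
      define d where "d = ((i, frac (x - u)), True)"
      have d: "d \<in> darts D" using u q by (simp add: d_def darts_iff hit_def)
      have "u \<le> stride d"
      proof (rule ccontr)
        assume "\<not> u \<le> stride d"
        moreover have "frac (frac (x - u) + stride d) \<in> CP i"
          using stride_hit[OF d] by (simp add: hit_def d_def dart_sign_def)
        then have "frac (x + - 1 * (u - stride d)) \<in> CP i" by (simp add: frac_shift algebra_simps)
        ultimately show False using u stride_pos[OF d] unfolding hit_def by (smt (verit))
      qed
      then have "u / stride d \<in> {0..1}" using u stride_pos[OF d] by (simp add: hit_def)
      moreover have "edge d (u / stride d) = q"
        unfolding edge_def q(2) using stride_pos[OF d]
        by (simp add: d_def dart_sign_def, intro curve_cong q) (simp add: frac_shift)
      ultimately show ?thesis using d by blast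
    qed
  qed
  show "free_circles \<union> (\<Union>d\<in>darts D. edge d ` {0..1}) \<subseteq> P"
    using edge_in_P by (auto simp: free_circles_def projection_image_def)
qed

lemma compact_P: "compact P"
  unfolding P_eq
  by (intro compact_Un compact_free_circles compact_UN finite_darts_D compact_continuous_image continuous_edge) auto

lemma closed_P: "closed P" using compact_P compact_imp_closed by blast

text \<open>
  Every point of an edge lies on one of its two halves. In contrast to a whole edge, a half starts at one
  vertex and stays away from all others, even if the edge is a loop.
\<close>

lemma P_half_edges: "P = free_circles \<union> (\<Union>d\<in>darts D. edge d ` {0..1/2})"
proof -
  have "edge d t \<in> (\<Union>d\<in>darts D. edge d ` {0..1/2})" if "d \<in> darts D" "t \<in> {0..1}" for d t
  proof (cases "t \<le> 1/2")
    case True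
    then show ?thesis using that by force
  next
    case False
    then have "edge d t = edge (opp D d) (1 - t)" "1 - t \<in> {0..1/2}" using edge_opp[OF that(1)] that by auto
    then show ?thesis using opp_in_darts[OF that(1)] by blast
  qed
  then have "(\<Union>d\<in>darts D. edge d ` {0..1}) \<subseteq> (\<Union>d\<in>darts D. edge d ` {0..1/2})"
    by (intro UN_least image_subsetI)
  moreover have "(\<Union>d\<in>darts D. edge d ` {0..1/2}) \<subseteq> (\<Union>d\<in>darts D. edge d ` {0..1})"
    by (intro UN_mono image_mono) auto
  ultimately have "(\<Union>d\<in>darts D. edge d ` {0..1}) = (\<Union>d\<in>darts D. edge d ` {0..1/2})"
    by (rule subset_antisym)
  then show ?thesis unfolding P_eq by (simp only:)
qed

end


section \<open>The cyclic order of the darts at a vertex\<close>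

text \<open>
  Think of \<open>A x y\<close> as the angle from \<open>x\<close> to \<open>y\<close> in one direction, with full turn \<open>c\<close>. An orbit of \<open>s\<close>
  that misses \<open>y\<close> has an element for which the angle to \<open>y\<close> is smallest, but the successor of this
  element is even closer. So there is a single orbit.
\<close>

lemma nearest_successor_is_cyclic:
  fixes A :: "'a \<Rightarrow> 'a \<Rightarrow> real"
  assumes X: "finite X" "card X \<ge> 2"
    and range: "\<And>x y. 0 \<le> A x y \<and> A x y < c"
    and zero: "\<And>x y. x \<in> X \<Longrightarrow> y \<in> X \<Longrightarrow> x \<noteq> y \<Longrightarrow> A x y \<noteq> 0"
    and add: "\<And>x y z. x \<in> X \<Longrightarrow> y \<in> X \<Longrightarrow> z \<in> X \<Longrightarrow> A x y + A y z = A x z \<or> A x y + A y z = A x z + c"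
    and s: "\<And>x. x \<in> X \<Longrightarrow> s x \<in> X \<and> s x \<noteq> x"
    and min: "\<And>x y. x \<in> X \<Longrightarrow> y \<in> X \<Longrightarrow> y \<noteq> x \<Longrightarrow> A x (s x) \<le> A x y"
    and x: "x \<in> X"
  shows "(s ^^ card X) x = x" "\<And>k. 0 < k \<Longrightarrow> (s ^^ k) x = x \<Longrightarrow> card X \<le> k"
    "\<And>y. y \<in> X \<Longrightarrow> \<exists>k. (s ^^ k) x = y"
proof -
  have pow: "(s ^^ k) x \<in> X" if "x \<in> X" for k x using that s by (induction k) auto
  have orbit: "range (\<lambda>k. (s ^^ k) x) = X" if xX: "x \<in> X" for x
  proof (rule ccontr)
    let ?O = "range (\<lambda>k. (s ^^ k) x)"
    assume "?O \<noteq> X"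
    then obtain y where y: "y \<in> X" "y \<notin> ?O" using pow[OF xX] by blast
    have "finite ?O" using pow[OF xX] X(1) finite_subset[of ?O X] by blast
    then obtain d where d: "d \<in> ?O" "\<And>e. e \<in> ?O \<Longrightarrow> A d y \<le> A e y"
      using ex_is_arg_min_if_finite[of ?O "\<lambda>e. A e y"] by (auto simp: is_arg_min_linorder)
    have dX: "d \<in> X" "s d \<in> X" "d \<noteq> y" using d(1) y pow[OF xX] s by auto
    obtain k where "d = (s ^^ k) x" using d(1) by blast
    then have "s d = (s ^^ Suc k) x" by simp
    then have "s d \<in> ?O" by blast
    then have "A d y \<le> A (s d) y" using d(2) by blast
    moreover have "A d (s d) > 0" using zero[of d "s d"] range[of d "s d"] dX s[OF dX(1)] by force
    moreover have "A d (s d) \<le> A d y" using min dX y by auto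
    moreover have "A (s d) y < c" using range by blast
    ultimately show False using add[OF dX(1,2) y(1)] by linarith
  qed
  show "\<exists>k. (s ^^ k) x = y" if "y \<in> X" for y using orbit[OF x] that by auto
  show least: "card X \<le> k" if "0 < k" "(s ^^ k) x = x" for k
    using orbit[OF x] periodic_orbit_segment[OF that(2,1)] card_image_le[of "{..<k}" "\<lambda>k. (s ^^ k) x"] by simp
  have "\<not> inj_on (\<lambda>k. (s ^^ k) x) {..card X}"
  proof
    assume "inj_on (\<lambda>k. (s ^^ k) x) {..card X}"
    then have "card {..card X} \<le> card X" using X(1) pow[OF x] by (intro card_inj_on_le) auto
    then show False by simp
  qed
  then obtain i j where ij: "i < j" "j \<le> card X" "(s ^^ i) x = (s ^^ j) x"
    unfolding inj_on_def by (metis atMost_iff linorder_neqE_nat)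
  let ?y = "(s ^^ i) x"
  have "(s ^^ (j - i)) ?y = (s ^^ (j - i + i)) x" by (simp only: funpow_add comp_apply)
  then have p: "(s ^^ (j - i)) ?y = ?y" using ij by simp
  have "card X \<le> j - i"
    using orbit[OF pow[OF x, of i]] periodic_orbit_segment[OF p] ij card_image_le[of "{..<j - i}" "\<lambda>k. (s ^^ k) ?y"] by simp
  then have "i = 0" "j = card X" using ij by linarith+
  then show "(s ^^ card X) x = x" using ij by simp
qed

context triple_projection begin

definition darts_at :: "complex \<Rightarrow> dart set" where "darts_at v = {d \<in> darts D. origin D d = v}"

lemma darts_at_eq: "v \<in> MP \<Longrightarrow> darts_at v = strands D v \<times> UNIV"
  unfolding darts_at_def darts_def origin_def by (auto simp: strands_def)

lemma finite_darts_at: "finite (darts_at v)" unfolding darts_at_def using finite_darts_D by simp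

lemma card_darts_at: "v \<in> MP \<Longrightarrow> card (darts_at v) = 6"
  by (simp add: darts_at_eq card_cartesian_product card_strands)

lemma fst_dart_strand: "d \<in> darts D \<Longrightarrow> fst d \<in> strands D (origin D d)"
  by (auto simp: darts_def origin_def strands_def)

lemma tangents_transverse:
  assumes "v \<in> MP" "a \<in> strands D v" "b \<in> strands D v" "a \<noteq> b"
  shows "transverse (tangent D a) (tangent D b)"
  using triple assms unfolding triple_point_projection_def projection_def pairwise_def by blast

lemma direction_nonzero:
  assumes "d \<in> darts D"
  shows "direction D d \<noteq> 0"
proof -
  have v: "origin D d \<in> MP" using origin_in_MP assms by blast
  have "\<not> strands D (origin D d) \<subseteq> {fst d}"
    using card_strands[OF v] card_mono[of "{fst d}" "strands D (origin D d)"] by auto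
  then obtain b where "b \<in> strands D (origin D d)" "fst d \<noteq> b" by blast
  then have "transverse (tangent D (fst d)) (tangent D b)"
    using tangents_transverse v fst_dart_strand assms by blast
  then have "tangent D (fst d) \<noteq> 0" unfolding transverse_def collinear_lemma by blast
  then show ?thesis by (simp add: direction_def)
qed

lemma directions_distinct:
  assumes d: "d \<in> darts D" "d' \<in> darts D" "origin D d = origin D d'"
    and r: "direction D d' = of_real r * direction D d" "r > 0"
  shows "d' = d"
proof (cases "fst d = fst d'")
  case True
  have "snd d' = snd d"
  proof (rule ccontr)
    assume "snd d' \<noteq> snd d"
    then have "direction D d' = - direction D d" using True by (auto simp: direction_def)
    then have "of_real (r + 1) * direction D d = 0" using r(1) by (simp add: algebra_simps)
    then have "r + 1 = 0" using direction_nonzero[OF d(1)] by (metis mult_eq_0_iff of_real_eq_0_iff)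
    then show False using r(2) by simp
  qed
  then show ?thesis using True by (simp add: prod_eq_iff)
next
  case False
  have "transverse (tangent D (fst d)) (tangent D (fst d'))"
    using tangents_transverse[OF origin_in_MP[OF d(1)]] fst_dart_strand d False by metis
  moreover have "tangent D (fst d') = (if snd d = snd d' then r else - r) *\<^sub>R tangent D (fst d)"
  proof -
    have "tangent D (fst d') = (if snd d' then 1 else -1) * direction D d'"
      by (simp add: direction_def)
    then have "tangent D (fst d') = (if snd d' then 1 else -1) * (of_real r * direction D d)"
      by (simp only: r(1))
    then show ?thesis by (simp add: direction_def scaleR_conv_of_real)
  qed
  ultimately show ?thesis unfolding transverse_def collinear_lemma by blast
qed

definition cw_angle :: "dart \<Rightarrow> dart \<Rightarrow> real" where
  "cw_angle d d' = Arg2pi (direction D d / direction D d')"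

lemma cw_angle_nonzero:
  assumes "d \<in> darts_at v" "d' \<in> darts_at v" "d \<noteq> d'"
  shows "cw_angle d d' \<noteq> 0"
proof
  assume "cw_angle d d' = 0"
  then have "direction D d / direction D d' = of_real (cmod (direction D d / direction D d'))"
    using Arg2pi_eq[of "direction D d / direction D d'"] by (simp add: cw_angle_def)
  moreover have nz: "direction D d' \<noteq> 0" "direction D d \<noteq> 0" using direction_nonzero assms unfolding darts_at_def by auto
  ultimately have "direction D d = of_real (cmod (direction D d / direction D d')) * direction D d'"
    by (metis nonzero_divide_eq_eq)
  then have "d = d'" using directions_distinct[of d' d "cmod (direction D d / direction D d')"] nz assms
    unfolding darts_at_def by auto
  then show False using assms by blast
qed

lemma cw_angle_add:
  assumes "d \<in> darts_at v" "d' \<in> darts_at v" "d'' \<in> darts_at v"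
  shows "cw_angle d d' + cw_angle d' d'' = cw_angle d d'' \<or> cw_angle d d' + cw_angle d' d'' = cw_angle d d'' + 2 * pi"
proof -
  have nz: "direction D d \<noteq> 0" "direction D d' \<noteq> 0" "direction D d'' \<noteq> 0"
    using direction_nonzero assms unfolding darts_at_def by auto
  have "direction D d / direction D d' * (direction D d' / direction D d'') = direction D d / direction D d''"
    using nz by simp
  then show ?thesis
    using Arg2pi_times[of "direction D d / direction D d'" "direction D d' / direction D d''"] nz
    unfolding cw_angle_def by (auto split: if_splits)
qed

lemma rot_cw_nearest:
  assumes d: "d \<in> darts_at v" and v: "v \<in> MP"
  shows "rot_cw D d \<in> darts_at v" "rot_cw D d \<noteq> d"
    "\<And>e. e \<in> darts_at v \<Longrightarrow> e \<noteq> d \<Longrightarrow> cw_angle d (rot_cw D d) \<le> cw_angle d e"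
proof -
  let ?S = "{d' \<in> darts D. origin D d' = origin D d \<and> d' \<noteq> d}"
  have S: "?S = darts_at v - {d}" using d unfolding darts_at_def by auto
  have "\<not> darts_at v \<subseteq> {d}" using card_darts_at[OF v] card_mono[of "{d}" "darts_at v"] by auto
  then have ne: "?S \<noteq> {}" unfolding S by blast
  have fin: "finite ?S" unfolding S using finite_darts_at by simp
  have rc: "rot_cw D d = arg_min_on (cw_angle d) ?S" unfolding rot_cw_def cw_angle_def by simp
  have "rot_cw D d \<in> ?S" "\<not> (\<exists>x\<in>?S. cw_angle d x < cw_angle d (rot_cw D d))"
    unfolding rc by (rule arg_min_if_finite[OF fin ne])+
  then show "rot_cw D d \<in> darts_at v" "rot_cw D d \<noteq> d"
    "\<And>e. e \<in> darts_at v \<Longrightarrow> e \<noteq> d \<Longrightarrow> cw_angle d (rot_cw D d) \<le> cw_angle d e"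
    unfolding S by (auto simp: not_less)
qed

lemma rot_cw_cyclic:
  assumes "d \<in> darts D"
  shows "(rot_cw D ^^ 6) d = d" "\<And>k. 0 < k \<Longrightarrow> (rot_cw D ^^ k) d = d \<Longrightarrow> 6 \<le> k"
    "\<And>e. e \<in> darts_at (origin D d) \<Longrightarrow> \<exists>k. (rot_cw D ^^ k) d = e"
proof -
  let ?v = "origin D d"
  have v: "?v \<in> MP" and dv: "d \<in> darts_at ?v" using origin_in_MP assms by (auto simp: darts_at_def)
  note c = nearest_successor_is_cyclic[of "darts_at ?v" cw_angle "2 * pi" "rot_cw D", OF finite_darts_at _ _ cw_angle_nonzero cw_angle_add _ _ dv]
  have r: "0 \<le> cw_angle x y \<and> cw_angle x y < 2 * pi" for x y
    unfolding cw_angle_def using Arg2pi_ge_0 Arg2pi_lt_2pi by blast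
  show "(rot_cw D ^^ 6) d = d" "\<And>k. 0 < k \<Longrightarrow> (rot_cw D ^^ k) d = d \<Longrightarrow> 6 \<le> k"
    "\<And>e. e \<in> darts_at ?v \<Longrightarrow> \<exists>k. (rot_cw D ^^ k) d = e"
    using c rot_cw_nearest[OF _ v] r unfolding card_darts_at[OF v] by auto
qed

lemma rot_cw_in_darts: "d \<in> darts D \<Longrightarrow> rot_cw D d \<in> darts D"
  using rot_cw_nearest(1)[of d "origin D d"] origin_in_MP unfolding darts_at_def by blast

lemma origin_rot_cw: "d \<in> darts D \<Longrightarrow> origin D (rot_cw D d) = origin D d"
  using rot_cw_nearest(1)[of d "origin D d"] origin_in_MP unfolding darts_at_def by blast

lemma sextic_map_darts: "sextic_map (darts D) (opp D) (rot_cw D)"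
proof (rule sextic_map.intro)
  fix d assume d: "d \<in> darts D"
  show "rot_cw D (rot_cw D (rot_cw D (rot_cw D (rot_cw D (rot_cw D d))))) = d"
    using rot_cw_cyclic(1)[OF d] by (simp add: eval_nat_numeral)
  show "rot_cw D d \<noteq> d" using rot_cw_cyclic(2)[OF d, of 1] by auto
  show "rot_cw D (rot_cw D d) \<noteq> d" using rot_cw_cyclic(2)[OF d, of 2] by (auto simp: eval_nat_numeral)
qed (simp_all add: finite_darts_D opp_in_darts opp_opp_D opp_neq_D rot_cw_in_darts)


section \<open>The projection near a triple point\<close>

text \<open>The edge seen in coordinates in which its dart starts at the origin in direction 1.\<close>

definition local_coord :: "dart \<Rightarrow> real \<Rightarrow> complex" where
  "local_coord d t = (edge d t - origin D d) / direction D d"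

lemma edge_derivative:
  assumes d: "d \<in> darts D"
  shows "(edge d has_vector_derivative (dart_sign d * stride d) *\<^sub>R
    vector_derivative (curve D (fst (fst d))) (at (snd (fst d) + dart_sign d * stride d * t))) (at t)"
proof -
  have "((\<lambda>t. snd (fst d) + dart_sign d * stride d * t) has_vector_derivative dart_sign d * stride d) (at t)"
    by (auto intro!: derivative_eq_intros simp: has_real_derivative_iff_has_vector_derivative[symmetric])
  from vector_diff_chain_at[OF this curve_derivative[OF comp_less[OF d]]]
  show ?thesis by (simp add: edge_def[abs_def] comp_def)
qed

definition local_deriv :: "dart \<Rightarrow> real \<Rightarrow> complex" where
  "local_deriv d t = ((dart_sign d * stride d) *\<^sub>R
    vector_derivative (curve D (fst (fst d))) (at (snd (fst d) + dart_sign d * stride d * t))) / direction D d"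

lemma local_coord_has_derivative:
  assumes d: "d \<in> darts D"
  shows "(local_coord d has_vector_derivative local_deriv d t) (at t)"
  unfolding local_coord_def[abs_def] local_deriv_def
  by (intro has_vector_derivative_divide has_vector_derivative_diff_const[THEN iffD2] edge_derivative[OF d])

lemma continuous_local_deriv:
  assumes d: "d \<in> darts D"
  shows "continuous_on UNIV (local_deriv d)"
  unfolding local_deriv_def
  by (intro continuous_intros continuous_on_compose2[OF continuous_curve_derivative[OF comp_less[OF d]]])
    (use direction_nonzero[OF d] in auto)

lemma local_deriv_0:
  assumes d: "d \<in> darts D"
  shows "local_deriv d 0 = of_real (stride d)"
  using direction_nonzero[OF d]
  by (auto simp: local_deriv_def direction_def tangent_def dart_sign_def scaleR_conv_of_real split: if_splits)

lemma local_coord_0: "local_coord d 0 = 0"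
  by (simp add: local_coord_def edge_0)

lemma continuous_local_coord: "d \<in> darts D \<Longrightarrow> continuous_on A (local_coord d)"
  unfolding local_coord_def by (intro continuous_intros continuous_edge) (auto simp: direction_nonzero)

text \<open>
  As the tangent at a triple point does not vanish, an edge leaves it within arbitrarily flat cones
  around its direction, and it does so even as seen from any of its first points.
\<close>

lemma edge_start_in_cone:
  assumes d: "d \<in> darts D" and \<kappa>: "\<kappa> > 0"
  shows "\<exists>\<delta>. 0 < \<delta> \<and> \<delta> < 1/2 \<and> (\<forall>a b. 0 \<le> a \<and> a < b \<and> b \<le> \<delta> \<longrightarrow>
    \<bar>Im (local_coord d b - local_coord d a)\<bar> < \<kappa> * Re (local_coord d b - local_coord d a))"
proof -
  define f g where "f t = \<kappa> * Re (local_coord d t) + Im (local_coord d t)" and "g t = \<kappa> * Re (local_coord d t) - Im (local_coord d t)" for t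
  define f' g' where "f' t = \<kappa> * Re (local_deriv d t) + Im (local_deriv d t)"
    and "g' t = \<kappa> * Re (local_deriv d t) - Im (local_deriv d t)" for t
  have der: "((\<lambda>t. Re (local_coord d t)) has_real_derivative Re (local_deriv d t)) (at t)"
    "((\<lambda>t. Im (local_coord d t)) has_real_derivative Im (local_deriv d t)) (at t)" for t
    using local_coord_has_derivative[OF d, of t] unfolding has_vector_derivative_complex_iff by auto
  have fg: "(f has_real_derivative f' t) (at t)" "(g has_real_derivative g' t) (at t)" for t
    unfolding f_def[abs_def] g_def[abs_def] f'_def g'_def
    by (rule DERIV_add[OF DERIV_cmult[OF der(1)] der(2)], rule DERIV_diff[OF DERIV_cmult[OF der(1)] der(2)])
  have "continuous_on UNIV f'" "continuous_on UNIV g'"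
    unfolding f'_def g'_def by (intro continuous_intros continuous_local_deriv[OF d])+
  then have "open (f' -` {0<..} \<inter> g' -` {0<..})" by (intro open_Int open_vimage) auto
  moreover have "0 \<in> f' -` {0<..} \<inter> g' -` {0<..}"
    using \<kappa> stride_pos[OF d] by (simp add: f'_def g'_def local_deriv_0[OF d])
  ultimately obtain e where e: "e > 0" "ball 0 e \<subseteq> f' -` {0<..} \<inter> g' -` {0<..}" using open_contains_ball by blast
  define \<delta> where "\<delta> = min (e / 2) (1/4)"
  have pos: "f' t > 0" "g' t > 0" if "0 \<le> t" "t \<le> \<delta>" for t
  proof -
    have "t \<in> ball 0 e" using that e(1) by (auto simp: \<delta>_def dist_norm)
    then show "f' t > 0" "g' t > 0" using e(2) by auto
  qed
  have "\<bar>Im (local_coord d b - local_coord d a)\<bar> < \<kappa> * Re (local_coord d b - local_coord d a)" if ab: "0 \<le> a" "a < b" "b \<le> \<delta>" for a b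
  proof -
    have "f a < f b" "g a < g b"
      using fg pos ab by (intro DERIV_pos_imp_increasing[OF ab(2)]; force)+
    then show ?thesis by (auto simp: f_def g_def abs_less_iff algebra_simps)
  qed
  then show ?thesis using e(1) by (intro exI[of _ \<delta>]) (auto simp: \<delta>_def)
qed

text \<open>
  The halves of edges that start elsewhere, the far parts of the halves that start at \<open>v\<close> and the
  free circles form a compact set that does not contain \<open>v\<close>.
\<close>

lemma vertex_neighbourhood:
  assumes v: "v \<in> MP" and \<tau>: "\<And>d. d \<in> darts_at v \<Longrightarrow> 0 < \<tau> d"
  obtains r where "r > 0"
    "\<And>q. q \<in> P \<Longrightarrow> q \<noteq> v \<Longrightarrow> dist v q < r \<Longrightarrow> \<exists>d\<in>darts_at v. \<exists>t. 0 < t \<and> t < \<tau> d \<and> q = edge d t"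
proof -
  define Z where "Z = free_circles \<union> (\<Union>d\<in>darts D - darts_at v. edge d ` {0..1/2}) \<union> (\<Union>d\<in>darts_at v. edge d ` {\<tau> d..1/2})"
  have "compact Z"
    unfolding Z_def using finite_darts_D finite_darts_at compact_free_circles
    by (intro compact_Un compact_UN compact_continuous_image continuous_edge) (auto simp: darts_at_def)
  then have "open (- Z)" using compact_imp_closed open_Compl by blast
  moreover have "v \<notin> Z"
  proof -
    have "v \<notin> free_circles" using free_circles_disjoint_MP v by blast
    moreover have "v \<noteq> edge d t" if "d \<in> darts D - darts_at v" "t \<in> {0..1/2}" for d t
      using that edge_interior[of d t] v edge_0[of d] by (cases "t = 0") (auto simp: darts_at_def)
    moreover have "v \<noteq> edge d t" if "d \<in> darts_at v" "t \<in> {\<tau> d..1/2}" for d t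
      using that edge_interior[of d t] v \<tau>[OF that(1)] by (auto simp: darts_at_def)
    ultimately show ?thesis unfolding Z_def by blast
  qed
  ultimately obtain r where r: "r > 0" "ball v r \<subseteq> - Z" by (metis ComplI openE)
  have "\<exists>d\<in>darts_at v. \<exists>t. 0 < t \<and> t < \<tau> d \<and> q = edge d t" if q: "q \<in> P" "q \<noteq> v" "dist v q < r" for q
  proof -
    have nZ: "q \<notin> Z" using r(2) q(3) by auto
    then have "q \<notin> free_circles" unfolding Z_def by blast
    then obtain d t where d: "d \<in> darts D" "t \<in> {0..1/2}" "q = edge d t"
      using q(1) unfolding P_half_edges by blast
    then have dv: "d \<in> darts_at v" using nZ unfolding Z_def by blast
    then have "t \<noteq> 0" using q(2) d(3) edge_0[of d] by (auto simp: darts_at_def)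
    moreover have "t < \<tau> d" using nZ dv d unfolding Z_def by force
    ultimately have "0 < t \<and> t < \<tau> d \<and> q = edge d t" using d by simp
    then show ?thesis using dv by blast
  qed
  then show ?thesis using that[OF r(1)] by blast
qed

lemma vertex_cone_neighbourhood:
  assumes v: "v \<in> MP" and \<kappa>: "\<kappa> > 0"
  obtains r where "r > 0"
    "\<And>q. q \<in> P \<Longrightarrow> q \<noteq> v \<Longrightarrow> dist v q < r \<Longrightarrow>
       \<exists>d\<in>darts_at v. \<bar>Im ((q - v) / direction D d)\<bar> < \<kappa> * Re ((q - v) / direction D d)"
proof -
  have "\<forall>d\<in>darts_at v. \<exists>\<delta>. 0 < \<delta> \<and> (\<forall>a b. 0 \<le> a \<and> a < b \<and> b \<le> \<delta> \<longrightarrow>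
    \<bar>Im (local_coord d b - local_coord d a)\<bar> < \<kappa> * Re (local_coord d b - local_coord d a))"
    using edge_start_in_cone[OF _ \<kappa>] unfolding darts_at_def by blast
  then obtain \<tau> where \<tau>: "\<And>d. d \<in> darts_at v \<Longrightarrow> 0 < \<tau> d"
    "\<And>d a b. d \<in> darts_at v \<Longrightarrow> 0 \<le> a \<Longrightarrow> a < b \<Longrightarrow> b \<le> \<tau> d \<Longrightarrow>
      \<bar>Im (local_coord d b - local_coord d a)\<bar> < \<kappa> * Re (local_coord d b - local_coord d a)"
    by metis
  obtain r where r: "r > 0"
    "\<And>q. q \<in> P \<Longrightarrow> q \<noteq> v \<Longrightarrow> dist v q < r \<Longrightarrow> \<exists>d\<in>darts_at v. \<exists>t. 0 < t \<and> t < \<tau> d \<and> q = edge d t"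
    using vertex_neighbourhood[OF v, of \<tau>] \<tau>(1) by blast
  show ?thesis
  proof (rule that[OF r(1)])
    fix q assume "q \<in> P" "q \<noteq> v" "dist v q < r"
    then obtain d t where d: "d \<in> darts_at v" "0 < t" "t < \<tau> d" "q = edge d t" using r(2) by blast
    then have "(q - v) / direction D d = local_coord d t" by (simp add: local_coord_def darts_at_def)
    then show "\<exists>d\<in>darts_at v. \<bar>Im ((q - v) / direction D d)\<bar> < \<kappa> * Re ((q - v) / direction D d)"
      using \<tau>(2)[OF d(1), of 0 t] d local_coord_0 by (intro bexI[OF _ d(1)]) simp
  qed
qed


section \<open>Sectors and wedges\<close>

definition in_cone :: "real \<Rightarrow> complex \<Rightarrow> bool" where
  "in_cone \<kappa> z \<longleftrightarrow> z \<noteq> 0 \<and> \<bar>Im z\<bar> \<le> \<kappa> * Re z"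

lemma in_cone_mono: "in_cone \<kappa> z \<Longrightarrow> \<kappa> > 0 \<Longrightarrow> \<kappa> \<le> \<kappa>' \<Longrightarrow> in_cone \<kappa>' z"
proof -
  assume a: "in_cone \<kappa> z" "\<kappa> > 0" "\<kappa> \<le> \<kappa>'"
  then have "0 \<le> \<kappa> * Re z" unfolding in_cone_def by (metis abs_ge_zero order_trans)
  then have "0 \<le> Re z" using a(2) by (simp add: zero_le_mult_iff)
  then have "\<kappa> * Re z \<le> \<kappa>' * Re z" using a(3) by (intro mult_right_mono)
  then show "in_cone \<kappa>' z" using a(1) unfolding in_cone_def by linarith
qed

text \<open>
  Turning a flat cone around the positive real axis by the argument of \<open>\<omega>\<close> moves it off itself once
  the cone is flatter than this argument.
\<close>

lemma cones_eventually_disjoint: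
  assumes "\<omega> \<noteq> 0" "\<And>r. r > 0 \<Longrightarrow> \<omega> \<noteq> of_real r"
  obtains \<kappa> where "\<kappa> > 0" "\<And>z. in_cone \<kappa> z \<Longrightarrow> \<not> in_cone \<kappa> (z * \<omega>)"
proof -
  define \<kappa> where "\<kappa> = (if Im \<omega> = 0 then 1 else min 1 (\<bar>Im \<omega>\<bar> / (4 * cmod \<omega>)))"
  have \<kappa>: "\<kappa> > 0" "\<kappa> \<le> 1" using assms(1) by (auto simp: \<kappa>_def)
  have "\<not> in_cone \<kappa> (z * \<omega>)" if z: "in_cone \<kappa> z" for z
  proof
    assume c: "in_cone \<kappa> (z * \<omega>)"
    define x \<eta> where "x = Re z" and "\<eta> = Im z / Re z"
    have "Re z > 0"
    proof -
      have "\<kappa> * Re z \<ge> 0" using z unfolding in_cone_def by (metis abs_ge_zero order_trans)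
      moreover have "Re z \<noteq> 0" using z unfolding in_cone_def by (auto simp: complex_eq_iff)
      ultimately show ?thesis using \<kappa>(1) by (simp add: zero_le_mult_iff)
    qed
    then have x: "x > 0" "Im z = \<eta> * x" "Re z = x" by (auto simp: x_def \<eta>_def)
    have "\<bar>\<eta>\<bar> * x \<le> \<kappa> * x" using z x unfolding in_cone_def by (simp add: abs_mult)
    then have \<eta>: "\<bar>\<eta>\<bar> \<le> \<kappa>" using x(1) by simp
    have "\<bar>x * (Im \<omega> + \<eta> * Re \<omega>)\<bar> \<le> \<kappa> * (x * (Re \<omega> - \<eta> * Im \<omega>))"
      using c x unfolding in_cone_def by (simp add: algebra_simps)
    then have "x * \<bar>Im \<omega> + \<eta> * Re \<omega>\<bar> \<le> x * (\<kappa> * (Re \<omega> - \<eta> * Im \<omega>))"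
      unfolding abs_mult using x(1) by (simp add: mult.left_commute)
    then have le: "\<bar>Im \<omega> + \<eta> * Re \<omega>\<bar> \<le> \<kappa> * (Re \<omega> - \<eta> * Im \<omega>)" using x(1) by simp
    show False
    proof (cases "Im \<omega> = 0")
      case True
      have "Re \<omega> > 0"
        using le \<kappa>(1) True assms(1) by (smt (verit) complex_eq_iff mult_zero_right zero_complex.simps zero_le_mult_iff)
      then show False using assms(2)[of "Re \<omega>"] True by (simp add: complex_eq_iff)
    next
      case False
      let ?m = "cmod \<omega>"
      have m: "\<bar>Re \<omega>\<bar> \<le> ?m" "\<bar>Im \<omega>\<bar> \<le> ?m" "?m > 0" using abs_Re_le_cmod abs_Im_le_cmod assms(1) by auto
      have "\<bar>\<eta> * Re \<omega>\<bar> \<le> \<kappa> * ?m" unfolding abs_mult by (intro mult_mono \<eta> m) (use \<kappa> in auto)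
      moreover have "\<bar>\<eta> * Im \<omega>\<bar> \<le> 1 * ?m" unfolding abs_mult by (intro mult_mono m) (use \<eta> \<kappa> in auto)
      then have "\<kappa> * (Re \<omega> - \<eta> * Im \<omega>) \<le> \<kappa> * (2 * ?m)" using m \<kappa> by (intro mult_left_mono) auto
      ultimately have "\<bar>Im \<omega>\<bar> \<le> 3 * (\<kappa> * ?m)" using le by linarith
      moreover have "\<kappa> * ?m \<le> \<bar>Im \<omega>\<bar> / (4 * ?m) * ?m"
        using False m(3) by (intro mult_right_mono) (auto simp: \<kappa>_def)
      ultimately show False using False m(3) by simp
    qed
  qed
  then show ?thesis using \<kappa>(1) that by blast
qed

lemma darts_in_disjoint_cones:
  assumes v: "v \<in> MP"
  obtains \<kappa> where "\<kappa> > 0"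
    "\<And>d d' z. d \<in> darts_at v \<Longrightarrow> d' \<in> darts_at v \<Longrightarrow> in_cone \<kappa> (z / direction D d) \<Longrightarrow> in_cone \<kappa> (z / direction D d') \<Longrightarrow> d = d'"
proof -
  let ?I = "{(d, d'). d \<in> darts_at v \<and> d' \<in> darts_at v \<and> d \<noteq> d'}"
  have "\<exists>\<kappa>>0. \<forall>z. in_cone \<kappa> z \<longrightarrow> \<not> in_cone \<kappa> (z * (direction D (fst p) / direction D (snd p)))" if "p \<in> ?I" for p
  proof -
    obtain d d' where dd: "p = (d, d')" by (metis prod.exhaust)
    then have p: "fst p \<in> darts D" "snd p \<in> darts D" "origin D (snd p) = origin D (fst p)" "fst p \<noteq> snd p"
      using that unfolding dd darts_at_def by simp_all
    have nz: "direction D (fst p) \<noteq> 0" "direction D (snd p) \<noteq> 0"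
      using p direction_nonzero by blast+
    have "direction D (fst p) / direction D (snd p) \<noteq> of_real r" if "r > 0" for r
    proof
      assume "direction D (fst p) / direction D (snd p) = of_real r"
      then have "direction D (fst p) = of_real r * direction D (snd p)" using nz by (simp add: divide_eq_eq)
      then have "fst p = snd p" using directions_distinct[OF p(2,1,3)] that by blast
      then show False using p(4) by blast
    qed
    then show ?thesis using cones_eventually_disjoint[of "direction D (fst p) / direction D (snd p)"] nz by (metis divide_eq_0_iff)
  qed
  then have "\<forall>p\<in>?I. \<exists>\<kappa>. \<kappa> > 0 \<and> (\<forall>z. in_cone \<kappa> z \<longrightarrow> \<not> in_cone \<kappa> (z * (direction D (fst p) / direction D (snd p))))"
    by (intro ballI)
  from bchoice[OF this] obtain k where
    k0: "\<forall>p\<in>?I. k p > 0 \<and> (\<forall>z. in_cone (k p) z \<longrightarrow> \<not> in_cone (k p) (z * (direction D (fst p) / direction D (snd p))))" ..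
  have k: "\<And>p. p \<in> ?I \<Longrightarrow> k p > 0"
    "\<And>p z. p \<in> ?I \<Longrightarrow> in_cone (k p) z \<Longrightarrow> \<not> in_cone (k p) (z * (direction D (fst p) / direction D (snd p)))"
    using k0 by blast+
  define \<kappa> where "\<kappa> = Min (insert 1 (k ` ?I))"
  have "?I \<subseteq> darts_at v \<times> darts_at v" by auto
  then have fin: "finite (insert 1 (k ` ?I))" using finite_darts_at finite_subset by blast
  have \<kappa>: "\<kappa> > 0" unfolding \<kappa>_def using fin k(1) by (subst Min_gr_iff) auto
  have \<kappa>le: "\<kappa> \<le> k p" if "p \<in> ?I" for p unfolding \<kappa>_def using fin that by (intro Min_le) auto
  show ?thesis
  proof (rule that[OF \<kappa>])
    fix d d' z
    assume dd: "d \<in> darts_at v" "d' \<in> darts_at v" and c: "in_cone \<kappa> (z / direction D d)" "in_cone \<kappa> (z / direction D d')"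
    show "d = d'"
    proof (rule ccontr)
      assume "d \<noteq> d'"
      then have I: "(d, d') \<in> ?I" using dd by auto
      have "in_cone (k (d, d')) (z / direction D d)" "in_cone (k (d, d')) (z / direction D d')"
        using in_cone_mono c \<kappa> \<kappa>le[OF I] by blast+
      then show False using k(2)[OF I, of "z / direction D d"] direction_nonzero dd by (simp add: darts_at_def)
    qed
  qed
qed

text \<open>The point with the coordinates \<open>(x, y)\<close> in the frame of a dart.\<close>

definition wedge_point :: "dart \<Rightarrow> real \<Rightarrow> real \<Rightarrow> complex" where
  "wedge_point d x y = origin D d + direction D d * Complex x y"

text \<open>
  Near its start, inside a cone around its direction, an edge is the graph of a function \<open>h\<close> and
  the rest of the projection is absent.
\<close>

definition wedge :: "dart \<Rightarrow> real \<Rightarrow> real \<Rightarrow> (real \<Rightarrow> real) \<Rightarrow> bool" where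
  "wedge d \<kappa> \<rho> h \<longleftrightarrow> \<kappa> > 0 \<and> \<rho> > 0 \<and>
     (\<forall>x. 0 < x \<and> x < \<rho> \<longrightarrow> \<bar>h x\<bar> < \<kappa> * x \<and>
        (\<forall>y. \<bar>y\<bar> \<le> \<kappa> * x \<longrightarrow> (wedge_point d x y \<in> P \<longleftrightarrow> y = h x))) \<and>
     (\<forall>\<epsilon>>0. \<exists>r>0. \<forall>x. 0 < x \<and> x < r \<longrightarrow> \<bar>h x\<bar> < \<epsilon> * x) \<and>
     (\<exists>\<delta>. 0 < \<delta> \<and> \<delta> < 1/2 \<and> (\<forall>a b. 0 \<le> a \<and> a < b \<and> b \<le> \<delta> \<longrightarrow> Re (local_coord d a) < Re (local_coord d b)) \<and>
        (\<forall>x. 0 < x \<and> x < \<rho> \<longrightarrow> (\<exists>t. 0 < t \<and> t < \<delta> \<and> edge d t = wedge_point d x (h x))))"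

lemma edge_wedge_point: "d \<in> darts D \<Longrightarrow> edge d t = wedge_point d (Re (local_coord d t)) (Im (local_coord d t))"
  using direction_nonzero[of d] by (simp add: wedge_point_def local_coord_def)

lemma wedge_point_inject: "d \<in> darts D \<Longrightarrow> wedge_point d x y = wedge_point d x' y' \<longleftrightarrow> x = x' \<and> y = y'"
  using direction_nonzero[of d] by (auto simp: wedge_point_def)

lemma wedge_exists:
  assumes d: "d \<in> darts D"
  obtains \<kappa> \<rho> h where "wedge d \<kappa> \<rho> h"
proof -
  let ?v = "origin D d"
  have v: "?v \<in> MP" and dv: "d \<in> darts_at ?v" using d origin_in_MP by (auto simp: darts_at_def)
  obtain \<kappa> where \<kappa>: "\<kappa> > 0"
    "\<And>d d' z. d \<in> darts_at ?v \<Longrightarrow> d' \<in> darts_at ?v \<Longrightarrow> in_cone \<kappa> (z / direction D d) \<Longrightarrow> in_cone \<kappa> (z / direction D d') \<Longrightarrow> d = d'"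
    using darts_in_disjoint_cones[OF v] by blast
  have "\<forall>e\<in>darts_at ?v. \<exists>\<delta>. 0 < \<delta> \<and> \<delta> < 1/2 \<and> (\<forall>a b. 0 \<le> a \<and> a < b \<and> b \<le> \<delta> \<longrightarrow>
    \<bar>Im (local_coord e b - local_coord e a)\<bar> < \<kappa> * Re (local_coord e b - local_coord e a))"
    using edge_start_in_cone[OF _ \<kappa>(1)] unfolding darts_at_def by blast
  then obtain \<delta> where \<delta>: "\<And>e. e \<in> darts_at ?v \<Longrightarrow> 0 < \<delta> e" "\<And>e. e \<in> darts_at ?v \<Longrightarrow> \<delta> e < 1/2"
    "\<And>e a b. e \<in> darts_at ?v \<Longrightarrow> 0 \<le> a \<Longrightarrow> a < b \<Longrightarrow> b \<le> \<delta> e \<Longrightarrow>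
      \<bar>Im (local_coord e b - local_coord e a)\<bar> < \<kappa> * Re (local_coord e b - local_coord e a)"
    by metis
  obtain r where r: "r > 0"
    "\<And>q. q \<in> P \<Longrightarrow> q \<noteq> ?v \<Longrightarrow> dist ?v q < r \<Longrightarrow> \<exists>e\<in>darts_at ?v. \<exists>t. 0 < t \<and> t < \<delta> e \<and> q = edge e t"
    using vertex_neighbourhood[OF v, of \<delta>] \<delta>(1) by blast
  have mono: "Re (local_coord d a) < Re (local_coord d b)" if "0 \<le> a" "a < b" "b \<le> \<delta> d" for a b
  proof -
    have "0 < \<kappa> * Re (local_coord d b - local_coord d a)" using \<delta>(3)[OF dv that] by (meson abs_ge_zero le_less_trans)
    then show ?thesis using \<kappa>(1) by (simp add: zero_less_mult_iff)
  qed
  have cone: "\<bar>Im (local_coord e t)\<bar> < \<kappa> * Re (local_coord e t)" "0 < Re (local_coord e t)" if "e \<in> darts_at ?v" "0 < t" "t \<le> \<delta> e" for e t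
  proof -
    show 1: "\<bar>Im (local_coord e t)\<bar> < \<kappa> * Re (local_coord e t)" using \<delta>(3)[OF that(1), of 0 t] that by (simp add: local_coord_0)
    then have "0 < \<kappa> * Re (local_coord e t)" by (meson abs_ge_zero le_less_trans)
    then show "0 < Re (local_coord e t)" using \<kappa>(1) by (simp add: zero_less_mult_iff)
  qed
  have Im_mono: "\<exists>r>0. \<forall>t. 0 < t \<and> t \<le> \<delta> d \<and> Re (local_coord d t) < r \<longrightarrow> \<bar>Im (local_coord d t)\<bar> < \<epsilon> * Re (local_coord d t)" if "\<epsilon> > 0" for \<epsilon>
  proof -
    obtain \<delta>' where \<delta>': "0 < \<delta>'" "\<And>a b. 0 \<le> a \<Longrightarrow> a < b \<Longrightarrow> b \<le> \<delta>' \<Longrightarrow>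
        \<bar>Im (local_coord d b - local_coord d a)\<bar> < \<epsilon> * Re (local_coord d b - local_coord d a)"
      using edge_start_in_cone[OF d \<open>\<epsilon> > 0\<close>] by blast
    define m where "m = min \<delta>' (\<delta> d)"
    have m: "0 < m" "m \<le> \<delta> d" "m \<le> \<delta>'" using \<delta>' \<delta>(1)[OF dv] by (auto simp: m_def)
    show ?thesis
    proof (intro exI[of _ "Re (local_coord d m)"] conjI allI impI)
      show "0 < Re (local_coord d m)" using cone(2)[OF dv m(1,2)] .
      fix t assume t: "0 < t \<and> t \<le> \<delta> d \<and> Re (local_coord d t) < Re (local_coord d m)"
      then have "t < m" using mono[of m t] m by (metis less_imp_le not_less_iff_gr_or_eq)
      then show "\<bar>Im (local_coord d t)\<bar> < \<epsilon> * Re (local_coord d t)" using \<delta>'(2)[of 0 t] t m by (simp add: local_coord_0)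
    qed
  qed
  define \<rho> where "\<rho> = min (Re (local_coord d (\<delta> d))) (r / (cmod (direction D d) * (1 + \<kappa>)))"
  have dir: "direction D d \<noteq> 0" using direction_nonzero d by blast
  have \<rho>: "\<rho> > 0" using cone(2)[OF dv \<delta>(1)[OF dv]] r(1) dir \<kappa>(1) by (simp add: \<rho>_def)
  have ex: "\<exists>t. 0 < t \<and> t < \<delta> d \<and> Re (local_coord d t) = x" if x: "0 < x" "x < \<rho>" for x
  proof -
    have "\<exists>t\<ge>0. t \<le> \<delta> d \<and> Re (local_coord d t) = x"
      using x \<delta>(1)[OF dv] local_coord_0[of d] continuous_local_coord[OF d]
      by (intro IVT') (auto simp: \<rho>_def intro!: continuous_intros)
    then obtain t where t: "0 \<le> t" "t \<le> \<delta> d" "Re (local_coord d t) = x" by blast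
    moreover have "t \<noteq> 0" "t \<noteq> \<delta> d" using t x local_coord_0[of d] by (auto simp: \<rho>_def)
    ultimately show ?thesis by (intro exI[of _ t]) linarith
  qed
  then obtain T where T: "\<And>x. 0 < x \<Longrightarrow> x < \<rho> \<Longrightarrow> 0 < T x" "\<And>x. 0 < x \<Longrightarrow> x < \<rho> \<Longrightarrow> T x < \<delta> d"
    "\<And>x. 0 < x \<Longrightarrow> x < \<rho> \<Longrightarrow> Re (local_coord d (T x)) = x" by metis
  define h where "h x = Im (local_coord d (T x))" for x
  have eT: "edge d (T x) = wedge_point d x (h x)" if "0 < x" "x < \<rho>" for x
    using edge_wedge_point[OF d, of "T x"] T(3)[OF that] by (simp add: h_def)
  have hx: "\<bar>h x\<bar> < \<kappa> * x" if "0 < x" "x < \<rho>" for x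
    using cone(1)[OF dv T(1)[OF that]] T(2,3)[OF that] by (simp add: h_def)
  have hP: "wedge_point d x y \<in> P \<longleftrightarrow> y = h x" if x: "0 < x" "x < \<rho>" and y: "\<bar>y\<bar> \<le> \<kappa> * x" for x y
  proof
    assume "y = h x"
    then show "wedge_point d x y \<in> P" using eT[OF x] edge_in_P[OF d] by metis
  next
    assume p: "wedge_point d x y \<in> P"
    have "Complex x y \<noteq> 0" using x by (simp add: complex_eq_iff)
    then have "wedge_point d x y \<noteq> ?v" using dir by (simp add: wedge_point_def)
    moreover have "dist ?v (wedge_point d x y) < r"
    proof -
      have "dist ?v (wedge_point d x y) = cmod (direction D d) * cmod (Complex x y)" by (simp add: wedge_point_def dist_norm norm_mult)
      also have "\<dots> \<le> cmod (direction D d) * (\<bar>x\<bar> + \<bar>y\<bar>)" using cmod_le[of "Complex x y"] by (intro mult_left_mono) auto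
      also have "\<dots> \<le> cmod (direction D d) * ((1 + \<kappa>) * x)" using x y by (intro mult_left_mono) (auto simp: algebra_simps)
      also have "\<dots> < r"
      proof -
        have "x < r / (cmod (direction D d) * (1 + \<kappa>))" using x by (simp add: \<rho>_def)
        moreover have "cmod (direction D d) * (1 + \<kappa>) > 0" using dir \<kappa>(1) by (intro mult_pos_pos) auto
        ultimately have "x * (cmod (direction D d) * (1 + \<kappa>)) < r" by (simp only: pos_less_divide_eq)
        then show ?thesis by (simp only: mult_ac)
      qed
      finally show ?thesis .
    qed
    ultimately obtain e t where e: "e \<in> darts_at ?v" "0 < t" "t < \<delta> e" "wedge_point d x y = edge e t" using r(2)[OF p] by blast
    have "(wedge_point d x y - ?v) / direction D d = Complex x y" using dir by (simp add: wedge_point_def)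
    then have c1: "in_cone \<kappa> ((wedge_point d x y - ?v) / direction D d)" using x y by (simp add: in_cone_def complex_eq_iff)
    have "(wedge_point d x y - ?v) / direction D e = local_coord e t" using e by (simp add: local_coord_def darts_at_def)
    then have "in_cone \<kappa> ((wedge_point d x y - ?v) / direction D e)" using cone[OF e(1,2)] e(3) by (auto simp: in_cone_def)
    then have "e = d" using \<kappa>(2)[OF e(1) dv] c1 by blast
    then have eq: "x = Re (local_coord d t)" "y = Im (local_coord d t)" using e(4) edge_wedge_point[OF d, of t] wedge_point_inject[OF d] by auto
    have "t = T x"
    proof (rule ccontr)
      assume "t \<noteq> T x"
      then have "Re (local_coord d t) \<noteq> Re (local_coord d (T x))"
        using mono[of t "T x"] mono[of "T x" t] e \<open>e = d\<close> T(1,2)[OF x] by (metis less_imp_le less_irrefl linorder_neqE_linordered_idom)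
      then show False using eq T(3)[OF x] by simp
    qed
    then show "y = h x" using eq by (simp add: h_def)
  qed
  have "wedge d \<kappa> \<rho> h"
    unfolding wedge_def
  proof (intro conjI allI impI)
    show "\<kappa> > 0" "\<rho> > 0" by fact+
    fix x assume x: "0 < x \<and> x < \<rho>"
    show "\<bar>h x\<bar> < \<kappa> * x" using hx x by blast
    show "wedge_point d x y \<in> P \<longleftrightarrow> y = h x" if "\<bar>y\<bar> \<le> \<kappa> * x" for y using hP x that by auto
  next
    fix \<epsilon> :: real assume "\<epsilon> > 0"
    from Im_mono[OF this] obtain r' where r': "r' > 0"
        "\<And>t. 0 < t \<and> t \<le> \<delta> d \<and> Re (local_coord d t) < r' \<Longrightarrow> \<bar>Im (local_coord d t)\<bar> < \<epsilon> * Re (local_coord d t)"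
      by (elim exE conjE) simp
    have "\<bar>h x\<bar> < \<epsilon> * x" if "0 < x" "x < min r' \<rho>" for x
      using r'(2)[of "T x"] T[of x] that by (simp add: h_def)
    then show "\<exists>r>0. \<forall>x. 0 < x \<and> x < r \<longrightarrow> \<bar>h x\<bar> < \<epsilon> * x"
      using r'(1) \<rho> by (intro exI[of _ "min r' \<rho>"]) auto
  next
    show "\<exists>\<delta>. 0 < \<delta> \<and> \<delta> < 1/2 \<and> (\<forall>a b. 0 \<le> a \<and> a < b \<and> b \<le> \<delta> \<longrightarrow> Re (local_coord d a) < Re (local_coord d b)) \<and>
        (\<forall>x. 0 < x \<and> x < \<rho> \<longrightarrow> (\<exists>t. 0 < t \<and> t < \<delta> \<and> edge d t = wedge_point d x (h x)))"
      using \<delta>(1,2)[OF dv] mono T(1,2) eT by (intro exI[of _ "\<delta> d"]) blast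
  qed
  then show ?thesis using that by blast
qed

text \<open>The mirror image of \<^const>\<open>on_left\<close>.\<close>

definition on_right :: "dart \<Rightarrow> complex set \<Rightarrow> bool" where
  "on_right d f \<longleftrightarrow>
     (\<forall>\<^sub>F \<theta> in at_right 0. \<forall>\<^sub>F r in at_right 0.
        origin D d + of_real r * (cis (- \<theta>) * direction D d) \<in> f)"

lemma face_disjoint: "f \<in> faces D \<Longrightarrow> g \<in> faces D \<Longrightarrow> x \<in> f \<Longrightarrow> x \<in> g \<Longrightarrow> f = g"
  unfolding faces_def using components_eq by blast

lemma side_unique:
  assumes "f \<in> faces D" "g \<in> faces D"
    and "\<forall>\<^sub>F \<theta> in at_right (0::real). \<forall>\<^sub>F r in at_right (0::real). X \<theta> r \<in> f"
    and "\<forall>\<^sub>F \<theta> in at_right 0. \<forall>\<^sub>F r in at_right 0. X \<theta> r \<in> g"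
  shows "f = g"
proof -
  have "\<forall>\<^sub>F \<theta> in at_right (0::real). \<forall>\<^sub>F r in at_right (0::real). X \<theta> r \<in> f \<and> X \<theta> r \<in> g"
    using assms(3,4) by eventually_elim (rule eventually_conj)
  then obtain \<theta> where "\<forall>\<^sub>F r in at_right (0::real). X \<theta> r \<in> f \<and> X \<theta> r \<in> g"
    using eventually_happens'[OF trivial_limit_at_right_real] by blast
  then obtain r where "X \<theta> r \<in> f \<and> X \<theta> r \<in> g"
    using eventually_happens'[OF trivial_limit_at_right_real] by blast
  then show ?thesis using face_disjoint assms(1,2) by blast
qed

lemma on_left_unique: "on_left D d f \<Longrightarrow> on_left D d g \<Longrightarrow> f \<in> faces D \<Longrightarrow> g \<in> faces D \<Longrightarrow> f = g"
  unfolding on_left_def by (rule side_unique)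

lemma on_right_unique: "on_right d f \<Longrightarrow> on_right d g \<Longrightarrow> f \<in> faces D \<Longrightarrow> g \<in> faces D \<Longrightarrow> f = g"
  unfolding on_right_def by (rule side_unique)

lemma connected_component_face: "f \<in> faces D \<Longrightarrow> x \<in> f \<Longrightarrow> connected_component (- P) x y \<Longrightarrow> y \<in> f"
  unfolding faces_def components_def using connected_component_trans by fastforce

lemma face_exists: "x \<notin> P \<Longrightarrow> \<exists>f\<in>faces D. x \<in> f"
  unfolding faces_def by (intro bexI[of _ "connected_component_set (- P) x"]) (auto simp: components_def)

lemma face_subset: "f \<in> faces D \<Longrightarrow> f \<inter> P = {}"
  unfolding faces_def using in_components_subset by fastforce

lemma open_face: "f \<in> faces D \<Longrightarrow> open f"
  unfolding faces_def using open_components closed_P open_Compl by blast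

lemma connected_face: "f \<in> faces D \<Longrightarrow> connected f"
  unfolding faces_def using in_components_connected by blast

text \<open>
  The points of the wedge above the graph can be connected vertically to the upper side of the
  wedge. As \<open>h\<close> is flat, they include short pieces of the rays on the left of the dart; so they all
  lie in the face on the left.
\<close>

lemma wedge_above_connected:
  assumes w: "wedge d \<kappa> \<rho> h" and x: "0 < x" "x < \<rho>" "h x < y" "y \<le> \<kappa> * x"
    and x': "0 < x'" "x' < \<rho>" "h x' < y'" "y' \<le> \<kappa> * x'"
  shows "connected_component (- P) (wedge_point d x y) (wedge_point d x' y')"
proof -
  have nP: "wedge_point d u z \<notin> P" if "0 < u" "u < \<rho>" "h u < z" "z \<le> \<kappa> * u" for u z
  proof -
    have "\<bar>h u\<bar> < \<kappa> * u" using w that unfolding wedge_def by blast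
    then have "\<bar>z\<bar> \<le> \<kappa> * u" using that by linarith
    then show ?thesis using w that unfolding wedge_def by (metis less_irrefl)
  qed
  have vert: "connected_component (- P) (wedge_point d u z) (wedge_point d u (\<kappa> * u))" if u: "0 < u" "u < \<rho>" "h u < z" "z \<le> \<kappa> * u" for u z
    unfolding connected_component_def
  proof (intro exI conjI)
    show "connected (wedge_point d u ` {z..\<kappa> * u})"
      unfolding wedge_point_def by (intro connected_continuous_image continuous_intros continuous_on_Complex) auto
    show "wedge_point d u ` {z..\<kappa> * u} \<subseteq> - P" using nP u by force
  qed (use u in auto)
  have "connected_component (- P) (wedge_point d x (\<kappa> * x)) (wedge_point d x' (\<kappa> * x'))"
    unfolding connected_component_def
  proof (intro exI conjI)
    show "connected ((\<lambda>u. wedge_point d u (\<kappa> * u)) ` {0<..<\<rho>})"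
      unfolding wedge_point_def by (intro connected_continuous_image continuous_intros continuous_on_Complex) auto
    have "h u < \<kappa> * u" if "0 < u" "u < \<rho>" for u using w that unfolding wedge_def by (metis abs_less_iff)
    then show "(\<lambda>u. wedge_point d u (\<kappa> * u)) ` {0<..<\<rho>} \<subseteq> - P" using nP by force
  qed (use x x' in auto)
  then show ?thesis using vert[OF x] vert[OF x'] connected_component_trans connected_component_sym by meson
qed

lemma wedge_below_connected:
  assumes w: "wedge d \<kappa> \<rho> h" and x: "0 < x" "x < \<rho>" "y < h x" "- (\<kappa> * x) \<le> y"
    and x': "0 < x'" "x' < \<rho>" "y' < h x'" "- (\<kappa> * x') \<le> y'"
  shows "connected_component (- P) (wedge_point d x y) (wedge_point d x' y')"
proof -
  have nP: "wedge_point d u z \<notin> P" if "0 < u" "u < \<rho>" "z < h u" "- (\<kappa> * u) \<le> z" for u z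
  proof -
    have "\<bar>h u\<bar> < \<kappa> * u" using w that unfolding wedge_def by blast
    then have "\<bar>z\<bar> \<le> \<kappa> * u" using that by linarith
    then show ?thesis using w that unfolding wedge_def by (metis less_irrefl)
  qed
  have vert: "connected_component (- P) (wedge_point d u z) (wedge_point d u (- (\<kappa> * u)))" if u: "0 < u" "u < \<rho>" "z < h u" "- (\<kappa> * u) \<le> z" for u z
    unfolding connected_component_def
  proof (intro exI conjI)
    show "connected (wedge_point d u ` {- (\<kappa> * u)..z})"
      unfolding wedge_point_def by (intro connected_continuous_image continuous_intros continuous_on_Complex) auto
    show "wedge_point d u ` {- (\<kappa> * u)..z} \<subseteq> - P" using nP u by force
  qed (use u in auto)
  have "connected_component (- P) (wedge_point d x (- (\<kappa> * x))) (wedge_point d x' (- (\<kappa> * x')))"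
    unfolding connected_component_def
  proof (intro exI conjI)
    show "connected ((\<lambda>u. wedge_point d u (- (\<kappa> * u))) ` {0<..<\<rho>})"
      unfolding wedge_point_def by (intro connected_continuous_image continuous_intros continuous_on_Complex) auto
    have "- (\<kappa> * u) < h u" if "0 < u" "u < \<rho>" for u using w that unfolding wedge_def by (metis abs_less_iff minus_less_iff)
    then show "(\<lambda>u. wedge_point d u (- (\<kappa> * u))) ` {0<..<\<rho>} \<subseteq> - P" using nP by force
  qed (use x x' in auto)
  then show ?thesis using vert[OF x] vert[OF x'] connected_component_trans connected_component_sym by meson
qed

lemma ray_in_wedge:
  assumes w: "wedge d \<kappa> \<rho> h"
  shows "\<forall>\<^sub>F \<theta> in at_right 0. \<forall>\<^sub>F r in at_right 0. 0 < r * cos \<theta> \<and> r * cos \<theta> < \<rho> \<and>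
    \<bar>h (r * cos \<theta>)\<bar> < r * sin \<theta> \<and> r * sin \<theta> \<le> \<kappa> * (r * cos \<theta>)"
proof -
  have k: "\<kappa> > 0" "\<rho> > 0" using w by (auto simp: wedge_def)
  have "((\<lambda>\<theta>. tan \<theta>) \<longlongrightarrow> tan 0) (at_right (0::real))" by (intro tendsto_intros) auto
  then have "\<forall>\<^sub>F \<theta> in at_right 0. tan \<theta> < \<kappa>" using k order_tendstoD(2)[of tan 0 "at_right 0" \<kappa>] by simp
  moreover have "\<forall>\<^sub>F \<theta> in at_right 0. \<theta> < pi / 2 \<and> (0::real) < \<theta>"
    by (auto simp: eventually_at_right_field intro!: exI[of _ "pi / 2"])
  ultimately show ?thesis
  proof eventually_elim
    case (elim \<theta>)
    have c: "cos \<theta> > 0" "sin \<theta> > 0" "tan \<theta> > 0" using elim cos_gt_zero_pi[of \<theta>] sin_gt_zero[of \<theta>] tan_gt_zero by auto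
    have t: "sin \<theta> = tan \<theta> * cos \<theta>" using c by (simp add: tan_def)
    have "\<forall>\<epsilon>>0. \<exists>r>0. \<forall>x. 0 < x \<and> x < r \<longrightarrow> \<bar>h x\<bar> < \<epsilon> * x" using w unfolding wedge_def by (elim conjE)
    then obtain R where R: "R > 0" "\<And>x. 0 < x \<Longrightarrow> x < R \<Longrightarrow> \<bar>h x\<bar> < tan \<theta> * x" using c(3) by meson
    have "0 < r * cos \<theta> \<and> r * cos \<theta> < \<rho> \<and> \<bar>h (r * cos \<theta>)\<bar> < r * sin \<theta> \<and> r * sin \<theta> \<le> \<kappa> * (r * cos \<theta>)"
      if r: "0 < r" "r < min R \<rho>" for r
    proof (intro conjI)
      have le: "r * cos \<theta> \<le> r" using mult_left_mono[OF cos_le_one[of \<theta>], of r] r(1) by simp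
      show p: "0 < r * cos \<theta>" using r c by simp
      show "r * cos \<theta> < \<rho>" using le r(2) by simp
      show "\<bar>h (r * cos \<theta>)\<bar> < r * sin \<theta>" using R(2)[OF p] le r(2) t by (simp add: mult_ac)
      have "tan \<theta> * (r * cos \<theta>) \<le> \<kappa> * (r * cos \<theta>)" using p elim(1) by (intro mult_right_mono) auto
      then show "r * sin \<theta> \<le> \<kappa> * (r * cos \<theta>)" using t by (simp add: algebra_simps)
    qed
    then show ?case using R(1) k by (auto simp: eventually_at_right_field intro!: exI[of _ "min R \<rho>"])
  qed
qed

lemma ray_wedge_point: "origin D d + of_real r * (cis \<theta> * direction D d) = wedge_point d (r * cos \<theta>) (r * sin \<theta>)"
  by (simp add: wedge_point_def complex_eq_iff cis.ctr algebra_simps)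

lemma wedge_above_in_face:
  assumes w: "wedge d \<kappa> \<rho> h" and f: "f \<in> faces D" "on_left D d f"
    and x: "0 < x" "x < \<rho>" "h x < y" "y \<le> \<kappa> * x"
  shows "wedge_point d x y \<in> f"
proof -
  have "\<forall>\<^sub>F \<theta> in at_right 0. \<forall>\<^sub>F r in at_right 0. wedge_point d (r * cos \<theta>) (r * sin \<theta>) \<in> f \<and>
    (0 < r * cos \<theta> \<and> r * cos \<theta> < \<rho> \<and> \<bar>h (r * cos \<theta>)\<bar> < r * sin \<theta> \<and> r * sin \<theta> \<le> \<kappa> * (r * cos \<theta>))"
    using f(2)[unfolded on_left_def ray_wedge_point] ray_in_wedge[OF w] by eventually_elim (rule eventually_conj)
  then obtain \<theta> where "\<forall>\<^sub>F r in at_right 0. wedge_point d (r * cos \<theta>) (r * sin \<theta>) \<in> f \<and>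
    (0 < r * cos \<theta> \<and> r * cos \<theta> < \<rho> \<and> \<bar>h (r * cos \<theta>)\<bar> < r * sin \<theta> \<and> r * sin \<theta> \<le> \<kappa> * (r * cos \<theta>))"
    using eventually_happens'[OF trivial_limit_at_right_real] by blast
  then obtain r where r: "wedge_point d (r * cos \<theta>) (r * sin \<theta>) \<in> f" "0 < r * cos \<theta>" "r * cos \<theta> < \<rho>"
     "\<bar>h (r * cos \<theta>)\<bar> < r * sin \<theta>" "r * sin \<theta> \<le> \<kappa> * (r * cos \<theta>)"
    using eventually_happens'[OF trivial_limit_at_right_real] by blast
  have "connected_component (- P) (wedge_point d (r * cos \<theta>) (r * sin \<theta>)) (wedge_point d x y)"
    by (rule wedge_above_connected[OF w]) (use r x in auto)
  then show ?thesis using connected_component_face f(1) r(1) by blast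
qed

lemma wedge_below_in_face:
  assumes w: "wedge d \<kappa> \<rho> h" and f: "f \<in> faces D" "on_right d f"
    and x: "0 < x" "x < \<rho>" "y < h x" "- (\<kappa> * x) \<le> y"
  shows "wedge_point d x y \<in> f"
proof -
  have "\<forall>\<^sub>F \<theta> in at_right 0. \<forall>\<^sub>F r in at_right 0. wedge_point d (r * cos (-\<theta>)) (r * sin (-\<theta>)) \<in> f \<and>
    (0 < r * cos \<theta> \<and> r * cos \<theta> < \<rho> \<and> \<bar>h (r * cos \<theta>)\<bar> < r * sin \<theta> \<and> r * sin \<theta> \<le> \<kappa> * (r * cos \<theta>))"
    using f(2)[unfolded on_right_def ray_wedge_point] ray_in_wedge[OF w] by eventually_elim (rule eventually_conj)
  then obtain \<theta> where "\<forall>\<^sub>F r in at_right 0. wedge_point d (r * cos (-\<theta>)) (r * sin (-\<theta>)) \<in> f \<and>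
    (0 < r * cos \<theta> \<and> r * cos \<theta> < \<rho> \<and> \<bar>h (r * cos \<theta>)\<bar> < r * sin \<theta> \<and> r * sin \<theta> \<le> \<kappa> * (r * cos \<theta>))"
    using eventually_happens'[OF trivial_limit_at_right_real] by blast
  then obtain r where r: "wedge_point d (r * cos (-\<theta>)) (r * sin (-\<theta>)) \<in> f" "0 < r * cos \<theta>" "r * cos \<theta> < \<rho>"
     "\<bar>h (r * cos \<theta>)\<bar> < r * sin \<theta>" "r * sin \<theta> \<le> \<kappa> * (r * cos \<theta>)"
    using eventually_happens'[OF trivial_limit_at_right_real] by blast
  have "connected_component (- P) (wedge_point d (r * cos (-\<theta>)) (r * sin (-\<theta>))) (wedge_point d x y)"
    by (rule wedge_below_connected[OF w]) (use r x in auto)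
  then show ?thesis using connected_component_face f(1) r(1) by blast
qed

text \<open>
  Between a dart and the next one clockwise, no edge leaves the vertex. The directions of a
  compact range of angles in this gap stay away from flat cones around the darts.
\<close>

lemma closed_sector_free:
  assumes d: "d \<in> darts_at v" and v: "v \<in> MP"
    and \<theta>: "0 < \<theta>1" "\<theta>2 < cw_angle d (rot_cw D d)"
  obtains r where "r > 0" "\<And>\<theta> s. \<theta> \<in> {\<theta>1..\<theta>2} \<Longrightarrow> 0 < s \<Longrightarrow> s < r \<Longrightarrow>
    v + of_real s * (cis (- \<theta>) * direction D d) \<notin> P"
proof -
  define \<phi> where "\<phi> e \<theta> = \<bar>Im (cis (- \<theta>) * direction D d / direction D e)\<bar> + max 0 (- Re (cis (- \<theta>) * direction D d / direction D e))" for e \<theta>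
  have nz: "direction D e \<noteq> 0" if "e \<in> darts_at v" for e using that direction_nonzero by (auto simp: darts_at_def)
  have a2: "cw_angle d e < 2 * pi" "cw_angle d e \<ge> 0" for e unfolding cw_angle_def using Arg2pi_lt_2pi Arg2pi_ge_0 by auto
  have pos: "\<phi> e \<theta> > 0" if e: "e \<in> darts_at v" and t: "\<theta> \<in> {\<theta>1..\<theta>2}" for e \<theta>
  proof (rule ccontr)
    let ?w = "cis (- \<theta>) * direction D d / direction D e"
    assume "\<not> \<phi> e \<theta> > 0"
    then have w0: "Im ?w = 0" "Re ?w \<ge> 0" unfolding \<phi>_def by linarith+
    moreover have "?w \<noteq> 0" using nz e d by auto
    ultimately have "Re ?w \<noteq> 0" by (metis complex_eq_iff zero_complex.simps)
    then have w: "?w = of_real (Re ?w)" "Re ?w > 0"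
      using w0 by (auto simp only: complex_eq_iff Re_complex_of_real Im_complex_of_real)
    have "direction D d / direction D e = of_real (Re ?w) * exp (\<i> * of_real \<theta>)"
    proof -
      have "direction D d / direction D e = ?w * cis \<theta>" by (simp add: cis_mult flip: mult.assoc)
      then show ?thesis using w(1) by (simp add: cis_conv_exp)
    qed
    moreover have "0 \<le> \<theta>" "\<theta> < 2 * pi" using t \<theta> a2(1)[of "rot_cw D d"] by auto
    ultimately have "cw_angle d e = \<theta>" unfolding cw_angle_def using Arg2pi_unique[of "Re ?w" \<theta>] w(2) by simp
    moreover have "e \<noteq> d"
    proof
      assume "e = d"
      then have "cw_angle d e = 0" using nz[OF e] Arg2pi_of_real[of 1] by (simp add: cw_angle_def)
      then show False using \<open>cw_angle d e = \<theta>\<close> t \<theta> by auto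
    qed
    ultimately show False using rot_cw_nearest(3)[OF d v e] t \<theta> by auto
  qed
  have "\<exists>\<mu>>0. \<forall>\<theta>\<in>{\<theta>1..\<theta>2}. \<mu> \<le> \<phi> e \<theta>" if e: "e \<in> darts_at v" for e
  proof (cases "\<theta>1 \<le> \<theta>2")
    case True
    have "continuous_on {\<theta>1..\<theta>2} (\<phi> e)"
      unfolding \<phi>_def using nz[OF e] by (intro continuous_intros) (auto simp: cis_conv_exp intro!: continuous_intros)
    then obtain \<theta>0 where "\<theta>0 \<in> {\<theta>1..\<theta>2}" "\<forall>\<theta>\<in>{\<theta>1..\<theta>2}. \<phi> e \<theta>0 \<le> \<phi> e \<theta>"
      using continuous_attains_inf[of "{\<theta>1..\<theta>2}" "\<phi> e"] True by auto
    then show ?thesis using pos[OF e] by blast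
  next
    case False
    then show ?thesis by (intro exI[of _ 1]) auto
  qed
  then obtain \<mu> where \<mu>: "\<And>e. e \<in> darts_at v \<Longrightarrow> \<mu> e > 0" "\<And>e \<theta>. e \<in> darts_at v \<Longrightarrow> \<theta> \<in> {\<theta>1..\<theta>2} \<Longrightarrow> \<mu> e \<le> \<phi> e \<theta>"
    by metis
  define k where "k e = \<mu> e * cmod (direction D e) / (2 * cmod (direction D d))" for e
  define \<kappa> where "\<kappa> = Min (k ` darts_at v)"
  have "k e > 0" if "e \<in> darts_at v" for e using that d \<mu>(1) nz by (simp add: k_def)
  then have "\<kappa> > 0" using finite_darts_at d unfolding \<kappa>_def by (subst Min_gr_iff) auto
  moreover have "\<kappa> \<le> k e" if "e \<in> darts_at v" for e using finite_darts_at that unfolding \<kappa>_def by (intro Min_le) auto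
  ultimately have \<kappa>: "\<kappa> > 0" "\<And>e. e \<in> darts_at v \<Longrightarrow> \<kappa> \<le> k e" by blast+
  obtain r where r: "r > 0" "\<And>q. q \<in> P \<Longrightarrow> q \<noteq> v \<Longrightarrow> dist v q < r \<Longrightarrow>
       \<exists>d\<in>darts_at v. \<bar>Im ((q - v) / direction D d)\<bar> < \<kappa> * Re ((q - v) / direction D d)"
    using vertex_cone_neighbourhood[OF v \<kappa>(1)] by blast
  have "v + of_real s * (cis (- \<theta>) * direction D d) \<notin> P"
    if t: "\<theta> \<in> {\<theta>1..\<theta>2}" and s: "0 < s" "s < r / cmod (direction D d)" for \<theta> s
  proof
    let ?q = "v + of_real s * (cis (- \<theta>) * direction D d)"
    assume p: "?q \<in> P"
    have "?q \<noteq> v" using s nz[OF d] by simp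
    moreover have "dist v ?q < r" using s nz[OF d] by (simp add: dist_norm norm_mult field_simps)
    ultimately obtain e where e: "e \<in> darts_at v" "\<bar>Im ((?q - v) / direction D e)\<bar> < \<kappa> * Re ((?q - v) / direction D e)"
      using r(2)[OF p] by blast
    let ?w = "cis (- \<theta>) * direction D d / direction D e"
    have w: "(?q - v) / direction D e = of_real s * ?w" by simp
    have ReIm: "Re (of_real s * w) = s * Re w" "Im (of_real s * w) = s * Im w" for w by simp_all
    have "s * \<bar>Im ?w\<bar> < s * (\<kappa> * Re ?w)"
      using e(2)[unfolded w ReIm abs_mult] s by (simp only: abs_of_pos mult.left_commute)
    then have im: "\<bar>Im ?w\<bar> < \<kappa> * Re ?w" using s by simp
    then have "0 < \<kappa> * Re ?w" by (meson abs_ge_zero le_less_trans)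
    then have re: "Re ?w > 0" using \<kappa>(1) by (simp add: zero_less_mult_iff)
    then have "\<phi> e \<theta> = \<bar>Im ?w\<bar>" by (simp add: \<phi>_def)
    moreover have "\<kappa> * Re ?w \<le> k e * cmod ?w"
      using \<kappa>(2)[OF e(1)] \<kappa>(1) re complex_Re_le_cmod[of ?w] by (intro mult_mono) auto
    moreover have "k e * cmod ?w = \<mu> e / 2"
      using nz[OF e(1)] nz[OF d] by (simp add: k_def norm_mult norm_divide)
    ultimately have "\<phi> e \<theta> < \<mu> e" using im \<mu>(1)[OF e(1)] by linarith
    then show False using \<mu>(2)[OF e(1) t] by simp
  qed
  then show ?thesis using r(1) nz[OF d] by (intro that[of "r / cmod (direction D d)"]) auto
qed

text \<open>
  Any two directions in the gap between consecutive darts belong to a common closed range of angles; so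
  short segments in all these directions lie in the same face.
\<close>

lemma face_in_sector:
  assumes dd: "d \<in> darts D"
  obtains f where "f \<in> faces D" "on_right d f" "on_left D (rot_cw D d) f"
proof -
  let ?v = "origin D d" and ?\<alpha> = "cw_angle d (rot_cw D d)"
  have v: "?v \<in> MP" and d: "d \<in> darts_at ?v" using dd origin_in_MP by (auto simp: darts_at_def)
  have e: "rot_cw D d \<in> darts_at ?v" "rot_cw D d \<noteq> d" using rot_cw_nearest[OF d v] by auto
  have \<alpha>: "?\<alpha> > 0" using cw_angle_nonzero[OF d e(1)] e(2) Arg2pi_ge_0[of "direction D d / direction D (rot_cw D d)"]
    by (auto simp: cw_angle_def less_eq_real_def)
  define G where "G \<theta> s = ?v + of_real s * (cis (- \<theta>) * direction D d)" for \<theta> s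
  define m where "m = ?\<alpha> / 2"
  have m0: "0 < m" "m < ?\<alpha>" using \<alpha> by (simp_all add: m_def)
  obtain r0 where r0: "r0 > 0" "\<And>s. 0 < s \<Longrightarrow> s < r0 \<Longrightarrow> G m s \<notin> P"
    using closed_sector_free[OF d v m0] unfolding G_def by (metis atLeastAtMost_iff order_refl)
  obtain f where f: "f \<in> faces D" "G m (r0 / 2) \<in> f" using face_exists[of "G m (r0 / 2)"] r0 by auto
  have m: "G m s \<in> f" if "0 < s" "s < r0" for s
  proof -
    have "connected_component (- P) (G m (r0 / 2)) (G m s)"
      unfolding connected_component_def
    proof (intro exI conjI)
      show "connected (G m ` {0<..<r0})"
        unfolding G_def by (intro connected_continuous_image continuous_intros) auto
    qed (use r0 that in auto)
    then show ?thesis using connected_component_face f by blast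
  qed
  have all: "\<exists>r>0. \<forall>s>0. s < r \<longrightarrow> G \<theta> s \<in> f" if t: "0 < \<theta>" "\<theta> < ?\<alpha>" for \<theta>
  proof -
    have mm: "0 < min \<theta> m" "max \<theta> m < ?\<alpha>" using t m0 by auto
    obtain r where r: "r > 0" "\<And>u s. u \<in> {min \<theta> m..max \<theta> m} \<Longrightarrow> 0 < s \<Longrightarrow> s < r \<Longrightarrow> G u s \<notin> P"
      using closed_sector_free[OF d v mm] unfolding G_def by blast
    have "G \<theta> s \<in> f" if s: "0 < s" "s < min r r0" for s
    proof -
      have "connected_component (- P) (G m s) (G \<theta> s)"
        unfolding connected_component_def
      proof (intro exI conjI)
        show "connected ((\<lambda>u. G u s) ` {min \<theta> m..max \<theta> m})"
          unfolding G_def cis_conv_exp by (intro connected_continuous_image continuous_intros) auto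
      qed (use r s in auto)
      then show ?thesis using connected_component_face[OF f(1) m] s by auto
    qed
    then show ?thesis using r(1) r0(1) by (intro exI[of _ "min r r0"]) auto
  qed
  have "on_right d f"
    unfolding on_right_def eventually_at_right_field G_def[symmetric]
    using all \<alpha> by (intro exI[of _ ?\<alpha>]) auto
  moreover have "on_left D (rot_cw D d) f"
  proof -
    let ?e = "direction D (rot_cw D d)"
    have nz: "direction D d \<noteq> 0" "?e \<noteq> 0" using direction_nonzero dd e by (auto simp: darts_at_def)
    define K where "K = cmod (direction D d / ?e)"
    have K: "K > 0" using nz by (simp add: K_def)
    have "direction D d / ?e = of_real K * cis ?\<alpha>"
      using Arg2pi_eq[of "direction D d / ?e"] by (simp add: K_def cw_angle_def cis_conv_exp)
    then have de: "direction D d = of_real K * cis ?\<alpha> * ?e" using nz by (simp add: divide_eq_eq)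
    have eq: "?v + of_real s * (cis \<theta> * ?e) = G (?\<alpha> - \<theta>) (s / K)" for \<theta> s
    proof -
      have "G (?\<alpha> - \<theta>) (s / K) = ?v + of_real (s / K) * of_real K * (cis (- (?\<alpha> - \<theta>)) * cis ?\<alpha>) * ?e"
        unfolding G_def by (subst de) (simp only: mult_ac)
      also have "of_real (s / K) * of_real K = (of_real s :: complex)" using K by simp
      also have "cis (- (?\<alpha> - \<theta>)) * cis ?\<alpha> = cis \<theta>" by (simp add: cis_mult)
      finally show ?thesis by (simp add: mult.assoc)
    qed
    have "\<exists>b>0. \<forall>s>0. s < b \<longrightarrow> G (?\<alpha> - \<theta>) (s / K) \<in> f" if t: "0 < \<theta>" "\<theta> < ?\<alpha>" for \<theta>
    proof -
      obtain r where r: "r > 0" "\<And>s. 0 < s \<Longrightarrow> s < r \<Longrightarrow> G (?\<alpha> - \<theta>) s \<in> f" using all[of "?\<alpha> - \<theta>"] t by auto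
      have "G (?\<alpha> - \<theta>) (s / K) \<in> f" if "0 < s" "s < r * K" for s
        using r(2)[of "s / K"] K that by (simp add: field_simps)
      then show ?thesis using r(1) K by (intro exI[of _ "r * K"]) auto
    qed
    then show ?thesis
      unfolding on_left_def eventually_at_right_field origin_rot_cw[OF dd] eq
      using \<alpha> by (intro exI[of _ ?\<alpha>]) auto
  qed
  ultimately show ?thesis using f(1) that by blast
qed

end


section \<open>Winding numbers of open arcs\<close>

lemma Ln_quarter_turns:
  assumes "Re b > 0"
  shows "Ln (\<i> * b) - Ln (- \<i> * b) = \<i> * pi"
proof -
  have "b \<noteq> 0" using assms by auto
  then have "Ln (- (\<i> * b)) = Ln (\<i> * b) - \<i> * pi"
    using assms by (subst Ln_minus) auto
  then show ?thesis by simp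
qed

text \<open>
  Only the part of the arc near the crossing matters, as the contributions of the other parts are continuous
  in the base point. Near the crossing the integral has explicit primitives: seen from a base point
  above the arc it avoids the upward ray, and seen from below the downward ray, so that logarithms
  cut along these rays can be used. Their difference accounts for the full turn.
\<close>

lemma winding_number_jump:
  fixes g :: "real \<Rightarrow> complex"
  assumes g: "valid_path g" and t: "0 \<le> u1" "u1 < t0" "t0 < u2" "u2 \<le> 1"
    and once: "\<And>t. 0 \<le> t \<Longrightarrow> t \<le> 1 \<Longrightarrow> g t = g t0 \<Longrightarrow> t = t0"
    and dir: "dir \<noteq> 0"
    and neg: "\<And>t. u1 \<le> t \<Longrightarrow> t < t0 \<Longrightarrow> Re ((g t - g t0) / dir) < 0"
    and pos: "\<And>t. t0 < t \<Longrightarrow> t \<le> u2 \<Longrightarrow> Re ((g t - g t0) / dir) > 0"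
    and off: "\<forall>\<^sub>F \<eta> in at_right 0. g t0 + \<i> * of_real \<eta> * dir \<notin> path_image g \<and> g t0 - \<i> * of_real \<eta> * dir \<notin> path_image g"
  shows "((\<lambda>\<eta>. winding_number g (g t0 + \<i> * of_real \<eta> * dir) - winding_number g (g t0 - \<i> * of_real \<eta> * dir)) \<longlongrightarrow> 1) (at_right 0)"
proof -
  define p where "p \<eta> = g t0 + \<i> * of_real \<eta> * dir" for \<eta> :: real
  define W where "W u v q = winding_number (subpath u v g) q" for u v q
  have path: "path g" using g valid_path_imp_path by blast
  have p_lim: "(p \<longlongrightarrow> g t0) (at_right 0)" "((\<lambda>\<eta>. p (- \<eta>)) \<longlongrightarrow> g t0) (at_right 0)"
    unfolding p_def by (auto intro!: tendsto_eq_intros)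
  have far: "((\<lambda>\<eta>. W u v (p \<eta>) - W u v (p (- \<eta>))) \<longlongrightarrow> 0) (at_right 0)"
    if uv: "0 \<le> u" "u \<le> v" "v \<le> 1" "t0 < u \<or> v < t0" for u v
  proof -
    have "g t0 \<notin> path_image (subpath u v g)"
    proof
      assume "g t0 \<in> path_image (subpath u v g)"
      then obtain s where "s \<in> {u..v}" "g t0 = g s" using uv by (auto simp: path_image_subpath)
      then show False using once[of s] uv by auto
    qed
    moreover have "path (subpath u v g)" using path uv by (intro path_subpath) auto
    ultimately have "isCont (W u v) (g t0)" unfolding W_def by (intro continuous_at_winding_number)
    then have "((\<lambda>\<eta>. W u v (p \<eta>)) \<longlongrightarrow> W u v (g t0)) (at_right 0)"
      "((\<lambda>\<eta>. W u v (p (- \<eta>))) \<longlongrightarrow> W u v (g t0)) (at_right 0)"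
      using p_lim isCont_tendsto_compose by blast+
    from tendsto_diff[OF this] show ?thesis by simp
  qed
  define A B where "A = (g u1 - g t0) / dir" and "B = (g u2 - g t0) / dir"
  have AB: "Re A < 0" "Re B > 0" using neg[of u1] pos[of u2] t by (auto simp: A_def B_def)
  \<comment> \<open>\<open>s = 1\<close> for the base point on the left, \<open>s = -1\<close> for the one on the right\<close>
  have mid: "\<i> * s * ((\<zeta> - p (s * \<eta>)) / dir) \<notin> \<real>\<^sub>\<le>\<^sub>0"
    if \<eta>: "\<eta> > 0" and s: "s = 1 \<or> s = -1" and \<zeta>: "\<zeta> \<in> path_image (subpath u1 u2 g)" for s \<eta> :: real and \<zeta>
  proof
    obtain u where u: "u \<in> {u1..u2}" "\<zeta> = g u" using \<zeta> t by (auto simp: path_image_subpath)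
    assume n: "\<i> * s * ((\<zeta> - p (s * \<eta>)) / dir) \<in> \<real>\<^sub>\<le>\<^sub>0"
    have "(\<zeta> - p (s * \<eta>)) / dir = (g u - g t0) / dir - \<i> * s * \<eta>"
      using dir by (simp add: p_def u(2) field_simps)
    moreover have "\<i> * s * X = \<i> * s * Y + \<eta>" if "X = Y - \<i> * s * \<eta>" for X Y
      using s that by (auto simp: algebra_simps)
    ultimately have e: "\<i> * s * ((\<zeta> - p (s * \<eta>)) / dir) = \<i> * s * ((g u - g t0) / dir) + \<eta>" by blast
    have "Im (\<i> * s * Y + \<eta>) = s * Re Y" for Y by simp
    note this[of "(g u - g t0) / dir"]
    moreover have "Im (\<i> * s * ((\<zeta> - p (s * \<eta>)) / dir)) = 0" using n complex_nonpos_Reals_iff by blast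
    ultimately have "Re ((g u - g t0) / dir) = 0" using e s by auto
    then have "u = t0" using neg[of u] pos[of u] u by (metis atLeastAtMost_iff less_irrefl linorder_neqE_linordered_idom)
    then have "\<i> * s * ((\<zeta> - p (s * \<eta>)) / dir) = \<eta>" using e by simp
    then show False using n \<eta> by simp
  qed
  have W_mid: "W u1 u2 (p (s * \<eta>)) = (Ln (\<i> * s * (B - \<i> * (s * \<eta>))) - Ln (\<i> * s * (A - \<i> * (s * \<eta>)))) / (2 * pi * \<i>)"
    if \<eta>: "\<eta> > 0" "s = 1 \<or> s = -1" for s \<eta> :: real
  proof -
    let ?g = "subpath u1 u2 g" and ?F = "\<lambda>\<zeta>. Ln (\<i> * s * ((\<zeta> - p (s * \<eta>)) / dir))"
    have v: "valid_path ?g" using g t by (intro valid_path_subpath) auto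
    have nz: "\<zeta> \<noteq> p (s * \<eta>)" if "\<zeta> \<in> path_image ?g" for \<zeta>
      using mid[OF \<eta> that] by auto
    have "((\<lambda>\<zeta>. 1 / (\<zeta> - p (s * \<eta>))) has_contour_integral (?F (pathfinish ?g) - ?F (pathstart ?g))) ?g"
    proof (rule contour_integral_primitive[where S = "path_image ?g"])
      fix \<zeta> assume z: "\<zeta> \<in> path_image ?g"
      have "(?F has_field_derivative inverse (\<i> * s * ((\<zeta> - p (s * \<eta>)) / dir)) * (\<i> * s * (1 / dir))) (at \<zeta> within path_image ?g)"
        using mid[OF \<eta> z] dir by (auto intro!: derivative_eq_intros simp: divide_inverse)
      moreover have "inverse (\<i> * s * ((\<zeta> - p (s * \<eta>)) / dir)) * (\<i> * s * (1 / dir)) = 1 / (\<zeta> - p (s * \<eta>))"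
        using dir nz[OF z] \<eta>(2) by (auto simp: field_simps)
      ultimately show "(?F has_field_derivative 1 / (\<zeta> - p (s * \<eta>))) (at \<zeta> within path_image ?g)" by simp
    qed (use v in auto)
    then have "contour_integral ?g (\<lambda>\<zeta>. 1 / (\<zeta> - p (s * \<eta>))) = ?F (g u2) - ?F (g u1)"
      by (simp add: contour_integral_unique)
    moreover have "(g u2 - p (s * \<eta>)) / dir = B - \<i> * (s * \<eta>)" "(g u1 - p (s * \<eta>)) / dir = A - \<i> * (s * \<eta>)"
      using dir by (simp_all add: p_def A_def B_def field_simps)
    moreover have "p (s * \<eta>) \<notin> path_image ?g" using nz by blast
    ultimately show ?thesis unfolding W_def using winding_number_valid_path[OF v] by simp
  qed
  define L where "L \<eta> = Ln (\<i> * (B - \<i> * \<eta>)) - Ln (\<i> * (A - \<i> * \<eta>)) - (Ln (- \<i> * (B + \<i> * \<eta>)) - Ln (- \<i> * (A + \<i> * \<eta>)))" for \<eta> :: real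
  have Lim: "(L \<longlongrightarrow> Ln (\<i> * (B - \<i> * (0::real))) - Ln (\<i> * (A - \<i> * (0::real))) - (Ln (- \<i> * (B + \<i> * (0::real))) - Ln (- \<i> * (A + \<i> * (0::real))))) (at_right 0)"
    unfolding L_def[abs_def] using AB by (intro tendsto_intros) (auto simp: complex_nonpos_Reals_iff)
  have "Ln (\<i> * B) - Ln (\<i> * A) - (Ln (- \<i> * B) - Ln (- \<i> * A)) = 2 * pi * \<i>"
    using Ln_quarter_turns[of B] Ln_quarter_turns[of "- A"] AB by (simp add: algebra_simps)
  then have "(L \<longlongrightarrow> 2 * pi * \<i>) (at_right 0)" using Lim by simp
  then have "((\<lambda>\<eta>. L \<eta> / (2 * pi * \<i>)) \<longlongrightarrow> 2 * pi * \<i> / (2 * pi * \<i>)) (at_right 0)" by (intro tendsto_intros) auto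
  then have L1: "((\<lambda>\<eta>. L \<eta> / (2 * pi * \<i>)) \<longlongrightarrow> 1) (at_right 0)" by simp
  have "\<forall>\<^sub>F \<eta> in at_right 0. L \<eta> / (2 * pi * \<i>) = W u1 u2 (p \<eta>) - W u1 u2 (p (- \<eta>))"
  proof (rule eventually_mono[OF eventually_at_right_less[of 0]])
    fix \<eta> :: real assume \<eta>: "0 < \<eta>"
    show "L \<eta> / (2 * pi * \<i>) = W u1 u2 (p \<eta>) - W u1 u2 (p (- \<eta>))"
      using W_mid[OF \<eta>, of 1] W_mid[OF \<eta>, of "-1"] by (simp add: L_def diff_divide_distrib)
  qed
  then have midlim: "((\<lambda>\<eta>. W u1 u2 (p \<eta>) - W u1 u2 (p (- \<eta>))) \<longlongrightarrow> 1) (at_right 0)"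
    by (rule Lim_transform_eventually[OF L1])
  have "((\<lambda>\<eta>. (W 0 u1 (p \<eta>) - W 0 u1 (p (- \<eta>))) + (W u1 u2 (p \<eta>) - W u1 u2 (p (- \<eta>)))
      + (W u2 1 (p \<eta>) - W u2 1 (p (- \<eta>)))) \<longlongrightarrow> 0 + 1 + 0) (at_right 0)"
    by (intro tendsto_add midlim far) (use t in auto)
  moreover have "\<forall>\<^sub>F \<eta> in at_right 0. (W 0 u1 (p \<eta>) - W 0 u1 (p (- \<eta>))) + (W u1 u2 (p \<eta>) - W u1 u2 (p (- \<eta>)))
      + (W u2 1 (p \<eta>) - W u2 1 (p (- \<eta>))) = winding_number g (p \<eta>) - winding_number g (p (- \<eta>))"
    using off
  proof eventually_elim
    case (elim \<eta>)
    have split: "W 0 u1 q + W u1 u2 q + W u2 1 q = winding_number g q" if "q \<notin> path_image g" for q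
      using winding_number_subpath_combine[OF path that, of 0 u1 u2] winding_number_subpath_combine[OF path that, of 0 u2 1] t
      unfolding W_def by simp
    have "p \<eta> \<notin> path_image g" "p (- \<eta>) \<notin> path_image g" using elim by (simp_all add: p_def)
    then show ?case using split by (simp add: algebra_simps flip: split)
  qed
  ultimately have "((\<lambda>\<eta>. winding_number g (p \<eta>) - winding_number g (p (- \<eta>))) \<longlongrightarrow> 0 + 1 + 0) (at_right 0)"
    by (rule Lim_transform_eventually)
  then show ?thesis by (simp add: p_def)
qed

context triple_projection begin

section \<open>The two sides of an edge\<close>

lemma rot_cw_surj:
  assumes "d \<in> darts D"
  obtains e where "e \<in> darts D" "rot_cw D e = d"
proof -
  have "(rot_cw D ^^ 5) d \<in> darts D" using assms rot_cw_in_darts by (simp add: eval_nat_numeral)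
  moreover have "rot_cw D ((rot_cw D ^^ 5) d) = d"
    using rot_cw_cyclic(1)[OF assms] by (simp add: eval_nat_numeral)
  ultimately show ?thesis using that by blast
qed

definition left :: "dart \<Rightarrow> complex set" where "left d = (THE f. f \<in> faces D \<and> on_left D d f)"
definition right :: "dart \<Rightarrow> complex set" where "right d = (THE f. f \<in> faces D \<and> on_right d f)"

lemma left_eqI: "f \<in> faces D \<Longrightarrow> on_left D d f \<Longrightarrow> left d = f"
  unfolding left_def by (rule the_equality, simp, elim conjE, rule on_left_unique)

lemma right_eqI: "f \<in> faces D \<Longrightarrow> on_right d f \<Longrightarrow> right d = f"
  unfolding right_def by (rule the_equality, simp, elim conjE, rule on_right_unique)

lemma left:
  assumes "d \<in> darts D"
  shows "left d \<in> faces D" "on_left D d (left d)"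
proof -
  obtain e where "e \<in> darts D" "rot_cw D e = d" using rot_cw_surj[OF assms] by blast
  then obtain f where "f \<in> faces D" "on_left D d f" using face_in_sector by metis
  then show "left d \<in> faces D" "on_left D d (left d)" using left_eqI by blast+
qed

lemma right:
  assumes "d \<in> darts D"
  shows "right d \<in> faces D" "on_right d (right d)" "right d = left (rot_cw D d)"
proof -
  obtain f where "f \<in> faces D" "on_right d f" "on_left D (rot_cw D d) f" using face_in_sector[OF assms] by blast
  then show "right d \<in> faces D" "on_right d (right d)" "right d = left (rot_cw D d)"
    using left_eqI right_eqI by blast+
qed

text \<open>Everything in the projection except the interior of one edge.\<close>

definition rest :: "dart \<Rightarrow> complex set" where
  "rest d = free_circles \<union> MP \<union> (\<Union>e\<in>darts D - {d, opp D d}. edge e ` {0..1})"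

lemma compact_rest: "compact (rest d)"
proof -
  have "compact (edge e ` {0..1})" if "e \<in> darts D" for e
    by (intro compact_continuous_image continuous_edge that compact_Icc)
  then show ?thesis
    unfolding rest_def using compact_free_circles finite_imp_compact[OF finite_MP] finite_darts_D
    by (intro compact_Un compact_UN) auto
qed

lemma edge_opp_image:
  assumes "d \<in> darts D"
  shows "edge (opp D d) ` {0..1} = edge d ` {0..1}"
proof -
  have "edge (opp D d) ` {0..1} = edge d ` (\<lambda>t. 1 - t) ` {0..1}"
    unfolding image_image by (intro image_cong refl edge_opp assms)
  moreover have "(\<lambda>t. 1 - t) ` {0..1} = {0..1::real}"
    by (auto simp: image_iff intro!: bexI[of _ "1 - _"])
  ultimately show ?thesis by simp
qed

lemma edge_endpoints_in_MP: "d \<in> darts D \<Longrightarrow> edge d 0 \<in> MP" "d \<in> darts D \<Longrightarrow> edge d 1 \<in> MP"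
  using edge_0 edge_1 origin_in_MP opp_in_darts by auto

lemma P_rest:
  assumes d: "d \<in> darts D"
  shows "P = rest d \<union> edge d ` {0..1}"
proof -
  define U U' where "U = (\<Union>e\<in>darts D. edge e ` {0..1})" and "U' = (\<Union>e\<in>darts D - {d, opp D d}. edge e ` {0..1})"
  have "darts D = (darts D - {d, opp D d}) \<union> {d, opp D d}" using d opp_in_darts[OF d] by blast
  then have "U = U' \<union> (\<Union>e\<in>{d, opp D d}. edge e ` {0..1})" unfolding U_def U'_def by (metis UN_Un)
  then have "U = U' \<union> edge d ` {0..1}" using edge_opp_image[OF d] by simp
  moreover have "P = free_circles \<union> U" unfolding U_def by (rule P_eq)
  moreover have "rest d = free_circles \<union> MP \<union> U'" unfolding U'_def by (rule rest_def)
  ultimately show ?thesis using MP_subset_P by blast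
qed

lemma edge_interior_not_rest:
  assumes d: "d \<in> darts D" and t: "0 < t" "t < 1"
  shows "edge d t \<notin> rest d"
proof
  assume r: "edge d t \<in> rest d"
  have "edge d t \<notin> free_circles" using free_circles_disjoint_edge[OF d] t by simp
  moreover have nMP: "edge d t \<notin> MP" using edge_interior[OF d t] .
  ultimately obtain e s where e: "e \<in> darts D" "e \<noteq> d" "e \<noteq> opp D d" "s \<in> {0..1}" "edge d t = edge e s"
    using r unfolding rest_def by blast
  have "s \<noteq> 0" "s \<noteq> 1" using e(5) nMP edge_endpoints_in_MP[OF e(1)] by metis+
  then show False using edge_injective[OF d e(1) t _ _ e(5)] e by auto
qed

lemma rest_opp: "d \<in> darts D \<Longrightarrow> rest (opp D d) = rest d"
  unfolding rest_def using opp_opp_D[of d] by (simp add: insert_commute)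

text \<open>
  A point of an edge close to its start, where both sides are visible: all faces that come within
  distance \<open>\<rho>\<close> of it are the two sides of the dart. Up to \<open>\<delta>\<close> the edge advances in the direction of
  the dart.
\<close>

definition side_point :: "dart \<Rightarrow> real \<Rightarrow> real \<Rightarrow> real \<Rightarrow> bool" where
  "side_point d t0 \<delta> \<rho> \<longleftrightarrow> 0 < t0 \<and> t0 < \<delta> \<and> \<delta> < 1/2 \<and> \<rho> > 0 \<and>
     (\<forall>a b. 0 \<le> a \<and> a < b \<and> b \<le> \<delta> \<longrightarrow> Re (local_coord d a) < Re (local_coord d b)) \<and>
     (\<forall>\<^sub>F \<eta> in at_right 0. edge d t0 + \<i> * of_real \<eta> * direction D d \<in> left d \<and>
        edge d t0 - \<i> * of_real \<eta> * direction D d \<in> right d) \<and>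
     ball (edge d t0) \<rho> \<inter> rest d = {} \<and> ball (edge d t0) \<rho> - P \<subseteq> left d \<union> right d"

lemma edge_side_point:
  assumes d: "d \<in> darts D"
  obtains t0 \<delta> \<rho> where "side_point d t0 \<delta> \<rho>"
proof -
  obtain \<kappa> r h where w: "wedge d \<kappa> r h" using wedge_exists[OF d] by blast
  have dir: "direction D d \<noteq> 0" using direction_nonzero d by blast
  define x where "x = r / 2"
  have kr: "\<kappa> > 0" "r > 0" and x: "0 < x" "x < r" using w by (auto simp: wedge_def x_def)
  have hx: "\<bar>h x\<bar> < \<kappa> * x" using w x unfolding wedge_def by blast
  have "\<exists>\<delta>. 0 < \<delta> \<and> \<delta> < 1/2 \<and> (\<forall>a b. 0 \<le> a \<and> a < b \<and> b \<le> \<delta> \<longrightarrow> Re (local_coord d a) < Re (local_coord d b)) \<and>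
        (\<forall>x. 0 < x \<and> x < r \<longrightarrow> (\<exists>t. 0 < t \<and> t < \<delta> \<and> edge d t = wedge_point d x (h x)))"
    using w unfolding wedge_def by (elim conjE)
  then obtain \<delta> where \<delta>: "0 < \<delta>" "\<delta> < 1/2" "\<And>a b. 0 \<le> a \<Longrightarrow> a < b \<Longrightarrow> b \<le> \<delta> \<Longrightarrow> Re (local_coord d a) < Re (local_coord d b)"
     "\<forall>x. 0 < x \<and> x < r \<longrightarrow> (\<exists>t. 0 < t \<and> t < \<delta> \<and> edge d t = wedge_point d x (h x))"
    by (elim exE conjE) simp
  then obtain t0 where t0: "0 < t0" "t0 < \<delta>" "edge d t0 = wedge_point d x (h x)" using x by blast
  define T where "T = {q. 0 < Re ((q - origin D d) / direction D d) \<and> Re ((q - origin D d) / direction D d) < r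
     \<and> \<bar>Im ((q - origin D d) / direction D d)\<bar> < \<kappa> * Re ((q - origin D d) / direction D d)}"
  have oT: "open T" unfolding T_def
    by (intro open_Collect_conj open_Collect_less continuous_intros) (use dir in auto)
  have point_coord: "(wedge_point d x y - origin D d) / direction D d = Complex x y" for x y using dir by (simp add: wedge_point_def)
  have xT: "edge d t0 \<in> T" unfolding T_def t0(3) using x hx by (simp add: point_coord)
  have Tside: "q \<in> left d \<union> right d" if q: "q \<in> T" "q \<notin> P" for q
  proof -
    define u y where "u = Re ((q - origin D d) / direction D d)" and "y = Im ((q - origin D d) / direction D d)"
    have "Complex u y = (q - origin D d) / direction D d" by (simp add: u_def y_def)
    then have qe: "q = wedge_point d u y" using dir by (simp add: wedge_point_def)
    have uy: "0 < u" "u < r" "\<bar>y\<bar> < \<kappa> * u" using q(1) by (auto simp: T_def u_def y_def)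
    have "y \<noteq> h u" using q(2) w uy unfolding wedge_def qe by (metis less_imp_le)
    then show ?thesis
      using wedge_above_in_face[OF w left[OF d] uy(1,2), of y] wedge_below_in_face[OF w right(1,2)[OF d] uy(1,2), of y] uy qe
      by (metis UnI1 UnI2 abs_less_iff less_imp_le linorder_neqE_linordered_idom minus_less_iff)
  qed
  have "edge d t0 \<in> T - rest d" using xT edge_interior_not_rest[OF d, of t0] t0 \<delta> by auto
  moreover have "open (T - rest d)" by (intro open_Diff oT compact_imp_closed compact_rest)
  ultimately obtain \<rho> where \<rho>: "\<rho> > 0" "ball (edge d t0) \<rho> \<subseteq> T - rest d" using openE by blast
  have "\<forall>\<^sub>F \<eta> in at_right 0. edge d t0 + \<i> * of_real \<eta> * direction D d \<in> left d \<and> edge d t0 - \<i> * of_real \<eta> * direction D d \<in> right d"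
    unfolding eventually_at_right_field
  proof (intro exI[of _ "\<kappa> * x - \<bar>h x\<bar>"] conjI allI impI)
    show "0 < \<kappa> * x - \<bar>h x\<bar>" using hx by simp
    fix \<eta> :: real assume \<eta>: "0 < \<eta>" "\<eta> < \<kappa> * x - \<bar>h x\<bar>"
    have "edge d t0 + \<i> * of_real \<eta> * direction D d = wedge_point d x (h x + \<eta>)" "edge d t0 - \<i> * of_real \<eta> * direction D d = wedge_point d x (h x - \<eta>)"
      unfolding t0(3) wedge_point_def by (auto simp: complex_eq_iff algebra_simps)
    then show "edge d t0 + \<i> * of_real \<eta> * direction D d \<in> left d" "edge d t0 - \<i> * of_real \<eta> * direction D d \<in> right d"
      using wedge_above_in_face[OF w left[OF d] x, of "h x + \<eta>"] wedge_below_in_face[OF w right(1,2)[OF d] x, of "h x - \<eta>"] \<eta> by auto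
  qed
  moreover have "ball (edge d t0) \<rho> \<inter> rest d = {}" "ball (edge d t0) \<rho> - P \<subseteq> left d \<union> right d"
    using \<rho>(2) Tside by blast+
  ultimately have "side_point d t0 \<delta> \<rho>" unfolding side_point_def using t0(1,2) \<delta>(2,3) \<rho>(1) by simp
  then show ?thesis using that by blast
qed


section \<open>Flows and their winding functions\<close>

definition flow :: "(dart \<Rightarrow> real) \<Rightarrow> bool" where
  "flow z \<longleftrightarrow> (\<forall>d\<in>darts D. z (opp D d) = - z d) \<and> (\<forall>v\<in>MP. (\<Sum>d\<in>darts_at v. z d) = 0)"

text \<open>The sum runs over darts, so every edge is counted in both directions.\<close>

definition winding :: "(dart \<Rightarrow> real) \<Rightarrow> complex \<Rightarrow> complex" where
  "winding z p = (\<Sum>d\<in>darts D. of_real (z d) * winding_number (edge d) p)"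

lemma valid_path_edge: "d \<in> darts D \<Longrightarrow> valid_path (edge d)"
proof -
  assume d: "d \<in> darts D"
  have "continuous_on {0..1} (\<lambda>t. (dart_sign d * stride d) *\<^sub>R
    vector_derivative (curve D (fst (fst d))) (at (snd (fst d) + dart_sign d * stride d * t)))"
    by (intro continuous_intros continuous_on_compose2[OF continuous_curve_derivative[OF comp_less[OF d]]]) auto
  then have "edge d C1_differentiable_on {0..1}"
    unfolding C1_differentiable_on_def using edge_derivative[OF d]
    by (intro exI[of _ "\<lambda>t. (dart_sign d * stride d) *\<^sub>R
      vector_derivative (curve D (fst (fst d))) (at (snd (fst d) + dart_sign d * stride d * t))"]) simp
  then show ?thesis unfolding valid_path_def by (rule C1_differentiable_imp_piecewise)
qed

lemma path_image_edge: "path_image (edge d) = edge d ` {0..1}" by (simp add: path_image_def)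

lemma edge_reverse: "d \<in> darts D \<Longrightarrow> edge (opp D d) = reversepath (edge d)"
  unfolding reversepath_def by (intro ext edge_opp)

lemma not_on_edge: "d \<in> darts D \<Longrightarrow> p \<notin> P \<Longrightarrow> p \<notin> path_image (edge d)"
  using edge_in_P[of d] by (auto simp: path_image_edge)

lemma winding_number_edge_opp:
  "d \<in> darts D \<Longrightarrow> p \<notin> P \<Longrightarrow> winding_number (edge (opp D d)) p = - winding_number (edge d) p"
  unfolding edge_reverse
  by (intro winding_number_reversepath not_on_edge valid_path_imp_path valid_path_edge)

lemma winding_number_edge_derivative:
  assumes d: "d \<in> darts D" and p: "p \<notin> P"
  shows "(winding_number (edge d) has_field_derivative
    (1 / (origin D d - p) - 1 / (origin D (opp D d) - p)) / (2 * pi * \<i>)) (at p)"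
proof -
  let ?g = "edge d"
  have v: "valid_path ?g" using valid_path_edge d by blast
  have off: "p \<notin> path_image ?g" using not_on_edge d p by blast
  have "continuous_on {0..1} (\<lambda>t. vector_derivative ?g (at t))"
  proof -
    have "vector_derivative ?g (at t) = (dart_sign d * stride d) *\<^sub>R
        vector_derivative (curve D (fst (fst d))) (at (snd (fst d) + dart_sign d * stride d * t))" for t
      using edge_derivative[OF d] vector_derivative_at by blast
    then show ?thesis
      by (simp, intro continuous_intros continuous_on_compose2[OF continuous_curve_derivative[OF comp_less[OF d]]]) auto
  qed
  then have "bounded ((\<lambda>t. vector_derivative ?g (at t)) ` {0..1})"
    by (intro compact_imp_bounded compact_continuous_image) auto
  then obtain B where B: "\<And>t. t \<in> {0..1} \<Longrightarrow> norm (vector_derivative ?g (at t)) \<le> B"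
    unfolding bounded_iff by blast
  have int: "((\<lambda>u. 1 / (u - w) ^ 1) has_contour_integral contour_integral ?g (\<lambda>u. 1 / (u - w))) ?g"
    if "w \<in> UNIV - path_image ?g" for w
    using contour_integrable_inversediff[OF v, of w] that has_contour_integral_integral by simp
  have "((\<lambda>w. contour_integral ?g (\<lambda>u. 1 / (u - w))) has_field_derivative
      of_nat 1 * contour_integral ?g (\<lambda>u. 1 / (u - p) ^ Suc 1)) (at p)"
    by (rule Cauchy_next_derivative(2)[of ?g "\<lambda>_. 1" B UNIV 1])
      (use B int v off in auto)
  moreover have "contour_integral ?g (\<lambda>u. 1 / (u - p) ^ Suc 1) = 1 / (origin D d - p) - 1 / (origin D (opp D d) - p)"
  proof -
    have "((\<lambda>u. 1 / (u - p) ^ Suc 1) has_contour_integral ((\<lambda>u. - 1 / (u - p)) (pathfinish ?g) - (\<lambda>u. - 1 / (u - p)) (pathstart ?g))) ?g"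
    proof (rule contour_integral_primitive[where S = "path_image ?g"])
      fix u assume "u \<in> path_image ?g"
      then have "u \<noteq> p" using off by blast
      then show "((\<lambda>u. - 1 / (u - p)) has_field_derivative 1 / (u - p) ^ Suc 1) (at u within path_image ?g)"
        by (auto intro!: derivative_eq_intros simp: power2_eq_square)
    qed (use v in auto)
    then show ?thesis using edge_0[of d] edge_1[OF d] by (simp add: contour_integral_unique pathfinish_def pathstart_def)
  qed
  ultimately have D: "((\<lambda>w. contour_integral ?g (\<lambda>u. 1 / (u - w))) has_field_derivative
      1 / (origin D d - p) - 1 / (origin D (opp D d) - p)) (at p)" by simp
  have D2: "((\<lambda>w. contour_integral ?g (\<lambda>u. 1 / (u - w)) / (2 * pi * \<i>)) has_field_derivative
      (1 / (origin D d - p) - 1 / (origin D (opp D d) - p)) / (2 * pi * \<i>)) (at p)"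
    by (rule DERIV_cdivide[OF D])
  show ?thesis
  proof (rule has_field_derivative_transform_within_open[OF D2])
    show "open (- path_image ?g)" using v closed_valid_path_image by auto
    show "p \<in> - path_image ?g" using off by simp
    show "contour_integral ?g (\<lambda>u. 1 / (u - w)) / (2 * pi * \<i>) = winding_number ?g w" if "w \<in> - path_image ?g" for w
      using winding_number_valid_path[OF v, of w] that by simp
  qed
qed

text \<open>
  The derivative of the winding function only sees the end points of the edges, where the
  contributions of a flow cancel.
\<close>

lemma winding_constant_on_face:
  assumes z: "flow z" and f: "f \<in> faces D" "p \<in> f" "q \<in> f"
  shows "winding z p = winding z q"
proof -
  have der: "(winding z has_field_derivative 0) (at p)" if p: "p \<in> f" for p
  proof -
    have pP: "p \<notin> P" using face_subset f(1) p by blast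
    have "(winding z has_field_derivative (\<Sum>d\<in>darts D. of_real (z d) *
        ((1 / (origin D d - p) - 1 / (origin D (opp D d) - p)) / (2 * pi * \<i>)))) (at p)"
      unfolding winding_def[abs_def]
      by (intro DERIV_sum DERIV_cmult winding_number_edge_derivative pP)
    moreover have "(\<Sum>d\<in>darts D. of_real (z d) *
        ((1 / (origin D d - p) - 1 / (origin D (opp D d) - p)) / (2 * pi * \<i>))) = 0"
    proof -
      let ?s = "\<lambda>d. of_real (z d) / (origin D d - p)"
      have "(\<Sum>d\<in>darts D. of_real (z d) / (origin D (opp D d) - p)) = (\<Sum>d\<in>darts D. - ?s d)"
        by (rule sum.reindex_bij_witness[of _ "opp D" "opp D"])
          (use z in \<open>auto simp: opp_opp_D opp_in_darts flow_def\<close>)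
      moreover have "(\<Sum>d\<in>darts D. ?s d) = (\<Sum>v\<in>MP. \<Sum>d\<in>darts_at v. ?s d)"
      proof -
        have "origin D ` darts D \<subseteq> MP" using origin_in_MP by blast
        then show ?thesis unfolding darts_at_def by (simp only: sum.group[OF finite_darts_D finite_MP])
      qed
      moreover have "(\<Sum>d\<in>darts_at v. ?s d) = 0" if "v \<in> MP" for v
      proof -
        have "(\<Sum>d\<in>darts_at v. ?s d) = (\<Sum>d\<in>darts_at v. of_real (z d) / (v - p))"
          by (rule sum.cong) (auto simp: darts_at_def)
        also have "\<dots> = of_real (\<Sum>d\<in>darts_at v. z d) / (v - p)" by (simp add: sum_divide_distrib)
        finally show ?thesis using z that by (simp add: flow_def del: of_real_sum)
      qed
      ultimately have 0: "(\<Sum>d\<in>darts D. ?s d) = 0" "(\<Sum>d\<in>darts D. of_real (z d) / (origin D (opp D d) - p)) = 0"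
        by (simp_all add: sum_negf)
      have "(\<Sum>d\<in>darts D. of_real (z d) * ((1 / (origin D d - p) - 1 / (origin D (opp D d) - p)) / (2 * pi * \<i>)))
          = (\<Sum>d\<in>darts D. (?s d - of_real (z d) / (origin D (opp D d) - p)) / (2 * pi * \<i>))"
        by (intro sum.cong refl) (simp add: algebra_simps diff_divide_distrib)
      also have "\<dots> = ((\<Sum>d\<in>darts D. ?s d) - (\<Sum>d\<in>darts D. of_real (z d) / (origin D (opp D d) - p))) / (2 * pi * \<i>)"
        by (simp only: sum_subtractf flip: sum_divide_distrib)
      finally show ?thesis using 0 by simp
    qed
    ultimately show ?thesis by simp
  qed
  have "continuous_on f (winding z)"
    using der by (meson DERIV_isCont continuous_at_imp_continuous_on)
  then obtain c where "\<And>x. x \<in> f \<Longrightarrow> winding z x = c"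
    using DERIV_zero_connected_constant[OF connected_face[OF f(1)] open_face[OF f(1)], of "{}" "winding z"] der by auto
  then show ?thesis using f by simp
qed

text \<open>
  The edge contributes its coefficient by the jump of its winding number, and the opposite
  direction contributes the same once more; all other edges contribute continuous functions.
\<close>

lemma winding_jump:
  assumes z: "flow z" and d: "d \<in> darts D" and p: "p \<in> left d" and q: "q \<in> right d"
  shows "winding z p - winding z q = of_real (2 * z d)"
proof -
  obtain t0 \<delta> \<rho> where sp: "side_point d t0 \<delta> \<rho>" using edge_side_point[OF d] by blast
  then have t0: "0 < t0" "t0 < \<delta>" "\<delta> < 1/2" "\<rho> > 0"
    "\<And>a b. 0 \<le> a \<Longrightarrow> a < b \<Longrightarrow> b \<le> \<delta> \<Longrightarrow> Re (local_coord d a) < Re (local_coord d b)"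
    unfolding side_point_def by simp_all
  have side: "\<forall>\<^sub>F \<eta> in at_right 0. edge d t0 + \<i> * of_real \<eta> * direction D d \<in> left d \<and> edge d t0 - \<i> * of_real \<eta> * direction D d \<in> right d"
    using sp unfolding side_point_def by (elim conjE)
  let ?dir = "direction D d" and ?q = "edge d t0"
  define a b where "a \<eta> = ?q + \<i> * of_real \<eta> * ?dir" and "b \<eta> = ?q - \<i> * of_real \<eta> * ?dir" for \<eta> :: real
  have side': "\<forall>\<^sub>F \<eta> in at_right 0. a \<eta> \<in> left d \<and> b \<eta> \<in> right d" using side by (simp add: a_def b_def)
  have offP: "\<forall>\<^sub>F \<eta> in at_right 0. a \<eta> \<notin> P \<and> b \<eta> \<notin> P"
    using side' by eventually_elim (use face_subset left(1)[OF d] right(1)[OF d] in blast)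
  have dir: "?dir \<noteq> 0" using direction_nonzero d by blast
  have jump: "((\<lambda>\<eta>. winding_number (edge d) (a \<eta>) - winding_number (edge d) (b \<eta>)) \<longlongrightarrow> 1) (at_right 0)"
    unfolding a_def b_def
  proof (rule winding_number_jump[OF valid_path_edge[OF d], of 0 t0 \<delta>])
    show "t = t0" if "0 \<le> t" "t \<le> 1" "edge d t = edge d t0" for t
    proof -
      have "edge d t0 \<notin> MP" using edge_interior[OF d] t0 by simp
      then have "t \<noteq> 0" "t \<noteq> 1" using that edge_endpoints_in_MP[OF d] by metis+
      then show ?thesis using edge_injective[OF d d, of t t0] that t0 opp_neq_D[OF d] by auto
    qed
    have "(edge d t - edge d t0) / ?dir = local_coord d t - local_coord d t0" for t by (simp add: local_coord_def diff_divide_distrib)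
    note e = this
    show "Re ((edge d t - edge d t0) / ?dir) < 0" if "0 \<le> t" "t < t0" for t
      using t0(5)[of t t0] that t0 by (simp add: e)
    show "Re ((edge d t - edge d t0) / ?dir) > 0" if "t0 < t" "t \<le> \<delta>" for t
      using t0(5)[of t0 t] that t0 by (simp add: e)
    show "\<forall>\<^sub>F \<eta> in at_right 0. edge d t0 + \<i> * of_real \<eta> * ?dir \<notin> path_image (edge d) \<and> edge d t0 - \<i> * of_real \<eta> * ?dir \<notin> path_image (edge d)"
      using offP unfolding a_def b_def by eventually_elim (use edge_in_P[OF d] in \<open>auto simp: path_image_edge\<close>)
  qed (use t0 dir in auto)
  have lim: "(a \<longlongrightarrow> ?q) (at_right 0)" "(b \<longlongrightarrow> ?q) (at_right 0)"
    unfolding a_def b_def by (auto intro!: tendsto_eq_intros)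
  have other: "((\<lambda>\<eta>. winding_number (edge e) (a \<eta>) - winding_number (edge e) (b \<eta>)) \<longlongrightarrow> 0) (at_right 0)"
    if e: "e \<in> darts D" "e \<noteq> d" "e \<noteq> opp D d" for e
  proof -
    have "?q \<notin> path_image (edge e)"
      using edge_interior_not_rest[OF d, of t0] t0 e by (auto simp: rest_def path_image_edge)
    then have "isCont (winding_number (edge e)) ?q"
      using valid_path_edge[OF e(1)] valid_path_imp_path continuous_at_winding_number by blast
    then have "((\<lambda>\<eta>. winding_number (edge e) (a \<eta>)) \<longlongrightarrow> winding_number (edge e) ?q) (at_right 0)"
      "((\<lambda>\<eta>. winding_number (edge e) (b \<eta>)) \<longlongrightarrow> winding_number (edge e) ?q) (at_right 0)"
      using lim isCont_tendsto_compose by blast+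
    from tendsto_diff[OF this] show ?thesis by simp
  qed
  let ?R = "darts D - {d, opp D d}"
  have split: "(\<Sum>e\<in>darts D. F e) = (\<Sum>e\<in>?R. F e) + F (opp D d) + F d" for F :: "dart \<Rightarrow> complex"
  proof -
    have "darts D = insert d (insert (opp D d) ?R)" using d opp_in_darts[OF d] by blast
    then have "(\<Sum>e\<in>darts D. F e) = (\<Sum>e\<in>insert d (insert (opp D d) ?R). F e)" by simp
    also have "\<dots> = F d + (F (opp D d) + (\<Sum>e\<in>?R. F e))"
      using finite_darts_D opp_neq_D[OF d] by (subst sum.insert; (subst sum.insert)?) auto
    finally show ?thesis by (simp add: algebra_simps)
  qed
  have "((\<lambda>\<eta>. (\<Sum>e\<in>?R. of_real (z e) * (winding_number (edge e) (a \<eta>) - winding_number (edge e) (b \<eta>)))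
      + of_real (2 * z d) * (winding_number (edge d) (a \<eta>) - winding_number (edge d) (b \<eta>)))
      \<longlongrightarrow> (\<Sum>e\<in>?R. of_real (z e) * 0) + of_real (2 * z d) * 1) (at_right 0)"
    by (intro tendsto_add tendsto_sum tendsto_mult tendsto_const jump other) auto
  moreover have "\<forall>\<^sub>F \<eta> in at_right 0. (\<Sum>e\<in>?R. of_real (z e) * (winding_number (edge e) (a \<eta>) - winding_number (edge e) (b \<eta>)))
      + of_real (2 * z d) * (winding_number (edge d) (a \<eta>) - winding_number (edge d) (b \<eta>)) = winding z p - winding z q"
    using offP side'
  proof eventually_elim
    case (elim \<eta>)
    have "winding z p = winding z (a \<eta>)" "winding z q = winding z (b \<eta>)"
      using winding_constant_on_face[OF z left(1)[OF d] p] winding_constant_on_face[OF z right(1)[OF d] q] elim by blast+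
    then have "winding z p - winding z q = winding z (a \<eta>) - winding z (b \<eta>)" by simp
    also have "\<dots> = (\<Sum>e\<in>darts D. of_real (z e) * (winding_number (edge e) (a \<eta>) - winding_number (edge e) (b \<eta>)))"
      by (simp add: winding_def sum_subtractf right_diff_distrib)
    finally show ?case
      unfolding split using winding_number_edge_opp[OF d] elim z d by (simp add: flow_def algebra_simps)
  qed
  ultimately have "((\<lambda>\<eta>::real. winding z p - winding z q) \<longlongrightarrow>
      (\<Sum>e\<in>?R. of_real (z e) * 0) + of_real (2 * z d) * 1) (at_right 0)"
    by (rule Lim_transform_eventually)
  then show ?thesis by (simp add: tendsto_const_iff)
qed


section \<open>The faces along an edge\<close>

declare opp.simps [simp del]

lemma face_nonempty: "f \<in> faces D \<Longrightarrow> \<exists>p. p \<in> f"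
  unfolding faces_def using in_components_nonempty by blast

lemma side_point_sees_both_sides:
  assumes sp: "side_point d t0 \<delta> \<rho>"
  shows "\<exists>y\<in>ball (edge d t0) \<rho>. y \<in> left d" "\<exists>y\<in>ball (edge d t0) \<rho>. y \<in> right d"
proof -
  let ?p = "\<lambda>\<eta>. edge d t0 + \<i> * of_real \<eta> * direction D d" and ?m = "\<lambda>\<eta>. edge d t0 - \<i> * of_real \<eta> * direction D d"
  have ev: "\<forall>\<^sub>F \<eta> in at_right 0. ?p \<eta> \<in> left d \<and> ?m \<eta> \<in> right d"
    using sp unfolding side_point_def by (elim conjE)
  have \<rho>: "\<rho> > 0" using sp unfolding side_point_def by (elim conjE)
  have "((\<lambda>\<eta>. \<bar>\<eta>\<bar> * cmod (direction D d)) \<longlongrightarrow> \<bar>0\<bar> * cmod (direction D d)) (at_right (0::real))"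
    by (intro tendsto_intros)
  then have "\<forall>\<^sub>F \<eta> in at_right (0::real). \<bar>\<eta>\<bar> * cmod (direction D d) < \<rho>"
    using order_tendstoD(2)[of _ _ _ \<rho>] \<rho> by force
  then have "\<forall>\<^sub>F \<eta> in at_right (0::real). (?p \<eta> \<in> left d \<and> ?m \<eta> \<in> right d) \<and> \<bar>\<eta>\<bar> * cmod (direction D d) < \<rho>"
    using ev by eventually_elim simp
  then obtain \<eta> :: real where \<eta>: "?p \<eta> \<in> left d" "?m \<eta> \<in> right d" "\<bar>\<eta>\<bar> * cmod (direction D d) < \<rho>"
    using eventually_happens'[OF trivial_limit_at_right_real] by blast
  have "?p \<eta> \<in> ball (edge d t0) \<rho>" "?m \<eta> \<in> ball (edge d t0) \<rho>"
    using \<eta>(3) by (simp_all add: dist_norm norm_mult)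
  then show "\<exists>y\<in>ball (edge d t0) \<rho>. y \<in> left d" "\<exists>y\<in>ball (edge d t0) \<rho>. y \<in> right d"
    using \<eta> by blast+
qed

lemma edge_inj_on:
  assumes d: "d \<in> darts D" and ab: "0 \<le> a" "b \<le> 1" "0 < a \<or> b < 1 \<or> origin D d \<noteq> origin D (opp D d)"
  shows "inj_on (edge d) {a..b}"
proof (rule inj_onI)
  fix s t assume st: "s \<in> {a..b}" "t \<in> {a..b}" "edge d s = edge d t"
  have interior: "edge d u \<in> MP \<longleftrightarrow> u = 0 \<or> u = 1" if "u \<in> {a..b}" for u
    using edge_interior[OF d, of u] edge_endpoints_in_MP[OF d] that ab by force
  show "s = t"
  proof (cases "edge d s \<in> MP")
    case True
    moreover have "edge d t \<in> MP" using True st(3) by simp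
    ultimately have "s = 0 \<or> s = 1" "t = 0 \<or> t = 1" using interior[OF st(1)] interior[OF st(2)] by blast+
    moreover have "\<not> (s = 0 \<and> t = 1)" "\<not> (s = 1 \<and> t = 0)"
      using st ab edge_0[of d] edge_1[OF d] by auto
    ultimately show ?thesis by blast
  next
    case False
    then have "0 < s" "s < 1" "0 < t" "t < 1"
      using interior[OF st(1)] interior[OF st(2)] st ab by auto
    then show ?thesis using edge_injective[OF d d _ _ _ _ st(3)] opp_neq_D[OF d] by auto
  qed
qed

lemma subarc_complement_connected:
  assumes d: "d \<in> darts D" and ab: "0 \<le> a" "a < b" "b \<le> 1" "0 < a \<or> b < 1 \<or> origin D d \<noteq> origin D (opp D d)"
  shows "connected (- edge d ` {a..b})"
proof -
  have "path (subpath a b (edge d))"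
    using valid_path_edge[OF d] ab by (intro path_subpath valid_path_imp_path) auto
  then have "arc (subpath a b (edge d))"
    using edge_inj_on[OF d ab(1,3,4)] ab by (simp add: arc_subpath_eq closed_segment_eq_real_ivl)
  then have "connected (- path_image (subpath a b (edge d)))" by (rule connected_arc_complement) simp
  then show ?thesis using ab by (simp add: path_image_subpath)
qed

lemma edge_meets_rest:
  assumes d: "d \<in> darts D" and t: "0 \<le> t" "t \<le> 1" and r: "edge d t \<in> rest d"
  shows "t = 0 \<or> t = 1"
  using edge_interior_not_rest[OF d, of t] t r by force

lemma compact_edge_piece: "d \<in> darts D \<Longrightarrow> compact (edge d ` {a..b})"
  by (intro compact_continuous_image continuous_edge compact_Icc)

text \<open>
  Suppose that a face touches the end of the edge, but not its start. Removing a short piece near the start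
  leaves two arcs that dangle from the rest of the projection, and by Janiszewski's theorem these do not
  separate. So the face would reach the removed piece, from which it stays away.
\<close>

lemma faces_at_end_are_faces_at_start:
  assumes d: "d \<in> darts D" and f: "f = left (opp D d) \<or> f = right (opp D d)"
  shows "f = left d \<or> f = right d"
proof (rule ccontr)
  assume neg: "\<not> (f = left d \<or> f = right d)"
  have od: "opp D d \<in> darts D" using opp_in_darts d by blast
  obtain s \<delta> \<rho> where sp: "side_point d s \<delta> \<rho>" using edge_side_point[OF d] by blast
  obtain s' \<delta>' \<rho>' where sp': "side_point (opp D d) s' \<delta>' \<rho>'" using edge_side_point[OF od] by blast
  define B0 B1 where "B0 = ball (edge d s) \<rho>" and "B1 = ball (edge (opp D d) s') \<rho>'"
  have s: "0 < s" "s < 1/2" "\<rho> > 0" "B0 \<inter> rest d = {}" "B0 - P \<subseteq> left d \<union> right d"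
    using sp unfolding side_point_def B0_def by auto
  have s': "0 < s'" "s' < 1/2" "\<rho>' > 0" "B1 \<inter> rest d = {}"
    using sp' unfolding side_point_def B1_def rest_opp[OF d] by auto
  have fF: "f \<in> faces D" using f left(1)[OF od] right(1)[OF od] by blast
  obtain y where y: "y \<in> f" "y \<in> B1" using f side_point_sees_both_sides[OF sp'] unfolding B1_def by blast
  obtain y' where y': "y' \<in> left d" "y' \<in> B0" using side_point_sees_both_sides(1)[OF sp] unfolding B0_def by blast
  have nP: "y \<notin> P" "y' \<notin> P" using face_subset fF left(1)[OF d] y y' by blast+
  have fB0: "f \<inter> B0 = {}"
  proof (rule ccontr)
    assume "f \<inter> B0 \<noteq> {}"
    then obtain x where x: "x \<in> f" "x \<in> B0" by blast
    then have "x \<in> left d \<union> right d" using s(5) face_subset[OF fF] by blast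
    then show False using neg face_disjoint[OF fF _ x(1)] left(1)[OF d] right(1)[OF d] by blast
  qed
  obtain e where e: "e > 0" "\<And>t. \<bar>t - s\<bar> < e \<Longrightarrow> edge d t \<in> B0"
  proof -
    have "isCont (edge d) s" using continuous_edge[OF d, of UNIV] continuous_on_eq_continuous_at by blast
    then show ?thesis using that s(3) unfolding B0_def continuous_at_eps_delta
      by (metis dist_commute dist_real_def mem_ball)
  qed
  define \<epsilon> where "\<epsilon> = min e (min s (1/2 - s)) / 2"
  define a b where "a = s - \<epsilon>" and "b = s + \<epsilon>"
  have ab: "0 < a" "a < b" "b < 1" "\<And>t. t \<in> {a..b} \<Longrightarrow> edge d t \<in> B0"
  proof -
    have \<epsilon>: "0 < \<epsilon>" "\<epsilon> < e" "\<epsilon> < s" "\<epsilon> < 1/2 - s" using e(1) s by (auto simp: \<epsilon>_def)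
    then show "0 < a" "a < b" "b < 1" using s by (auto simp: a_def b_def)
    show "edge d t \<in> B0" if "t \<in> {a..b}" for t using e(2)[of t] that \<epsilon> by (auto simp: a_def b_def abs_less_iff)
  qed
  define A1 A2 where "A1 = edge d ` {0..a}" and "A2 = edge d ` {b..1}"
  have sub: "A1 \<subseteq> P" "A2 \<subseteq> P" unfolding A1_def A2_def using edge_in_P[OF d] by blast+
  have cr: "connected_component (- rest d) y y'"
  proof -
    let ?E = "edge d ` {0<..<1}"
    have "connected ?E" by (intro connected_continuous_image continuous_edge d) auto
    moreover have "edge d s \<in> ?E \<inter> B0" using s by (auto simp: B0_def)
    moreover have "connected B0" "connected B1" by (simp_all add: B0_def B1_def)
    ultimately have c: "connected (?E \<union> B0)" by (intro connected_Un) blast+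
    have "edge d (1 - s') \<in> ?E" using s' by (intro imageI) auto
    moreover have "edge d (1 - s') \<in> B1" using s' edge_opp[OF d, of s'] by (simp add: B1_def)
    ultimately have "(?E \<union> B0) \<inter> B1 \<noteq> {}" by blast
    from connected_Un[OF c \<open>connected B1\<close> this]
    have "connected (?E \<union> B0 \<union> B1)" .
    moreover have "?E \<inter> rest d = {}" using edge_interior_not_rest[OF d] by auto
    ultimately show ?thesis unfolding connected_component_def using s(4) s'(4) y y' by blast
  qed
  have c1: "connected_component (- (A1 \<union> rest d)) y y'"
  proof (rule Janiszewski[OF _ _ _ _ cr])
    show "compact A1" "closed (rest d)"
      unfolding A1_def using compact_edge_piece[OF d] compact_imp_closed[OF compact_rest] by blast+
    have "A1 \<inter> rest d = {edge d 0}"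
    proof
      show "A1 \<inter> rest d \<subseteq> {edge d 0}"
      proof
        fix x assume x: "x \<in> A1 \<inter> rest d"
        then obtain t where t: "t \<in> {0..a}" "x = edge d t" unfolding A1_def by blast
        then have "t = 0 \<or> t = 1" using edge_meets_rest[OF d, of t] ab(1-3) x by auto
        then have "t = 0" using t(1) ab(1-3) by auto
        then show "x \<in> {edge d 0}" using t(2) by simp
      qed
      have "edge d 0 \<in> A1" unfolding A1_def using ab(1-3) by (intro imageI) auto
      then show "{edge d 0} \<subseteq> A1 \<inter> rest d" using edge_endpoints_in_MP[OF d] by (simp add: rest_def)
    qed
    then show "connected (A1 \<inter> rest d)" by simp
    have "connected (- A1)" unfolding A1_def by (rule subarc_complement_connected[OF d]) (use ab in auto)
    then show "connected_component (- A1) y y'"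
      unfolding connected_iff_connected_component using nP sub by blast
  qed
  have c2: "connected_component (- (A2 \<union> (A1 \<union> rest d))) y y'"
  proof (rule Janiszewski[OF _ _ _ _ c1])
    show "compact A2" "closed (A1 \<union> rest d)"
      unfolding A1_def A2_def
      by (intro compact_edge_piece d closed_Un compact_imp_closed compact_rest)+
    have "A2 \<inter> rest d = {edge d 1}"
    proof
      show "A2 \<inter> rest d \<subseteq> {edge d 1}"
      proof
        fix x assume x: "x \<in> A2 \<inter> rest d"
        then obtain t where t: "t \<in> {b..1}" "x = edge d t" unfolding A2_def by blast
        then have "t = 0 \<or> t = 1" using edge_meets_rest[OF d, of t] ab(1-3) x by auto
        then have "t = 1" using t(1) ab(1-3) by auto
        then show "x \<in> {edge d 1}" using t(2) by simp
      qed
      have "edge d 1 \<in> A2" unfolding A2_def using ab(1-3) by (intro imageI) auto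
      then show "{edge d 1} \<subseteq> A2 \<inter> rest d" using edge_endpoints_in_MP[OF d] by (simp add: rest_def)
    qed
    moreover have "A2 \<inter> A1 \<subseteq> {edge d 1}"
    proof
      fix x assume "x \<in> A2 \<inter> A1"
      then obtain t u where tu: "t \<in> {0..a}" "u \<in> {b..1}" "x = edge d t" "x = edge d u" unfolding A1_def A2_def by blast
      have "u = 1"
      proof (rule ccontr)
        assume "u \<noteq> 1"
        then have u: "0 < u" "u < 1" using tu ab by auto
        then have "t \<noteq> 0" using edge_interior[OF d u] edge_endpoints_in_MP[OF d] tu by metis
        then show False using edge_injective[OF d d _ _ u, of t] tu ab opp_neq_D[OF d] by auto
      qed
      then show "x \<in> {edge d 1}" using tu by simp
    qed
    ultimately have "A2 \<inter> (A1 \<union> rest d) = {edge d 1}" by blast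
    then show "connected (A2 \<inter> (A1 \<union> rest d))" by simp
    have "connected (- A2)" unfolding A2_def by (rule subarc_complement_connected[OF d]) (use ab in auto)
    then show "connected_component (- A2) y y'"
      unfolding connected_iff_connected_component using nP sub by blast
  qed
  then obtain C where C: "connected C" "C \<subseteq> - (A2 \<union> (A1 \<union> rest d))" "y \<in> C" "y' \<in> C"
    unfolding connected_component_def by blast
  have "C \<subseteq> f \<union> - closure f"
  proof
    fix x assume x: "x \<in> C"
    show "x \<in> f \<union> - closure f"
    proof (cases "x \<in> P")
      case True
      then have "x \<in> edge d ` {0..1}" using P_rest[OF d] x C(2) by blast
      then obtain t where t: "t \<in> {0..1}" "x = edge d t" by blast
      then have "t \<in> {a..b}" using x C(2) unfolding A1_def A2_def by force
      then have "x \<in> B0" using ab(4) t by blast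
      moreover have "B0 \<inter> closure f = {}" using fB0 open_Int_closure_eq_empty[of B0 f] by (auto simp: B0_def)
      ultimately show ?thesis by blast
    next
      case False
      then obtain g where g: "g \<in> faces D" "x \<in> g" using face_exists by blast
      show ?thesis
      proof (cases "g = f")
        case False
        then have "g \<inter> f = {}" using face_disjoint[OF g(1) fF] by blast
        then have "g \<inter> closure f = {}" using open_Int_closure_eq_empty[OF open_face[OF g(1)]] by blast
        then show ?thesis using g by blast
      qed (use g in blast)
    qed
  qed
  moreover have "open f" "open (- closure f)" using open_face[OF fF] by auto
  moreover have "f \<inter> - closure f \<inter> C = {}" using closure_subset by blast
  moreover have "f \<inter> C \<noteq> {}" using y C by blast
  ultimately have "- closure f \<inter> C = {}" using connectedD[OF C(1), of f "- closure f"] by blast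
  then have "y' \<in> f" using C(4) \<open>C \<subseteq> f \<union> - closure f\<close> by blast
  then show False using fB0 y' by blast
qed

definition reachable_avoiding :: "dart \<Rightarrow> complex set" where
  "reachable_avoiding d = {(origin D e, origin D (opp D e)) |e. e \<in> darts D - {d, opp D d}}\<^sup>* `` {origin D (opp D d)}"

text \<open>
  If the edge is a bridge of the graph, the rest of the projection splits into two closed parts, each of
  which meets the edge in one end point. Neither the edge nor these parts separate two points next to
  the edge, so by Janiszewski's theorem their union does not separate them.
\<close>

lemma bridge_sides_equal:
  assumes d: "d \<in> darts D" and br: "origin D d \<notin> reachable_avoiding d"
  shows "left d = right d"
proof -
  let ?N = "reachable_avoiding d" and ?X = "darts D - {d, opp D d}" and ?v = "origin D d" and ?v' = "origin D (opp D d)"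
  have v': "?v' \<in> ?N" by (simp add: reachable_avoiding_def)
  have step: "origin D (opp D e) \<in> ?N" if "e \<in> ?X" "origin D e \<in> ?N" for e
  proof -
    have "(origin D e, origin D (opp D e)) \<in> {(origin D e, origin D (opp D e)) |e. e \<in> ?X}" using that(1) by blast
    moreover have "(?v', origin D e) \<in> {(origin D e, origin D (opp D e)) |e. e \<in> ?X}\<^sup>*"
      using that(2) by (simp add: reachable_avoiding_def)
    ultimately have "(?v', origin D (opp D e)) \<in> {(origin D e, origin D (opp D e)) |e. e \<in> ?X}\<^sup>*"
      by (rule rtrancl_into_rtrancl[rotated])
    then show ?thesis by (simp add: reachable_avoiding_def)
  qed
  have oX: "opp D e \<in> ?X" if "e \<in> ?X" for e
    using that opp_in_darts[of e] opp_opp_D[of e] opp_opp_D[OF d] by auto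
  have iff: "origin D (opp D e) \<in> ?N \<longleftrightarrow> origin D e \<in> ?N" if "e \<in> ?X" for e
    using step[OF that] step[OF oX[OF that]] opp_opp_D[of e] that by auto
  define Q1 Q2 where "Q1 = (MP \<inter> ?N) \<union> (\<Union>e\<in>{e\<in>?X. origin D e \<in> ?N}. edge e ` {0..1})"
    and "Q2 = free_circles \<union> (MP - ?N) \<union> (\<Union>e\<in>{e\<in>?X. origin D e \<notin> ?N}. edge e ` {0..1})"
  have rest: "rest d = Q1 \<union> Q2"
    unfolding rest_def Q1_def Q2_def by blast
  have cl: "compact Q1" "compact Q2"
  proof -
    have fin: "finite {e\<in>?X. origin D e \<in> ?N}" "finite {e\<in>?X. origin D e \<notin> ?N}" using finite_darts_D by auto
    have "compact (\<Union>e\<in>{e\<in>?X. origin D e \<in> ?N}. edge e ` {0..1})" "compact (\<Union>e\<in>{e\<in>?X. origin D e \<notin> ?N}. edge e ` {0..1})"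
      by (intro compact_UN fin ballI compact_edge_piece; blast)+
    moreover have "compact (MP \<inter> ?N)" "compact (MP - ?N)" using finite_MP by (auto intro: finite_imp_compact)
    ultimately show "compact Q1" "compact Q2"
      unfolding Q1_def Q2_def by (simp_all only: compact_Un compact_free_circles)
  qed
  have ends: "edge e t \<in> ?N \<longleftrightarrow> origin D e \<in> ?N" if "e \<in> ?X" "t \<in> {0..1}" "edge e t \<in> MP" for e t
  proof -
    have "t = 0 \<or> t = 1" using edge_interior[of e t] that by force
    then show ?thesis using edge_0[of e] edge_1[of e] iff[OF that(1)] that(1) by auto
  qed
  have Q1N: "x \<in> ?N" if "x \<in> Q1" "x \<in> MP" for x using that ends unfolding Q1_def by blast
  have Q2N: "x \<notin> ?N" if "x \<in> Q2" "x \<in> MP" for x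
    using that ends free_circles_disjoint_MP unfolding Q2_def by blast
  have disj: "Q1 \<inter> Q2 = {}"
  proof (rule equals0I)
    fix x assume x: "x \<in> Q1 \<inter> Q2"
    then have nM: "x \<notin> MP" using Q1N Q2N by blast
    then obtain e t where e: "e \<in> ?X" "origin D e \<in> ?N" "t \<in> {0..1}" "x = edge e t" using x unfolding Q1_def by blast
    then have "x \<notin> free_circles" using free_circles_disjoint_edge[of e t] by auto
    then obtain e' t' where e': "e' \<in> ?X" "origin D e' \<notin> ?N" "t' \<in> {0..1}" "x = edge e' t'" using x nM unfolding Q2_def by blast
    have "t \<noteq> 0" "t \<noteq> 1" using nM e edge_endpoints_in_MP[of e] by auto
    moreover have "t' \<noteq> 0" "t' \<noteq> 1" using nM e' edge_endpoints_in_MP[of e'] by auto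
    ultimately have "e' = e \<or> e' = opp D e" using edge_injective[of e e' t t'] e e' by auto
    then show False using e(2) e'(2) iff[OF e(1)] by blast
  qed
  let ?A = "edge d ` {0..1}"
  have vv: "?v \<in> MP" "?v' \<in> MP" using origin_in_MP d opp_in_darts by auto
  have inA: "?v \<in> ?A" "?v' \<in> ?A" 
    using edge_0[of d] edge_1[OF d] imageI[of 0 "{0..1}" "edge d"] imageI[of 1 "{0..1}" "edge d"] by simp_all
  have inQ: "?v' \<in> Q1" "?v \<in> Q2" using vv v' br by (auto simp: Q1_def Q2_def)
  have Arest: "x = ?v \<or> x = ?v'" if x: "x \<in> ?A" "x \<in> rest d" for x
  proof -
    obtain t where t: "t \<in> {0..1}" "x = edge d t" using x(1) by blast
    then have "t = 0 \<or> t = 1" using edge_meets_rest[OF d, of t] x(2) by simp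
    then show ?thesis using t edge_0[of d] edge_1[OF d] by auto
  qed
  have vQ: "?v \<notin> Q1" "?v' \<notin> Q2" using inQ disj by (metis IntI empty_iff)+
  have sub: "Q1 \<subseteq> rest d" "Q2 \<subseteq> rest d" by (simp_all add: rest)
  have A1: "?A \<inter> Q1 = {?v'}"
  proof (intro equalityI subsetI)
    fix x assume x: "x \<in> ?A \<inter> Q1"
    then have "x = ?v \<or> x = ?v'" using Arest[of x] sub(1) by (simp add: subset_iff)
    then show "x \<in> {?v'}" using vQ x by auto
  qed (use inA inQ in simp)
  have A2: "(?A \<union> Q1) \<inter> Q2 = {?v}"
  proof (intro equalityI subsetI)
    fix x assume x: "x \<in> (?A \<union> Q1) \<inter> Q2"
    then have "x \<in> ?A" using disj by (metis IntE IntI UnE empty_iff)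
    then have "x = ?v \<or> x = ?v'" using Arest[of x] sub(2) x by (simp add: subset_iff)
    then show "x \<in> {?v}" using vQ x by auto
  qed (use inA inQ in simp)
  have ne: "?v \<noteq> ?v'" using br v' by auto
  obtain s \<delta> \<rho> where sp: "side_point d s \<delta> \<rho>" using edge_side_point[OF d] by blast
  define B0 where "B0 = ball (edge d s) \<rho>"
  have B0: "B0 \<inter> rest d = {}" using sp unfolding side_point_def B0_def by (elim conjE)
  obtain p where p: "p \<in> left d" "p \<in> B0" using side_point_sees_both_sides(1)[OF sp] unfolding B0_def by blast
  obtain q where q: "q \<in> right d" "q \<in> B0" using side_point_sees_both_sides(2)[OF sp] unfolding B0_def by blast
  have nP: "p \<notin> P" "q \<notin> P" using face_subset left(1)[OF d] right(1)[OF d] p q by blast+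
  have near: "connected_component (- Q) p q" if "Q \<subseteq> rest d" for Q
    unfolding connected_component_def using p q B0 that by (intro exI[of _ B0]) (auto simp: B0_def)
  have "connected (- ?A)" by (rule subarc_complement_connected[OF d]) (use ne in auto)
  then have cA: "connected_component (- ?A) p q"
    unfolding connected_iff_connected_component using nP edge_in_P[OF d] by blast
  have "connected (?A \<inter> Q1)" "connected ((?A \<union> Q1) \<inter> Q2)" unfolding A1 A2 by simp_all
  note conn = this
  have c1: "connected_component (- (?A \<union> Q1)) p q"
    by (rule Janiszewski[OF compact_edge_piece[OF d] compact_imp_closed[OF cl(1)] conn(1) cA near[OF sub(1)]])
  have "connected_component (- (?A \<union> Q1 \<union> Q2)) p q"
    by (rule Janiszewski[OF compact_Un[OF compact_edge_piece[OF d] cl(1)] compact_imp_closed[OF cl(2)] conn(2) c1 near[OF sub(2)]])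
  moreover have "?A \<union> Q1 \<union> Q2 = P" using P_rest[OF d] rest by blast
  ultimately have "q \<in> left d" using connected_component_face[OF left(1)[OF d] p(1)] by simp
  then show ?thesis using face_disjoint[OF left(1)[OF d] right(1)[OF d]] q(1) by blast
qed

definition unit_flow :: "dart \<Rightarrow> dart \<Rightarrow> real" where
  "unit_flow e f = (if f = e then 1 else 0) - (if f = opp D e then 1 else 0)"

lemma unit_flow_opp: "e \<in> darts D \<Longrightarrow> f \<in> darts D \<Longrightarrow> unit_flow e (opp D f) = - unit_flow e f"
proof -
  assume "e \<in> darts D" "f \<in> darts D"
  then have "opp D f = e \<longleftrightarrow> f = opp D e" "opp D f = opp D e \<longleftrightarrow> f = e" using opp_opp_D by metis+
  then show ?thesis by (simp add: unit_flow_def)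
qed

lemma unit_flow_divergence:
  assumes e: "e \<in> darts D"
  shows "(\<Sum>f\<in>darts_at v. unit_flow e f) = (if v = origin D e then 1 else 0) - (if v = origin D (opp D e) then 1 else 0)"
proof -
  have "(\<Sum>f\<in>darts_at v. unit_flow e f) = (if e \<in> darts_at v then 1 else 0) - (if opp D e \<in> darts_at v then 1 else 0)"
    unfolding unit_flow_def sum_subtractf using finite_darts_at by (simp add: sum.delta)
  then show ?thesis using e opp_in_darts[OF e] by (auto simp: darts_at_def)
qed

text \<open>
  The unit flows along the edges of a walk add up to a flow from its start to its end.
\<close>

lemma unit_flow_path:
  assumes d: "d \<in> darts D" and "u \<in> reachable_avoiding d"
  shows "\<exists>z. (\<forall>f\<in>darts D. z (opp D f) = - z f) \<and> z d = 0 \<and>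
    (\<forall>v. (\<Sum>f\<in>darts_at v. z f) = (if v = origin D (opp D d) then 1 else 0) - (if v = u then 1 else (0::real)))"
proof -
  have "(origin D (opp D d), u) \<in> {(origin D e, origin D (opp D e)) |e. e \<in> darts D - {d, opp D d}}\<^sup>*"
    using assms(2) by (simp add: reachable_avoiding_def)
  then show ?thesis
  proof (induction rule: rtrancl_induct)
    case base
    show ?case by (intro exI[of _ "\<lambda>_. 0"]) auto
  next
    case (step u w)
    then obtain z where z: "\<forall>f\<in>darts D. z (opp D f) = - z f" "z d = 0"
      "\<And>v. (\<Sum>f\<in>darts_at v. z f) = (if v = origin D (opp D d) then 1 else 0) - (if v = u then 1 else (0::real))"
      by blast
    obtain e where e: "e \<in> darts D" "e \<noteq> d" "e \<noteq> opp D d" "u = origin D e" "w = origin D (opp D e)"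
      using step.hyps(2) by blast
    have "unit_flow e d = 0" using e opp_opp_D[OF e(1)] by (auto simp: unit_flow_def)
    then show ?case
      using z unit_flow_opp[OF e(1)] unit_flow_divergence[OF e(1)] e(4,5)
      by (intro exI[of _ "\<lambda>f. z f + unit_flow e f"]) (auto simp: sum.distrib)
  qed
qed

lemma flow_through_non_bridge:
  assumes d: "d \<in> darts D" and "origin D d \<in> reachable_avoiding d"
  obtains z where "flow z" "z d = 1"
proof -
  obtain z where z: "\<forall>f\<in>darts D. z (opp D f) = - z f" "z d = 0"
    "\<And>v. (\<Sum>f\<in>darts_at v. z f) = (if v = origin D (opp D d) then 1 else 0) - (if v = origin D d then 1 else (0::real))"
    using unit_flow_path[OF assms] by blast
  have "flow (\<lambda>f. z f + unit_flow d f)"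
    unfolding flow_def using z unit_flow_opp[OF d] unit_flow_divergence[OF d] by (auto simp: sum.distrib)
  moreover have "z d + unit_flow d d = 1" using z(2) opp_neq_D[OF d] by (simp add: unit_flow_def)
  ultimately show ?thesis using that by blast
qed

text \<open>
  Both ends of the edge border the same pair of faces. If these differ, the edge is not a bridge and
  some flow passes through it. If the sides were exchanged between the ends, the jump of the winding
  function of this flow across the edge would change its sign.
\<close>

lemma left_along_edge:
  assumes d: "d \<in> darts D"
  shows "right (opp D d) = left d"
proof -
  have od: "opp D d \<in> darts D" using opp_in_darts d by blast
  have ends: "f = left d \<or> f = right d" if "f = left (opp D d) \<or> f = right (opp D d)" for f
    using faces_at_end_are_faces_at_start[OF d that] .
  have ends': "f = left (opp D d) \<or> f = right (opp D d)" if "f = left d \<or> f = right d" for f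
    using faces_at_end_are_faces_at_start[OF od, of f] that opp_opp_D[OF d] by simp
  show ?thesis
  proof (cases "left d = right d")
    case True
    then show ?thesis using ends by metis
  next
    case False
    then have "origin D d \<in> reachable_avoiding d" using bridge_sides_equal[OF d] by blast
    then obtain z where z: "flow z" "z d = 1" using flow_through_non_bridge[OF d] by blast
    show ?thesis
    proof (rule ccontr)
      assume "right (opp D d) \<noteq> left d"
      then have R: "right (opp D d) = right d" "left (opp D d) = left d" using ends ends' by metis+
      obtain p q where pq: "p \<in> left d" "q \<in> right d"
        using face_nonempty left(1)[OF d] right(1)[OF d] by blast
      have "winding z p - winding z q = of_real (2 * z d)" using winding_jump[OF z(1) d pq] .
      moreover have "winding z p - winding z q = of_real (2 * z (opp D d))"
        using winding_jump[OF z(1) od, of p q] pq R by simp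
      moreover have "z (opp D d) = - 1" using z d by (simp add: flow_def)
      ultimately show False using z(2) by simp
    qed
  qed
qed

lemma left_walk_step: "d \<in> darts D \<Longrightarrow> left (walk_step D d) = left d"
  using right(3)[OF opp_in_darts] left_along_edge unfolding walk_step_def by metis


section \<open>Euler's inequality\<close>

interpretation map: sextic_map "darts D" "opp D" "rot_cw D"
  by (rule sextic_map_darts)

lemma walk_eq: "map.walk = walk_step D"
  by (rule ext) (simp add: map.walk_def walk_step_def)

lemma left_on_orbit:
  assumes "d \<in> darts D" "e \<in> map.walk_orbit d"
  shows "left e = left d"
proof -
  have "left ((walk_step D ^^ k) d) = left d" for k
  proof (induction k)
    case (Suc k)
    have "(walk_step D ^^ k) d \<in> darts D" using map.walk_pow_in[OF assms(1)] unfolding walk_eq .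
    then show ?case using Suc left_walk_step by simp
  qed simp
  then show ?thesis using assms(2) unfolding map.walk_orbit_def walk_eq by blast
qed

lemma card_darts: "card (darts D) = 6 * card MP"
proof -
  have "card (\<Union>v\<in>MP. darts_at v) = (\<Sum>v\<in>MP. card (darts_at v))"
    by (rule card_UN_disjoint) (auto simp: finite_MP finite_darts_at, auto simp: darts_at_def)
  moreover have "(\<Union>v\<in>MP. darts_at v) = darts D" using origin_in_MP by (auto simp: darts_at_def)
  ultimately show ?thesis using card_darts_at by simp
qed

abbreviation "forward \<equiv> {d \<in> darts D. snd d}"

lemma snd_opp: "d \<in> darts D \<Longrightarrow> snd (opp D d) \<longleftrightarrow> \<not> snd d"
  using opp_eq by simp

lemma card_forward: "2 * card forward = card (darts D)"
proof -
  have "bij_betw (opp D) forward {d \<in> darts D. \<not> snd d}"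
    by (rule bij_betw_byWitness[where f' = "opp D"]) (use opp_opp_D opp_in_darts snd_opp in auto)
  then have "card forward = card {d \<in> darts D. \<not> snd d}" by (rule bij_betw_same_card)
  moreover have "card (darts D) = card forward + card {d \<in> darts D. \<not> snd d}"
    using finite_darts_D by (subst card_Un_disjoint[symmetric]) (auto intro!: arg_cong[where f = card])
  ultimately show ?thesis by simp
qed

definition extend_antisymmetrically :: "(dart \<Rightarrow> real) \<Rightarrow> dart \<Rightarrow> real" where
  "extend_antisymmetrically x d = (if snd d then x d else - x (opp D d))"

lemma sum_extend:
  assumes "T \<subseteq> darts D"
  shows "(\<Sum>d\<in>T. extend_antisymmetrically x d)
    = (\<Sum>e\<in>forward. ((if e \<in> T then 1 else 0) - (if opp D e \<in> T then 1 else 0)) * x e)"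
proof -
  let ?z = "extend_antisymmetrically x"
  have fin: "finite T" using assms finite_darts_D finite_subset by blast
  have T: "T = {d\<in>T. snd d} \<union> {d\<in>T. \<not> snd d}" by blast
  have "(\<Sum>d\<in>T. ?z d) = (\<Sum>d\<in>{d\<in>T. snd d}. ?z d) + (\<Sum>d\<in>{d\<in>T. \<not> snd d}. ?z d)"
    by (subst T, rule sum.union_disjoint) (use fin in auto)
  also have "(\<Sum>d\<in>{d\<in>T. snd d}. ?z d) = (\<Sum>e\<in>forward. (if e \<in> T then 1 else 0) * x e)"
    by (rule sum.mono_neutral_cong_left) (use assms finite_darts_D in \<open>auto simp: extend_antisymmetrically_def\<close>)
  also have "(\<Sum>d\<in>{d\<in>T. \<not> snd d}. ?z d) = (\<Sum>e\<in>{e\<in>forward. opp D e \<in> T}. - x e)"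
    by (rule sum.reindex_bij_witness[of _ "opp D" "opp D"])
      (use assms opp_opp_D opp_in_darts snd_opp in \<open>auto simp: extend_antisymmetrically_def subset_iff\<close>)
  also have "\<dots> = (\<Sum>e\<in>forward. - ((if opp D e \<in> T then 1 else 0) * x e))"
    by (rule sum.mono_neutral_cong_left) (use finite_darts_D in auto)
  finally show ?thesis by (simp add: left_diff_distrib sum_subtractf sum_negf)
qed

text \<open>
  Were there fewer faces, there would be a non-zero flow orthogonal to all boundary walks, since this is a
  condition on \<open>3 V\<close> coefficients given by less than \<open>3 V\<close> equations. But the values of its winding
  function on the faces write a flow as a combination of boundary walks; so it would be orthogonal
  to itself.
\<close>

lemma euler_inequality:
  assumes ne: "MP \<noteq> {}"
  shows "card (darts D) < 3 * card map.orbits"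
proof (rule ccontr)
  assume "\<not> card (darts D) < 3 * card map.orbits"
  then have few: "card map.orbits \<le> 2 * card MP" using card_darts by simp
  have "card MP > 0" using ne finite_MP by (simp add: card_gt_0_iff)
  then have "darts D \<noteq> {}" using card_darts by fastforce
  then obtain W0 where W0: "W0 \<in> map.orbits" unfolding map.orbits_def by blast
  \<comment> \<open>One boundary walk may be left out: every edge occurs in both directions, so the equations of all
    boundary walks add up to a trivial one.\<close>
  define A where "A = darts_at ` MP \<union> (map.orbits - {W0})"
  have finA: "finite A" unfolding A_def using finite_MP map.finite_orbits by simp
  have "card A \<le> card (darts_at ` MP) + card (map.orbits - {W0})" unfolding A_def by (rule card_Un_le)
  also have "\<dots> \<le> card MP + (card map.orbits - 1)"
    using card_image_le[OF finite_MP, of darts_at] W0 map.finite_orbits by (simp add: card_Diff_singleton)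
  also have "\<dots> < card forward" using few card_forward card_darts \<open>card MP > 0\<close> by linarith
  finally have lt: "card A < card forward" .
  have "finite forward" using finite_darts_D by simp
  from homogeneous_system_nontrivial_solution[OF finA this lt,
        of "\<lambda>T e. (if e \<in> T then 1 else 0) - (if opp D e \<in> T then 1 else 0)"]
  obtain x :: "dart \<Rightarrow> real" where x: "\<exists>e\<in>forward. x e \<noteq> 0"
    "\<And>T. T \<in> A \<Longrightarrow> (\<Sum>e\<in>forward. ((if e \<in> T then 1 else 0) - (if opp D e \<in> T then 1 else 0)) * x e) = 0"
    by blast
  define z where "z = extend_antisymmetrically x"
  have AS: "T \<subseteq> darts D" if "T \<in> A" for T
    using that map.orbit_of_member unfolding A_def by (auto simp: darts_at_def)
  have z0: "(\<Sum>d\<in>T. z d) = 0" if "T \<in> A" for T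
    unfolding z_def sum_extend[OF AS[OF that]] using x(2)[OF that] .
  have anti: "z (opp D d) = - z d" if "d \<in> darts D" for d
    using snd_opp[OF that] opp_opp_D[OF that] by (simp add: z_def extend_antisymmetrically_def)
  have flow: "flow z" unfolding flow_def using anti z0 by (auto simp: A_def)
  have orb0: "(\<Sum>d\<in>W. z d) = 0" if "W \<in> map.orbits" for W
  proof (cases "W = W0")
    case True
    have "(\<Sum>d\<in>darts D. z d) = (\<Sum>d\<in>darts D. - z d)"
      by (rule sum.reindex_bij_witness[of _ "opp D" "opp D"]) (use opp_opp_D opp_in_darts anti in auto)
    then have "0 = (\<Sum>d\<in>darts D. z d)" by (simp add: sum_negf)
    also have "\<dots> = (\<Sum>W\<in>map.orbits. \<Sum>d\<in>W. z d)" by (rule map.sum_over_orbits)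
    also have "\<dots> = (\<Sum>d\<in>W0. z d) + (\<Sum>W\<in>map.orbits - {W0}. \<Sum>d\<in>W. z d)"
      using W0 map.finite_orbits by (simp add: sum.remove)
    also have "(\<Sum>W\<in>map.orbits - {W0}. \<Sum>d\<in>W. z d) = 0" by (rule sum.neutral) (use z0 in \<open>auto simp: A_def\<close>)
    finally show ?thesis using True by simp
  next
    case False
    then show ?thesis using z0 that by (simp add: A_def)
  qed
  define \<omega> where "\<omega> d = winding z (SOME p. p \<in> left d)" for d
  have some: "(SOME p. p \<in> left d) \<in> left d" if "d \<in> darts D" for d
    using face_nonempty[OF left(1)[OF that]] by (rule someI_ex)
  have \<omega>: "of_real (2 * z d) = \<omega> d - \<omega> (opp D d)" if d: "d \<in> darts D" for d
  proof -
    have "right d = left (opp D d)" using left_along_edge[OF opp_in_darts[OF d]] opp_opp_D[OF d] by simp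
    then have "(SOME p. p \<in> left (opp D d)) \<in> right d" using some[OF opp_in_darts[OF d]] by simp
    from winding_jump[OF flow d some[OF d] this] show ?thesis by (simp add: \<omega>_def)
  qed
  have orth: "(\<Sum>d\<in>darts D. of_real (z d) * \<omega> d) = 0"
  proof -
    have "(\<Sum>d\<in>W. of_real (z d) * \<omega> d) = 0" if W: "W \<in> map.orbits" for W
    proof -
      obtain d0 where d0: "d0 \<in> darts D" "W = map.walk_orbit d0" using W by (auto simp: map.orbits_def)
      have "(\<Sum>d\<in>W. of_real (z d) * \<omega> d) = (\<Sum>d\<in>W. of_real (z d) * \<omega> d0)"
        using left_on_orbit[OF d0(1)] d0(2) by (intro sum.cong) (auto simp: \<omega>_def)
      also have "\<dots> = of_real (\<Sum>d\<in>W. z d) * \<omega> d0" by (simp add: sum_distrib_right)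
      finally show ?thesis using orb0[OF W] by (simp del: of_real_sum)
    qed
    then show ?thesis unfolding map.sum_over_orbits by simp
  qed
  have orth': "(\<Sum>d\<in>darts D. of_real (z d) * \<omega> (opp D d)) = 0"
  proof -
    have "(\<Sum>d\<in>darts D. of_real (z d) * \<omega> (opp D d)) = (\<Sum>d\<in>darts D. - (of_real (z d) * \<omega> d))"
      by (rule sum.reindex_bij_witness[of _ "opp D" "opp D"]) (use opp_opp_D opp_in_darts anti in auto)
    then show ?thesis using orth by (simp add: sum_negf)
  qed
  have "complex_of_real (\<Sum>d\<in>darts D. 2 * (z d)\<^sup>2) = (\<Sum>d\<in>darts D. of_real (z d) * of_real (2 * z d))"
    by (simp add: power2_eq_square algebra_simps)
  also have "\<dots> = (\<Sum>d\<in>darts D. of_real (z d) * \<omega> d - of_real (z d) * \<omega> (opp D d))"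
    by (intro sum.cong refl) (simp only: \<omega> right_diff_distrib)
  also have "\<dots> = 0" using orth orth' by (simp add: sum_subtractf)
  finally have "(\<Sum>d\<in>darts D. 2 * (z d)\<^sup>2) = 0" by (simp del: of_real_sum)
  then have "\<forall>d\<in>darts D. z d = 0" using finite_darts_D by (subst (asm) sum_nonneg_eq_0_iff) auto
  then show False using x(1) by (auto simp: z_def extend_antisymmetrically_def)
qed


section \<open>Polygons and tangles\<close>

lemma polygon_of_dart:
  assumes d: "d \<in> darts D"
  shows "(left d, map.walk_orbit d) \<in> gons D (card (map.walk_orbit d))"
proof -
  have "on_left D e (left d)" if "e \<in> map.walk_orbit d" for e
    using left(2)[of e] left_on_orbit[OF d that] map.walk_orbit_subset[OF d] that by auto
  then show ?thesis
    unfolding gons_def boundary_walk_def using left(1)[OF d] d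
    by (auto simp: map.walk_orbit_def walk_eq)
qed

text \<open>
  A boundary walk is a set of darts and determines its face, which lies on the left of each of them.
\<close>

lemma finite_gons: "finite (gons D n)"
proof (rule finite_subset)
  show "gons D n \<subseteq> (\<lambda>W. (left (SOME d. d \<in> W), W)) ` Pow (darts D)"
  proof clarify
    fix f W assume "(f, W) \<in> gons D n"
    then have fW: "f \<in> faces D" "\<exists>d\<in>darts D. W = range (\<lambda>k. (walk_step D ^^ k) d)" "\<forall>d\<in>W. on_left D d f"
      by (auto simp: gons_def boundary_walk_def)
    then obtain d where d: "d \<in> darts D" "W = map.walk_orbit d" by (auto simp: map.walk_orbit_def walk_eq)
    have W: "W \<subseteq> darts D" "(SOME d. d \<in> W) \<in> W"
      using map.walk_orbit_subset[OF d(1)] map.walk_orbit_self[of d] d(2) by (auto intro: someI)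
    then have "f = left (SOME d. d \<in> W)" using left_eqI[OF fW(1)] fW(3) by auto
    then show "(f, W) \<in> (\<lambda>W. (left (SOME d. d \<in> W), W)) ` Pow (darts D)" using W by auto
  qed
  show "finite ((\<lambda>W. (left (SOME d. d \<in> W), W)) ` Pow (darts D))" using finite_darts_D by simp
qed

lemma disjoint_number_positive:
  assumes "finite \<T>" "T \<in> \<T>"
  shows "disjoint_number \<T> \<ge> 1"
proof -
  let ?C = "{card \<F> |\<F>. \<F> \<subseteq> \<T> \<and> finite \<F> \<and> pairwise disjnt \<F>}"
  have "?C \<subseteq> card ` Pow \<T>" by blast
  then have "finite ?C" using assms(1) finite_subset by blast
  moreover have "1 \<in> ?C" using assms(2) by (intro CollectI exI[of _ "{T}"]) auto
  ultimately show ?thesis unfolding disjoint_number_def by (rule Max_ge)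
qed

lemma finite_tangles: "finite (tangles1 D)" "finite (tangles2 D)" "finite (tangles3 D)" "finite (tangles4 D)"
proof -
  have "tangles1 D \<subseteq> (\<lambda>p. closure (fst p)) ` gons D 1" unfolding tangles1_def by force
  then show "finite (tangles1 D)" using finite_gons finite_surj by blast
  have "tangles2 D \<subseteq> (\<lambda>(p, q). closure (fst p) \<union> closure (fst q)) ` (gons D 2 \<times> gons D 2)"
    unfolding tangles2_def by force
  then show "finite (tangles2 D)" using finite_gons finite_surj by (metis finite_cartesian_product)
  have "tangles3 D \<subseteq> (\<lambda>(p, q). closure (fst p) \<union> closure (fst q)) ` (gons D 2 \<times> gons D 3)"
    unfolding tangles3_def by force
  then show "finite (tangles3 D)" using finite_gons finite_surj by (metis finite_cartesian_product)
  have "tangles4 D \<subseteq> (\<lambda>(p, q, r). closure (fst p) \<union> closure (fst q) \<union> closure (fst r)) ` (gons D 2 \<times> gons D 2 \<times> gons D 2)"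
  proof
    fix T assume "T \<in> tangles4 D"
    then show "T \<in> (\<lambda>(p, q, r). closure (fst p) \<union> closure (fst q) \<union> closure (fst r)) ` (gons D 2 \<times> gons D 2 \<times> gons D 2)"
      unfolding tangles4_def mem_Collect_eq
    proof (elim exE conjE)
      fix f0 f1 f2 W0 W1 W2
      assume "T = closure f0 \<union> closure f1 \<union> closure f2" "{(f0, W0), (f1, W1), (f2, W2)} \<subseteq> gons D 2"
      then show ?thesis by (intro image_eqI[of _ _ "((f0, W0), (f1, W1), (f2, W2))"]) auto
    qed
  qed
  then show "finite (tangles4 D)" using finite_gons finite_surj by (metis finite_cartesian_product)
qed

lemma tangles2I:
  assumes "(f, W) \<in> gons D 2" "(g, X) \<in> gons D 2" "W \<noteq> X" "d \<in> W" "opp D d \<in> X"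
    "origin D d \<noteq> origin D (opp D d)"
  shows "closure f \<union> closure g \<in> tangles2 D"
  unfolding tangles2_def mem_Collect_eq
  by (rule exI[of _ f], rule exI[of _ g], rule exI[of _ W], rule exI[of _ X], rule exI[of _ d], intro conjI)
    (use assms in simp_all)

lemma tangles3I:
  assumes "(f, W) \<in> gons D 2" "(g, X) \<in> gons D 3" "d \<in> W" "opp D d \<in> X"
  shows "closure f \<union> closure g \<in> tangles3 D"
  unfolding tangles3_def mem_Collect_eq
  by (rule exI[of _ f], rule exI[of _ g], rule exI[of _ W], rule exI[of _ X], rule exI[of _ d], intro conjI)
    (use assms in simp_all)

lemma tangles4I:
  assumes "(f0, W0) \<in> gons D 2" "(f1, W1) \<in> gons D 2" "(f2, W2) \<in> gons D 2" "distinct [W0, W1, W2]"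
    "4 \<le> m" "(g, X) \<in> gons D m" "d \<in> X" "opp D d \<in> W0" "opp D (walk_step D d) \<in> W1"
    "opp D (walk_step D (walk_step D d)) \<in> W2"
  shows "closure f0 \<union> closure f1 \<union> closure f2 \<in> tangles4 D"
  unfolding tangles4_def mem_Collect_eq
  by (rule exI[of _ f0], rule exI[of _ f1], rule exI[of _ f2], rule exI[of _ W0], rule exI[of _ W1], rule exI[of _ W2], rule exI[of _ g], rule exI[of _ X], rule exI[of _ m], rule exI[of _ d], intro conjI)
    (use assms in simp_all)

lemma tangle_exists:
  assumes ne: "MP \<noteq> {}"
  shows "t1 D + t2 D + t3 D + t4 D \<ge> 1"
proof (cases "\<exists>d\<in>darts D. card (map.walk_orbit d) = 1")
  case True
  then obtain d where "d \<in> darts D" "card (map.walk_orbit d) = 1" by blast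
  then have "closure (left d) \<in> tangles1 D" using polygon_of_dart[of d] unfolding tangles1_def by auto
  then show ?thesis using disjoint_number_positive[OF finite_tangles(1)] unfolding t1_def by fastforce
next
  case no_monogon: False
  then have cases: "(\<exists>d\<in>darts D. card (map.walk_orbit d) = 2 \<and> card (map.walk_orbit (opp D d)) \<in> {2, 3}) \<or>
    (\<exists>d\<in>darts D. card (map.walk_orbit d) \<ge> 4 \<and> card (map.walk_orbit (opp D d)) = 2 \<and>
       card (map.walk_orbit (opp D (walk_step D d))) = 2 \<and>
       card (map.walk_orbit (opp D (walk_step D (walk_step D d)))) = 2)"
    using map.discharging[OF euler_inequality[OF ne]] unfolding walk_eq by blast
  show ?thesis
  proof (cases "\<exists>d\<in>darts D. card (map.walk_orbit d) = 2 \<and> card (map.walk_orbit (opp D d)) \<in> {2, 3}")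
    case True
    then obtain d where d: "d \<in> darts D" "card (map.walk_orbit d) = 2" "card (map.walk_orbit (opp D d)) \<in> {2, 3}" by blast
    have od: "opp D d \<in> darts D" using opp_in_darts d by blast
    let ?T = "closure (left d) \<union> closure (left (opp D d))"
    show ?thesis
    proof (cases "card (map.walk_orbit (opp D d)) = 2")
      case True
      have "origin D d \<noteq> origin D (opp D d)"
      proof
        assume "origin D d = origin D (opp D d)"
        then have "opp D d \<in> darts_at (origin D d)" using od by (simp add: darts_at_def)
        then obtain k where "(rot_cw D ^^ k) d = opp D d" using rot_cw_cyclic(3)[OF d(1)] by blast
        then show False using map.adjacent_bigons_at_one_vertex[OF d(1,2) True] no_monogon by blast
      qed
      moreover have "map.walk_orbit d \<noteq> map.walk_orbit (opp D d)" using map.adjacent_bigons_distinct[OF d(1,2)] .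
      moreover have "(left d, map.walk_orbit d) \<in> gons D 2" "(left (opp D d), map.walk_orbit (opp D d)) \<in> gons D 2"
        using polygon_of_dart[OF d(1)] polygon_of_dart[OF od] by (simp_all only: d(2) True)
      ultimately have "?T \<in> tangles2 D"
        using tangles2I[of _ "map.walk_orbit d" _ "map.walk_orbit (opp D d)" d] map.walk_orbit_self by blast
      then show ?thesis using disjoint_number_positive[OF finite_tangles(2)] unfolding t2_def by fastforce
    next
      case False
      then have "card (map.walk_orbit (opp D d)) = 3" using d(3) by blast
      then have "(left d, map.walk_orbit d) \<in> gons D 2" "(left (opp D d), map.walk_orbit (opp D d)) \<in> gons D 3"
        using polygon_of_dart[OF d(1)] polygon_of_dart[OF od] by (simp_all only: d(2))
      then have "?T \<in> tangles3 D"
        using tangles3I[of _ "map.walk_orbit d" _ "map.walk_orbit (opp D d)" d] map.walk_orbit_self by blast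
      then show ?thesis using disjoint_number_positive[OF finite_tangles(3)] unfolding t3_def by fastforce
    qed
  next
    case False
    then obtain d where d: "d \<in> darts D" "card (map.walk_orbit d) \<ge> 4" "card (map.walk_orbit (opp D d)) = 2"
      "card (map.walk_orbit (opp D (walk_step D d))) = 2"
      "card (map.walk_orbit (opp D (walk_step D (walk_step D d)))) = 2" using cases by blast
    let ?a = "opp D d" and ?b = "opp D (walk_step D d)" and ?c = "opp D (walk_step D (walk_step D d))"
    have abc: "?a \<in> darts D" "?b \<in> darts D" "?c \<in> darts D"
      using d(1) map.walk_in opp_in_darts unfolding walk_eq by blast+
    have dist: "distinct [map.walk_orbit ?a, map.walk_orbit ?b, map.walk_orbit ?c]"
      using map.three_consecutive_bigons_distinct[OF d(1,2,3)] d(4,5) no_monogon unfolding walk_eq by blast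
    have "(left ?a, map.walk_orbit ?a) \<in> gons D 2" "(left ?b, map.walk_orbit ?b) \<in> gons D 2"
      "(left ?c, map.walk_orbit ?c) \<in> gons D 2"
      using polygon_of_dart[OF abc(1)] polygon_of_dart[OF abc(2)] polygon_of_dart[OF abc(3)] by (simp_all only: d(3-5))
    then have "closure (left ?a) \<union> closure (left ?b) \<union> closure (left ?c) \<in> tangles4 D"
      by (rule tangles4I[OF _ _ _ dist d(2) polygon_of_dart[OF d(1)]]) (rule map.walk_orbit_self)+
    then show ?thesis using disjoint_number_positive[OF finite_tangles(4)] unfolding t4_def by fastforce
  qed
qed

end

lemma fst_C1_differentiable:
  fixes \<gamma> :: "real \<Rightarrow> R3"
  assumes "\<gamma> C1_differentiable_on UNIV"
  shows "(\<lambda>s. fst (\<gamma> s)) C1_differentiable_on UNIV"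
proof -
  obtain \<gamma>' where g: "\<And>s. (\<gamma> has_vector_derivative \<gamma>' s) (at s)" "continuous_on UNIV \<gamma>'"
    using assms unfolding C1_differentiable_on_def by blast
  have "((\<lambda>s. fst (\<gamma> s)) has_vector_derivative fst (\<gamma>' s)) (at s)" for s
    using bounded_linear.has_vector_derivative[OF bounded_linear_fst g(1)] .
  then show ?thesis
    unfolding C1_differentiable_on_def using continuous_on_fst[OF g(2)]
    by (intro exI[of _ "\<lambda>s. fst (\<gamma>' s)"]) simp
qed

lemma triple_projection_of_diagram:
  assumes "triple_crossing_diagram_of D K"
  shows "triple_projection D"
proof -
  obtain \<gamma> where g: "link_param (ncomp D) \<gamma>" "projects_to \<gamma> D" "triple_point_projection D"
    using assms unfolding triple_crossing_diagram_of_def by blast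
  have c: "curve D i = (\<lambda>s. fst (\<gamma> i s))" if "i < ncomp D" for i
    using g(2) that unfolding projects_to_def by blast
  show ?thesis
  proof
    fix i s assume i: "i < ncomp D"
    then have k: "knot_param (\<gamma> i)" using g(1) unfolding link_param_def by blast
    show "curve D i (s + 1) = curve D i s" using k unfolding c[OF i] knot_param_def by simp
    show "curve D i C1_differentiable_on UNIV"
      unfolding c[OF i] using k fst_C1_differentiable unfolding knot_param_def by blast
  qed (rule g(3))
qed


theorem theorem3p3:
  fixes K :: "R3 set" and D :: diagram
  assumes "(is_knot K \<and> \<not> trivial_knot K) \<or> (\<exists>n\<ge>2. is_link n K \<and> \<not> split_link K)"
    and "triple_crossing_diagram_of D K"
  shows "t1 D + t2 D + t3 D + t4 D \<ge> 1"
proof -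
  interpret triple_projection D by (rule triple_projection_of_diagram[OF assms(2)])
  show ?thesis by (rule tangle_exists[OF multiple_points_exist[OF assms]])
qed

end
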